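(* Let $m\ge 1$, $l\ge 1$, let $M^{2m+2l}(c)$ be a Kaehler manifold of complex dimension $m+l$ and constant holomorphic sectional curvature $c$, and let $F^{2m}$ be a Kaehler submanifold of complex dimension $m$ in $M^{2m+2l}(c)$. If the second fundamental form $b$ of $F^{2m}$ is recurrent (that is, $b\neq 0$ and there exists a 1-form $\mu$ on $F^{2m}$ with $\overline\nabla b=\mu\otimes b$), then the tensor of normal curvature $R^\bot$ of $F^{2m}$ is nonzero, $R^\bot\neq 0$, and it is parallel, i.e. $\overline\nabla R^\bot\equiv 0$.
   Context: $M^{2m+2l}$ carries an almost complex structure $J$ and a Riemannian metric $\widetilde g$ with $\widetilde g(JX,JY)=\widetilde g(X,Y)$ and $\widetilde\nabla J=0$, where $\widetilde\nabla$ is the Levi-Civita connection of $\widetilde g$ (Kaehler manifold). Constant holomorphic sectional curvature $c$ means that the curvature tensor satisfies $$\widetilde R(X,Y)Z=\tfrac{c}{4}\big(\widetilde g(Y,Z)X-\widetilde g(X,Z)Y+\widetilde g(JY,Z)JX-\widetilde g(JX,Z)JY+2\widetilde g(X,JY)JZ\big).$$ A submanifold $F^{2m}$ is a Kaehler submanifold if $JX\in TF^{2m}$ for every $X\in TF^{2m}$; it carries the induced metric $g$ with Levi-Civita connection $\nabla$. The normal bundle is $T^\bot F^{2m}$. The second fundamental form $b$, the operators $A_\xi$ and the normal connection $D$ are defined by $\widetilde\nabla_XY=\nabla_XY+b(X,Y)$ and $\widetilde\nabla_X\xi=-A_\xi X+D_X\xi$ for $X,Y$ tangent and $\xi$ normal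 to $F^{2m}$ (tangential part first/second accordingly). $R^\bot$ is the curvature tensor of $D$: $R^\bot(X,Y)\xi=D_XD_Y\xi-D_YD_X\xi-D_{[X,Y]}\xi$. $\overline\nabla=\nabla\oplus D$ is the van der Waerden–Bortolotti connection: $$(\overline\nabla_Xb)(Y,Z)=D_X(b(Y,Z))-b(\nabla_XY,Z)-b(Y,\nabla_XZ),$$ $$(\overline\nabla_XR^\bot)(Y,Z)\xi=D_X(R^\bot(Y,Z)\xi)-R^\bot(\nabla_XY,Z)\xi-R^\bot(Y,\nabla_XZ)\xi-R^\bot(Y,Z)D_X\xi.$$ The condition $\overline\nabla b=\mu\otimes b$ means $(\overline\nabla_Xb)(Y,Z)=\mu(X)\,b(Y,Z)$ for all tangent $X,Y,Z$. Here $b\ne0$ and $R^\bot\neq0$ mean not identically zero. *)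

theory Defs
  imports "HOL-Analysis.Analysis"
begin

section \<open>Smooth maps between Euclidean spaces\<close>

text \<open>Only meaningful for open \<open>S\<close>, as derivatives are taken at \<open>x\<close>, not within \<open>S\<close>.\<close>

primrec Ck_on :: "nat \<Rightarrow> ('a::euclidean_space \<Rightarrow> 'b::euclidean_space) \<Rightarrow> 'a set \<Rightarrow> bool" where
  "Ck_on 0 f S \<longleftrightarrow> continuous_on S f"
| "Ck_on (Suc k) f S \<longleftrightarrow>
     (\<forall>x\<in>S. f differentiable (at x)) \<and> (\<forall>v. Ck_on k (\<lambda>x. frechet_derivative f (at x) v) S)"

definition smooth_on :: "'a set \<Rightarrow> ('a::euclidean_space \<Rightarrow> 'b::euclidean_space) \<Rightarrow> bool" where
  "smooth_on S f \<longleftrightarrow> (\<forall>k. Ck_on k f S)"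


section \<open>Smooth manifolds\<close>

text \<open>A manifold is a Hausdorff, second countable type \<open>'p\<close> with a smooth atlas \<open>A\<close> (not
  necessarily maximal) modelled on a Euclidean space \<open>'e\<close>; its dimension is \<open>DIM('e)\<close>.\<close>

type_synonym ('p, 'e) chart = "'p set \<times> ('p \<Rightarrow> 'e)"
type_synonym ('p, 'e) atlas = "('p, 'e) chart set"

definition chart_inv :: "('p, 'e) chart \<Rightarrow> 'e \<Rightarrow> 'p" where
  "chart_inv c = inv_into (fst c) (snd c)"

definition smooth_manifold ::
  "('p::{t2_space,second_countable_topology}, 'e::euclidean_space) atlas \<Rightarrow> bool" where
  "smooth_manifold A \<longleftrightarrow>
     (\<Union>c\<in>A. fst c) = UNIV \<and>
     (\<forall>c\<in>A. open (fst c) \<and> open (snd c ` fst c) \<and>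
        homeomorphism (fst c) (snd c ` fst c) (snd c) (chart_inv c)) \<and>
     (\<forall>c\<in>A. \<forall>d\<in>A. smooth_on (snd c ` (fst c \<inter> fst d)) (snd d \<circ> chart_inv c))"

text \<open>\<open>smooth_fun A U h\<close>: the function \<open>h\<close> is smooth on the open set \<open>U\<close>.\<close>

definition smooth_fun ::
  "('p, 'e::euclidean_space) atlas \<Rightarrow> 'p set \<Rightarrow> ('p \<Rightarrow> 'b::euclidean_space) \<Rightarrow> bool" where
  "smooth_fun A U h \<longleftrightarrow> (\<forall>c\<in>A. smooth_on (snd c ` (fst c \<inter> U)) (h \<circ> chart_inv c))"

text \<open>The tangent space at \<open>p\<close> is the model space \<open>'e\<close> itself: a vector \<open>v :: 'e\<close> at \<open>p\<close> stands
  for the tangent vector with components \<open>v\<close> in a fixed preferred chart around \<open>p\<close>. Since the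
  preferred chart varies with \<open>p\<close>, fields must never be differentiated as functions
  \<open>'p \<Rightarrow> 'e\<close>; one first passes to their components in one chart (\<open>comps\<close>).\<close>

definition chart_at :: "('p, 'e) atlas \<Rightarrow> 'p \<Rightarrow> ('p, 'e) chart" where
  "chart_at A p = (SOME c. c \<in> A \<and> p \<in> fst c)"

text \<open>Derivative at \<open>p\<close> of a vector-valued function along the tangent vector \<open>v\<close> at \<open>p\<close>.\<close>

definition dird ::
  "('p, 'e::euclidean_space) atlas \<Rightarrow> ('p \<Rightarrow> 'b::euclidean_space) \<Rightarrow> 'p \<Rightarrow> 'e \<Rightarrow> 'b" where
  "dird A h p v =
     frechet_derivative (h \<circ> chart_inv (chart_at A p)) (at (snd (chart_at A p) p)) v"

text \<open>Components in the chart \<open>d\<close> of the tangent vector \<open>v\<close> at \<open>p\<close>.\<close>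

definition comps ::
  "('p, 'e::euclidean_space) atlas \<Rightarrow> ('p, 'e) chart \<Rightarrow> 'p \<Rightarrow> 'e \<Rightarrow> 'e" where
  "comps A d p v = dird A (snd d) p v"

text \<open>The vector field on the domain of \<open>d\<close> with constant components \<open>u\<close> in \<open>d\<close>.\<close>

definition coord_field ::
  "('p, 'e::euclidean_space) atlas \<Rightarrow> ('p, 'e) chart \<Rightarrow> 'e \<Rightarrow> 'p \<Rightarrow> 'e" where
  "coord_field A d u p =
     frechet_derivative (snd (chart_at A p) \<circ> chart_inv d) (at (snd d p)) u"

definition smooth_map ::
  "('q::topological_space, 'f::euclidean_space) atlas \<Rightarrow>
   ('p::topological_space, 'e::euclidean_space) atlas \<Rightarrow> ('q \<Rightarrow> 'p) \<Rightarrow> bool" where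
  "smooth_map B A f \<longleftrightarrow>
     continuous_on UNIV f \<and> (\<forall>d\<in>A. smooth_fun B (f -` fst d) (snd d \<circ> f))"

text \<open>The differential of \<open>f\<close> at \<open>q\<close>, from the tangent space at \<open>q\<close> to that at \<open>f q\<close>.\<close>

definition dmap ::
  "('q, 'f::euclidean_space) atlas \<Rightarrow> ('p, 'e::euclidean_space) atlas \<Rightarrow> ('q \<Rightarrow> 'p) \<Rightarrow>
   'q \<Rightarrow> 'f \<Rightarrow> 'e" where
  "dmap B A f q v = dird B (snd (chart_at A (f q)) \<circ> f) q v"

definition immersion ::
  "('q::topological_space, 'f::euclidean_space) atlas \<Rightarrow>
   ('p::topological_space, 'e::euclidean_space) atlas \<Rightarrow> ('q \<Rightarrow> 'p) \<Rightarrow> bool" where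
  "immersion B A f \<longleftrightarrow> smooth_map B A f \<and> (\<forall>q. inj (dmap B A f q))"

text \<open>Smooth vector fields along \<open>f\<close>, defined on the open set \<open>U\<close>; values outside \<open>U\<close> are
  irrelevant.\<close>

definition field_along ::
  "('q, 'f::euclidean_space) atlas \<Rightarrow> ('p, 'e::euclidean_space) atlas \<Rightarrow> ('q \<Rightarrow> 'p) \<Rightarrow>
   'q set \<Rightarrow> ('q \<Rightarrow> 'e) \<Rightarrow> bool" where
  "field_along B A f U V \<longleftrightarrow>
     (\<forall>d\<in>A. smooth_fun B (U \<inter> f -` fst d) (\<lambda>q. comps A d (f q) (V q)))"

definition vector_field ::
  "('p, 'e::euclidean_space) atlas \<Rightarrow> 'p set \<Rightarrow> ('p \<Rightarrow> 'e) \<Rightarrow> bool" where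
  "vector_field A U X \<longleftrightarrow> (\<forall>d\<in>A. smooth_fun A (U \<inter> fst d) (\<lambda>p. comps A d p (X p)))"

definition one_form ::
  "('p::topological_space, 'e::euclidean_space) atlas \<Rightarrow> ('p \<Rightarrow> 'e \<Rightarrow> real) \<Rightarrow> bool" where
  "one_form A \<mu> \<longleftrightarrow>
     (\<forall>p. linear (\<mu> p)) \<and>
     (\<forall>U X. open U \<and> vector_field A U X \<longrightarrow> smooth_fun A U (\<lambda>p. \<mu> p (X p)))"

definition lie_bracket ::
  "('p, 'e::euclidean_space) atlas \<Rightarrow> ('p \<Rightarrow> 'e) \<Rightarrow> ('p \<Rightarrow> 'e) \<Rightarrow> 'p \<Rightarrow> 'e" where
  "lie_bracket A X Y p =
     dird A (\<lambda>p'. comps A (chart_at A p) p' (Y p')) p (X p)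
     - dird A (\<lambda>p'. comps A (chart_at A p) p' (X p')) p (Y p)"


section \<open>Riemannian metrics, connections and Kaehler manifolds\<close>

definition riemannian_metric ::
  "('p::topological_space, 'e::euclidean_space) atlas \<Rightarrow> ('p \<Rightarrow> 'e \<Rightarrow> 'e \<Rightarrow> real) \<Rightarrow> bool" where
  "riemannian_metric A g \<longleftrightarrow>
     (\<forall>p. bilinear (g p) \<and> (\<forall>u v. g p u v = g p v u) \<and> (\<forall>v. v \<noteq> 0 \<longrightarrow> g p v v > 0)) \<and>
     (\<forall>U X Y. open U \<and> vector_field A U X \<and> vector_field A U Y \<longrightarrow>
        smooth_fun A U (\<lambda>p. g p (X p) (Y p)))"

text \<open>A connection acts on vector fields defined on arbitrary open sets, compatibly with
  restriction: this is the first clause below, the field being constrained only on \<open>U\<close>.\<close>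

definition connection ::
  "('p::topological_space, 'e::euclidean_space) atlas \<Rightarrow>
   (('p \<Rightarrow> 'e) \<Rightarrow> ('p \<Rightarrow> 'e) \<Rightarrow> 'p \<Rightarrow> 'e) \<Rightarrow> bool" where
  "connection A nabla \<longleftrightarrow>
     (\<forall>U X Y. open U \<and> vector_field A U X \<and> vector_field A U Y \<longrightarrow>
        (\<forall>X' Y'. (\<forall>p\<in>U. X' p = X p \<and> Y' p = Y p) \<longrightarrow> (\<forall>p\<in>U. nabla X' Y' p = nabla X Y p)) \<and>
        vector_field A U (nabla X Y) \<and>
        (\<forall>X'. vector_field A U X' \<longrightarrow>
           (\<forall>p\<in>U. nabla (\<lambda>p. X p + X' p) Y p = nabla X Y p + nabla X' Y p)) \<and>
        (\<forall>Y'. vector_field A U Y' \<longrightarrow>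
           (\<forall>p\<in>U. nabla X (\<lambda>p. Y p + Y' p) p = nabla X Y p + nabla X Y' p)) \<and>
        (\<forall>h. smooth_fun A U h \<longrightarrow>
           (\<forall>p\<in>U. nabla (\<lambda>p. h p *\<^sub>R X p) Y p = h p *\<^sub>R nabla X Y p \<and>
                   nabla X (\<lambda>p. h p *\<^sub>R Y p) p = dird A h p (X p) *\<^sub>R Y p + h p *\<^sub>R nabla X Y p)))"

definition torsion_free ::
  "('p::topological_space, 'e::euclidean_space) atlas \<Rightarrow>
   (('p \<Rightarrow> 'e) \<Rightarrow> ('p \<Rightarrow> 'e) \<Rightarrow> 'p \<Rightarrow> 'e) \<Rightarrow> bool" where
  "torsion_free A nabla \<longleftrightarrow>
     (\<forall>U X Y. open U \<and> vector_field A U X \<and> vector_field A U Y \<longrightarrow>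
        (\<forall>p\<in>U. nabla X Y p - nabla Y X p = lie_bracket A X Y p))"

definition metric_connection ::
  "('p::topological_space, 'e::euclidean_space) atlas \<Rightarrow> ('p \<Rightarrow> 'e \<Rightarrow> 'e \<Rightarrow> real) \<Rightarrow>
   (('p \<Rightarrow> 'e) \<Rightarrow> ('p \<Rightarrow> 'e) \<Rightarrow> 'p \<Rightarrow> 'e) \<Rightarrow> bool" where
  "metric_connection A g nabla \<longleftrightarrow>
     (\<forall>U X Y Z. open U \<and> vector_field A U X \<and> vector_field A U Y \<and> vector_field A U Z \<longrightarrow>
        (\<forall>p\<in>U. dird A (\<lambda>p. g p (Y p) (Z p)) p (X p)
               = g p (nabla X Y p) (Z p) + g p (Y p) (nabla X Z p)))"

definition levi_civita ::
  "('p::topological_space, 'e::euclidean_space) atlas \<Rightarrow> ('p \<Rightarrow> 'e \<Rightarrow> 'e \<Rightarrow> real) \<Rightarrow>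
   (('p \<Rightarrow> 'e) \<Rightarrow> ('p \<Rightarrow> 'e) \<Rightarrow> 'p \<Rightarrow> 'e) \<Rightarrow> bool" where
  "levi_civita A g nabla \<longleftrightarrow>
     connection A nabla \<and> torsion_free A nabla \<and> metric_connection A g nabla"

definition almost_complex ::
  "('p::topological_space, 'e::euclidean_space) atlas \<Rightarrow> ('p \<Rightarrow> 'e \<Rightarrow> 'e) \<Rightarrow> bool" where
  "almost_complex A J \<longleftrightarrow>
     (\<forall>p. linear (J p) \<and> (\<forall>v. J p (J p v) = - v)) \<and>
     (\<forall>U X. open U \<and> vector_field A U X \<longrightarrow> vector_field A U (\<lambda>p. J p (X p)))"

definition kaehler_manifold ::
  "('p::{t2_space,second_countable_topology}, 'e::euclidean_space) atlas \<Rightarrow>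
   ('p \<Rightarrow> 'e \<Rightarrow> 'e) \<Rightarrow> ('p \<Rightarrow> 'e \<Rightarrow> 'e \<Rightarrow> real) \<Rightarrow>
   (('p \<Rightarrow> 'e) \<Rightarrow> ('p \<Rightarrow> 'e) \<Rightarrow> 'p \<Rightarrow> 'e) \<Rightarrow> bool" where
  "kaehler_manifold A J g nabla \<longleftrightarrow>
     smooth_manifold A \<and> almost_complex A J \<and> riemannian_metric A g \<and>
     (\<forall>p u v. g p (J p u) (J p v) = g p u v) \<and>
     levi_civita A g nabla \<and>
     (\<forall>U X Y. open U \<and> vector_field A U X \<and> vector_field A U Y \<longrightarrow>
        (\<forall>p\<in>U. nabla X (\<lambda>p. J p (Y p)) p = J p (nabla X Y p)))"

definition curvature ::
  "('p, 'e::euclidean_space) atlas \<Rightarrow> (('p \<Rightarrow> 'e) \<Rightarrow> ('p \<Rightarrow> 'e) \<Rightarrow> 'p \<Rightarrow> 'e) \<Rightarrow>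
   ('p \<Rightarrow> 'e) \<Rightarrow> ('p \<Rightarrow> 'e) \<Rightarrow> ('p \<Rightarrow> 'e) \<Rightarrow> 'p \<Rightarrow> 'e" where
  "curvature A nabla X Y Z p =
     nabla X (nabla Y Z) p - nabla Y (nabla X Z) p - nabla (lie_bracket A X Y) Z p"

definition const_holo_sect_curvature ::
  "('p::topological_space, 'e::euclidean_space) atlas \<Rightarrow> ('p \<Rightarrow> 'e \<Rightarrow> 'e) \<Rightarrow>
   ('p \<Rightarrow> 'e \<Rightarrow> 'e \<Rightarrow> real) \<Rightarrow> (('p \<Rightarrow> 'e) \<Rightarrow> ('p \<Rightarrow> 'e) \<Rightarrow> 'p \<Rightarrow> 'e) \<Rightarrow> real \<Rightarrow> bool" where
  "const_holo_sect_curvature A J g nabla c \<longleftrightarrow>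
     (\<forall>U X Y Z. open U \<and> vector_field A U X \<and> vector_field A U Y \<and> vector_field A U Z \<longrightarrow>
        (\<forall>p\<in>U. curvature A nabla X Y Z p =
           (c / 4) *\<^sub>R
             (g p (Y p) (Z p) *\<^sub>R X p - g p (X p) (Z p) *\<^sub>R Y p
              + g p (J p (Y p)) (Z p) *\<^sub>R J p (X p) - g p (J p (X p)) (Z p) *\<^sub>R J p (Y p)
              + (2 * g p (X p) (J p (Y p))) *\<^sub>R J p (Z p))))"


section \<open>Submanifolds\<close>

text \<open>A submanifold is an immersion \<open>f\<close> of a manifold with atlas \<open>B\<close> into the ambient manifold
  with atlas \<open>A\<close>. Tangent fields \<open>X\<close>, \<open>Y\<close>, \<open>Z\<close> are fields on the source; normal fields are
  fields along \<open>f\<close>.\<close>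

definition kaehler_submanifold ::
  "('q::{t2_space,second_countable_topology}, 'f::euclidean_space) atlas \<Rightarrow>
   ('p::topological_space, 'e::euclidean_space) atlas \<Rightarrow> ('q \<Rightarrow> 'p) \<Rightarrow> ('p \<Rightarrow> 'e \<Rightarrow> 'e) \<Rightarrow> bool" where
  "kaehler_submanifold B A f J \<longleftrightarrow>
     smooth_manifold B \<and> immersion B A f \<and>
     (\<forall>q v. J (f q) (dmap B A f q v) \<in> range (dmap B A f q))"

definition induced_metric ::
  "('q, 'f::euclidean_space) atlas \<Rightarrow> ('p, 'e::euclidean_space) atlas \<Rightarrow> ('q \<Rightarrow> 'p) \<Rightarrow>
   ('p \<Rightarrow> 'e \<Rightarrow> 'e \<Rightarrow> real) \<Rightarrow> 'q \<Rightarrow> 'f \<Rightarrow> 'f \<Rightarrow> real" where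
  "induced_metric B A f g q u v = g (f q) (dmap B A f q u) (dmap B A f q v)"

definition normal_space ::
  "('q, 'f::euclidean_space) atlas \<Rightarrow> ('p, 'e::euclidean_space) atlas \<Rightarrow> ('q \<Rightarrow> 'p) \<Rightarrow>
   ('p \<Rightarrow> 'e \<Rightarrow> 'e \<Rightarrow> real) \<Rightarrow> 'q \<Rightarrow> 'e set" where
  "normal_space B A f g q = {\<xi>. \<forall>v. g (f q) \<xi> (dmap B A f q v) = 0}"

definition normal_part ::
  "('q, 'f::euclidean_space) atlas \<Rightarrow> ('p, 'e::euclidean_space) atlas \<Rightarrow> ('q \<Rightarrow> 'p) \<Rightarrow>
   ('p \<Rightarrow> 'e \<Rightarrow> 'e \<Rightarrow> real) \<Rightarrow> 'q \<Rightarrow> 'e \<Rightarrow> 'e" where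
  "normal_part B A f g q w =
     (THE \<xi>. \<xi> \<in> normal_space B A f g q \<and> w - \<xi> \<in> range (dmap B A f q))"

definition normal_field ::
  "('q, 'f::euclidean_space) atlas \<Rightarrow> ('p, 'e::euclidean_space) atlas \<Rightarrow> ('q \<Rightarrow> 'p) \<Rightarrow>
   ('p \<Rightarrow> 'e \<Rightarrow> 'e \<Rightarrow> real) \<Rightarrow> 'q set \<Rightarrow> ('q \<Rightarrow> 'e) \<Rightarrow> bool" where
  "normal_field B A f g U \<xi> \<longleftrightarrow>
     field_along B A f U \<xi> \<and> (\<forall>q\<in>U. \<xi> q \<in> normal_space B A f g q)"

text \<open>The Christoffel symbols at \<open>p\<close> in the preferred chart at \<open>p\<close>, as a bilinear map, and the
  covariant derivative along \<open>f\<close> of an ambient connection, given by the usual coordinate formula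
  \<open>(\<nabla>\<^sub>X V)\<^sup>k = X(V\<^sup>k) + \<Gamma>\<^sup>k\<^sub>i\<^sub>j (df X)\<^sup>i V\<^sup>j\<close> in the preferred chart of the ambient
  manifold at \<open>f q\<close>.\<close>

definition christoffel ::
  "('p, 'e::euclidean_space) atlas \<Rightarrow> (('p \<Rightarrow> 'e) \<Rightarrow> ('p \<Rightarrow> 'e) \<Rightarrow> 'p \<Rightarrow> 'e) \<Rightarrow>
   'p \<Rightarrow> 'e \<Rightarrow> 'e \<Rightarrow> 'e" where
  "christoffel A nabla p u w =
     nabla (coord_field A (chart_at A p) u) (coord_field A (chart_at A p) w) p"

definition cov_along ::
  "('q, 'f::euclidean_space) atlas \<Rightarrow> ('p, 'e::euclidean_space) atlas \<Rightarrow> ('q \<Rightarrow> 'p) \<Rightarrow>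
   (('p \<Rightarrow> 'e) \<Rightarrow> ('p \<Rightarrow> 'e) \<Rightarrow> 'p \<Rightarrow> 'e) \<Rightarrow> ('q \<Rightarrow> 'f) \<Rightarrow> ('q \<Rightarrow> 'e) \<Rightarrow> 'q \<Rightarrow> 'e" where
  "cov_along B A f nabla X V q =
     dird B (\<lambda>q'. comps A (chart_at A (f q)) (f q') (V q')) q (X q)
     + christoffel A nabla (f q) (dmap B A f q (X q)) (V q)"

text \<open>In the following, \<open>nabla\<close> is the Levi-Civita connection of the ambient manifold, and
  \<open>nab\<close> that of the induced metric. By the Gauss formula, \<open>df (nab X Y)\<close> is the tangential part
  of the ambient covariant derivative whose normal part is \<open>second_ff X Y\<close>.\<close>

definition second_ff ::
  "('q, 'f::euclidean_space) atlas \<Rightarrow> ('p, 'e::euclidean_space) atlas \<Rightarrow> ('q \<Rightarrow> 'p) \<Rightarrow>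
   ('p \<Rightarrow> 'e \<Rightarrow> 'e \<Rightarrow> real) \<Rightarrow> (('p \<Rightarrow> 'e) \<Rightarrow> ('p \<Rightarrow> 'e) \<Rightarrow> 'p \<Rightarrow> 'e) \<Rightarrow>
   ('q \<Rightarrow> 'f) \<Rightarrow> ('q \<Rightarrow> 'f) \<Rightarrow> 'q \<Rightarrow> 'e" where
  "second_ff B A f g nabla X Y q =
     normal_part B A f g q (cov_along B A f nabla X (\<lambda>q. dmap B A f q (Y q)) q)"

definition normal_conn ::
  "('q, 'f::euclidean_space) atlas \<Rightarrow> ('p, 'e::euclidean_space) atlas \<Rightarrow> ('q \<Rightarrow> 'p) \<Rightarrow>
   ('p \<Rightarrow> 'e \<Rightarrow> 'e \<Rightarrow> real) \<Rightarrow> (('p \<Rightarrow> 'e) \<Rightarrow> ('p \<Rightarrow> 'e) \<Rightarrow> 'p \<Rightarrow> 'e) \<Rightarrow>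
   ('q \<Rightarrow> 'f) \<Rightarrow> ('q \<Rightarrow> 'e) \<Rightarrow> 'q \<Rightarrow> 'e" where
  "normal_conn B A f g nabla X \<xi> q = normal_part B A f g q (cov_along B A f nabla X \<xi> q)"

definition normal_curv ::
  "('q, 'f::euclidean_space) atlas \<Rightarrow> ('p, 'e::euclidean_space) atlas \<Rightarrow> ('q \<Rightarrow> 'p) \<Rightarrow>
   ('p \<Rightarrow> 'e \<Rightarrow> 'e \<Rightarrow> real) \<Rightarrow> (('p \<Rightarrow> 'e) \<Rightarrow> ('p \<Rightarrow> 'e) \<Rightarrow> 'p \<Rightarrow> 'e) \<Rightarrow>
   ('q \<Rightarrow> 'f) \<Rightarrow> ('q \<Rightarrow> 'f) \<Rightarrow> ('q \<Rightarrow> 'e) \<Rightarrow> 'q \<Rightarrow> 'e" where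
  "normal_curv B A f g nabla X Y \<xi> q =
     normal_conn B A f g nabla X (normal_conn B A f g nabla Y \<xi>) q
     - normal_conn B A f g nabla Y (normal_conn B A f g nabla X \<xi>) q
     - normal_conn B A f g nabla (lie_bracket B X Y) \<xi> q"

text \<open>The van der Waerden--Bortolotti covariant derivatives of the second fundamental form and of
  the normal curvature tensor, in the direction of the first field argument \<open>X\<close>.\<close>

definition vdWB_second_ff ::
  "('q, 'f::euclidean_space) atlas \<Rightarrow> ('p, 'e::euclidean_space) atlas \<Rightarrow> ('q \<Rightarrow> 'p) \<Rightarrow>
   ('p \<Rightarrow> 'e \<Rightarrow> 'e \<Rightarrow> real) \<Rightarrow> (('p \<Rightarrow> 'e) \<Rightarrow> ('p \<Rightarrow> 'e) \<Rightarrow> 'p \<Rightarrow> 'e) \<Rightarrow>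
   (('q \<Rightarrow> 'f) \<Rightarrow> ('q \<Rightarrow> 'f) \<Rightarrow> 'q \<Rightarrow> 'f) \<Rightarrow>
   ('q \<Rightarrow> 'f) \<Rightarrow> ('q \<Rightarrow> 'f) \<Rightarrow> ('q \<Rightarrow> 'f) \<Rightarrow> 'q \<Rightarrow> 'e" where
  "vdWB_second_ff B A f g nabla nab X Y Z q =
     normal_conn B A f g nabla X (second_ff B A f g nabla Y Z) q
     - second_ff B A f g nabla (nab X Y) Z q
     - second_ff B A f g nabla Y (nab X Z) q"

definition vdWB_normal_curv ::
  "('q, 'f::euclidean_space) atlas \<Rightarrow> ('p, 'e::euclidean_space) atlas \<Rightarrow> ('q \<Rightarrow> 'p) \<Rightarrow>
   ('p \<Rightarrow> 'e \<Rightarrow> 'e \<Rightarrow> real) \<Rightarrow> (('p \<Rightarrow> 'e) \<Rightarrow> ('p \<Rightarrow> 'e) \<Rightarrow> 'p \<Rightarrow> 'e) \<Rightarrow>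
   (('q \<Rightarrow> 'f) \<Rightarrow> ('q \<Rightarrow> 'f) \<Rightarrow> 'q \<Rightarrow> 'f) \<Rightarrow>
   ('q \<Rightarrow> 'f) \<Rightarrow> ('q \<Rightarrow> 'f) \<Rightarrow> ('q \<Rightarrow> 'f) \<Rightarrow> ('q \<Rightarrow> 'e) \<Rightarrow> 'q \<Rightarrow> 'e" where
  "vdWB_normal_curv B A f g nabla nab X Y Z \<xi> q =
     normal_conn B A f g nabla X (normal_curv B A f g nabla Y Z \<xi>) q
     - normal_curv B A f g nabla (nab X Y) Z \<xi> q
     - normal_curv B A f g nabla Y (nab X Z) \<xi> q
     - normal_curv B A f g nabla Y Z (normal_conn B A f g nabla X \<xi>) q"

definition recurrent_second_ff ::
  "('q::topological_space, 'f::euclidean_space) atlas \<Rightarrow> ('p, 'e::euclidean_space) atlas \<Rightarrow>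
   ('q \<Rightarrow> 'p) \<Rightarrow> ('p \<Rightarrow> 'e \<Rightarrow> 'e \<Rightarrow> real) \<Rightarrow> (('p \<Rightarrow> 'e) \<Rightarrow> ('p \<Rightarrow> 'e) \<Rightarrow> 'p \<Rightarrow> 'e) \<Rightarrow>
   (('q \<Rightarrow> 'f) \<Rightarrow> ('q \<Rightarrow> 'f) \<Rightarrow> 'q \<Rightarrow> 'f) \<Rightarrow> bool" where
  "recurrent_second_ff B A f g nabla nab \<longleftrightarrow>
     (\<exists>U X Y. open U \<and> vector_field B U X \<and> vector_field B U Y \<and>
        (\<exists>q\<in>U. second_ff B A f g nabla X Y q \<noteq> 0)) \<and>
     (\<exists>\<mu>. one_form B \<mu> \<and>
        (\<forall>U X Y Z. open U \<and> vector_field B U X \<and> vector_field B U Y \<and> vector_field B U Z \<longrightarrow>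
           (\<forall>q\<in>U. vdWB_second_ff B A f g nabla nab X Y Z q
                  = \<mu> q (X q) *\<^sub>R second_ff B A f g nabla Y Z q)))"

definition normal_curv_nonzero ::
  "('q::topological_space, 'f::euclidean_space) atlas \<Rightarrow> ('p, 'e::euclidean_space) atlas \<Rightarrow>
   ('q \<Rightarrow> 'p) \<Rightarrow> ('p \<Rightarrow> 'e \<Rightarrow> 'e \<Rightarrow> real) \<Rightarrow> (('p \<Rightarrow> 'e) \<Rightarrow> ('p \<Rightarrow> 'e) \<Rightarrow> 'p \<Rightarrow> 'e) \<Rightarrow> bool" where
  "normal_curv_nonzero B A f g nabla \<longleftrightarrow>
     (\<exists>U X Y \<xi>. open U \<and> vector_field B U X \<and> vector_field B U Y \<and> normal_field B A f g U \<xi> \<and>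
        (\<exists>q\<in>U. normal_curv B A f g nabla X Y \<xi> q \<noteq> 0))"

definition normal_curv_parallel ::
  "('q::topological_space, 'f::euclidean_space) atlas \<Rightarrow> ('p, 'e::euclidean_space) atlas \<Rightarrow>
   ('q \<Rightarrow> 'p) \<Rightarrow> ('p \<Rightarrow> 'e \<Rightarrow> 'e \<Rightarrow> real) \<Rightarrow> (('p \<Rightarrow> 'e) \<Rightarrow> ('p \<Rightarrow> 'e) \<Rightarrow> 'p \<Rightarrow> 'e) \<Rightarrow>
   (('q \<Rightarrow> 'f) \<Rightarrow> ('q \<Rightarrow> 'f) \<Rightarrow> 'q \<Rightarrow> 'f) \<Rightarrow> bool" where
  "normal_curv_parallel B A f g nabla nab \<longleftrightarrow>
     (\<forall>U X Y Z \<xi>. open U \<and> vector_field B U X \<and> vector_field B U Y \<and> vector_field B U Z \<and>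
          normal_field B A f g U \<xi> \<longrightarrow>
        (\<forall>q\<in>U. vdWB_normal_curv B A f g nabla nab X Y Z \<xi> q = 0))"

end

(*
  A recurrent second fundamental form is parallel: b (J X) Y = J (b X Y) and the Codazzi equation
  turn the recurrence into \<mu>(J X) b = \<mu>(X) J b, and b and J b are linearly independent where
  b does not vanish, so \<mu> = 0 there. The Ricci equation expresses the normal curvature by b, the
  shape operator A, g and J, which are then all parallel, so the normal curvature is parallel.

  Suppose that it vanishes, and put \<xi> = b X X, n = g X X and \<eta> = b X (A_\<xi> X). The Ricci equation for
  X, J X, \<xi> gives (c/2) n \<xi> + 2 \<eta> = 0, while the Ricci identity for the parallel form b together with
  the Gauss equation gives 2 \<eta> - c n \<xi> = 0. Hence \<eta> = 0, so |A_\<xi> X|^2 = g \<xi> \<eta> = 0, and then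
  |\<xi>|^2 = g (A_\<xi> X) X = 0 for every X, that is, b = 0.
*)
theory Submission
  imports Defs
begin

section \<open>Calculus of smooth maps\<close>

text \<open>The geometry is given for ambient vector fields, while normal fields and images of
  tangent fields are fields along \<open>f\<close>, which need not come from ambient ones; moreover
  \<open>cov_along\<close> is written in a chart chosen anew at every point. Metricity, parallelism
  of \<open>J\<close> and the curvature formula must therefore first be carried over to fields along
  \<open>f\<close>. This works because near a point such a field is a combination, with smooth
  coefficients, of restricted ambient coordinate fields. Likewise \<open>nab\<close> is given only
  as a Levi-Civita connection, so the Gauss formula has to come from uniqueness.

  The Codazzi equation has no curvature term because \<open>J\<close> preserves tangent spaces. The
  zero set of \<open>b\<close> needs no study: only the product of \<open>\<mu>\<close> and
  \<open>b\<close> matters, and it vanishes pointwise.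

  In the last elimination \<open>2 \<eta>\<close> equals both \<open>-(c/2) n \<xi>\<close> and
  \<open>c n \<xi>\<close>, hence minus twice itself, so \<open>\<eta> = 0\<close> for every
  \<open>c\<close>. Eliminating \<open>\<eta>\<close> instead would leave
  \<open>c n \<xi> = 0\<close>, which says nothing when \<open>c = 0\<close>; hence the detour
  through \<open>A_\<xi> X\<close>.\<close>

lemma frechet_derivative_cong_open:
  assumes "open S" "x \<in> S" "\<And>y. y \<in> S \<Longrightarrow> f y = g y"
  shows "frechet_derivative f (at x) = frechet_derivative g (at x)"
proof -
  have "(f has_derivative D) (at x) \<longleftrightarrow> (g has_derivative D) (at x)" for D
    using assms by (metis has_derivative_transform_within_open)
  then show ?thesis by (simp add: frechet_derivative_def)
qed

lemma differentiable_cong_open: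
  assumes "open S" "x \<in> S" "\<And>y. y \<in> S \<Longrightarrow> f y = g y" "f differentiable (at x)"
  shows "g differentiable (at x)"
  using assms unfolding differentiable_def by (metis has_derivative_transform_within_open)

lemma frechet_derivativeI:
  "(f has_derivative D) (at x) \<Longrightarrow> frechet_derivative f (at x) = D"
  by (rule frechet_derivative_at[symmetric])

lemma Ck_on_subset: "Ck_on k f S \<Longrightarrow> T \<subseteq> S \<Longrightarrow> Ck_on k f T"
  by (induction k arbitrary: f) (auto intro: continuous_on_subset)

lemma Ck_on_cong:
  assumes "open S" "\<And>y. y \<in> S \<Longrightarrow> f y = g y" "Ck_on k f S"
  shows "Ck_on k g S"
  using assms(2,3)
proof (induction k arbitrary: f g)
  case 0
  then show ?case by (simp cong: continuous_on_cong)
next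
  case (Suc k)
  have "Ck_on k (\<lambda>x. frechet_derivative g (at x) v) S" for v
  proof (rule Suc.IH)
    show "frechet_derivative f (at y) v = frechet_derivative g (at y) v" if "y \<in> S" for y
      using frechet_derivative_cong_open[OF assms(1) that] Suc.prems(1) by metis
  qed (use Suc.prems in auto)
  moreover have "g differentiable (at x)" if "x \<in> S" for x
    using differentiable_cong_open[OF assms(1) that, of f g] Suc.prems that by auto
  ultimately show ?case by simp
qed

lemma Ck_on_local:
  assumes "\<And>x. x \<in> S \<Longrightarrow> \<exists>T. open T \<and> x \<in> T \<and> Ck_on k f T"
  shows "Ck_on k f S"
  using assms
proof (induction k arbitrary: f)
  case 0
  have "isCont f x" if "x \<in> S" for x
    using 0[OF that] by (auto simp: continuous_on_eq_continuous_at)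
  then show ?case by (simp add: continuous_at_imp_continuous_on)
next
  case (Suc k)
  have "f differentiable (at x)" if "x \<in> S" for x
    using Suc.prems[OF that] by auto
  moreover have "Ck_on k (\<lambda>x. frechet_derivative f (at x) v) S" for v
    by (rule Suc.IH) (use Suc.prems in fastforce)
  ultimately show ?case by simp
qed

lemma Ck_on_SucD: "Ck_on (Suc k) f S \<Longrightarrow> Ck_on k f S"
proof (induction k arbitrary: f)
  case 0
  then show ?case
    by (simp add: continuous_at_imp_continuous_on differentiable_imp_continuous_within)
next
  case (Suc k)
  then show ?case by (metis Ck_on.simps(2))
qed

lemma Ck_on_const: "Ck_on k (\<lambda>x. c) S"
  by (induction k arbitrary: c) (auto simp: frechet_derivative_const)

lemma Ck_on_bounded_linear:
  assumes "open S" "bounded_linear L" "Ck_on k f S"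
  shows "Ck_on k (\<lambda>x. L (f x)) S"
  using assms(3)
proof (induction k arbitrary: f)
  case 0
  then show ?case using assms(2) by (simp add: bounded_linear.continuous_on)
next
  case (Suc k)
  have D: "((\<lambda>x. L (f x)) has_derivative (\<lambda>v. L (frechet_derivative f (at x) v))) (at x)"
    if "x \<in> S" for x
    using Suc.prems that by (auto intro!: bounded_linear.has_derivative[OF assms(2)]
        simp: frechet_derivative_works[symmetric])
  have "Ck_on k (\<lambda>x. frechet_derivative (\<lambda>x. L (f x)) (at x) v) S" for v
    by (rule Ck_on_cong[OF assms(1) _ Suc.IH[of "\<lambda>x. frechet_derivative f (at x) v"]])
      (use Suc.prems D[THEN frechet_derivativeI] in auto)
  then show ?case using D by (auto simp: differentiable_def)
qed

lemma Ck_on_add: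
  assumes "open S" "Ck_on k f S" "Ck_on k g S"
  shows "Ck_on k (\<lambda>x. f x + g x) S"
  using assms(2,3)
proof (induction k arbitrary: f g)
  case 0
  then show ?case by (simp add: continuous_on_add)
next
  case (Suc k)
  have D: "((\<lambda>x. f x + g x) has_derivative
      (\<lambda>v. frechet_derivative f (at x) v + frechet_derivative g (at x) v)) (at x)"
    if "x \<in> S" for x
    using Suc.prems that by (auto intro!: has_derivative_add simp: frechet_derivative_works[symmetric])
  have "Ck_on k (\<lambda>x. frechet_derivative (\<lambda>x. f x + g x) (at x) v) S" for v
    by (rule Ck_on_cong[OF assms(1) _ Suc.IH[of "\<lambda>x. frechet_derivative f (at x) v"
            "\<lambda>x. frechet_derivative g (at x) v"]])
      (use Suc.prems D[THEN frechet_derivativeI] in auto)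
  then show ?case using D by (auto simp: differentiable_def)
qed

lemma Ck_on_sum:
  assumes "open S" "\<And>i. i \<in> I \<Longrightarrow> Ck_on k (f i) S"
  shows "Ck_on k (\<lambda>x. \<Sum>i\<in>I. f i x) S"
  using assms(2)
  by (induction I rule: infinite_finite_induct) (auto intro: Ck_on_const Ck_on_add[OF assms(1)])

lemma Ck_on_bilinear:
  assumes "open S" "bounded_bilinear p" "Ck_on k f S" "Ck_on k g S"
  shows "Ck_on k (\<lambda>x. p (f x) (g x)) S"
  using assms(3,4)
proof (induction k arbitrary: f g)
  case 0
  then show ?case using assms(2) by (simp add: bounded_bilinear.continuous_on)
next
  case (Suc k)
  have D: "((\<lambda>x. p (f x) (g x)) has_derivative
      (\<lambda>v. p (f x) (frechet_derivative g (at x) v) + p (frechet_derivative f (at x) v) (g x))) (at x)"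
    if "x \<in> S" for x
    using Suc.prems that
    by (auto intro!: bounded_bilinear.FDERIV[OF assms(2)] simp: frechet_derivative_works[symmetric])
  have "Ck_on k (\<lambda>x. frechet_derivative (\<lambda>x. p (f x) (g x)) (at x) v) S" for v
  proof (rule Ck_on_cong[OF assms(1)])
    show "Ck_on k (\<lambda>x. p (f x) (frechet_derivative g (at x) v)
        + p (frechet_derivative f (at x) v) (g x)) S"
      using Suc.prems by (intro Ck_on_add[OF assms(1)] Suc.IH Ck_on_SucD[of k f] Ck_on_SucD[of k g]) auto
  qed (use D[THEN frechet_derivativeI] in auto)
  then show ?case using D by (auto simp: differentiable_def)
qed

lemma linear_euclidean_expand:
  fixes L :: "'a::euclidean_space \<Rightarrow> 'b::real_vector"
  assumes "linear L"
  shows "L v = (\<Sum>i\<in>Basis. (v \<bullet> i) *\<^sub>R L i)"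
  by (subst euclidean_representation[symmetric, of v])
    (simp only: linear_sum[OF assms] linear_scale[OF assms])

lemma frechet_derivative_expand:
  assumes "f differentiable (at x)"
  shows "frechet_derivative f (at x) v = (\<Sum>i\<in>Basis. (v \<bullet> i) *\<^sub>R frechet_derivative f (at x) i)"
  by (rule linear_euclidean_expand[OF linear_frechet_derivative[OF assms]])

text \<open>\<open>Ck_on\<close> controls derivatives in a fixed direction only, whereas the chain
  rule evaluates the derivative of \<open>f\<close> in a direction that moves with the point.
  Expanding that direction in \<open>Basis\<close> leaves a sum of products, to which the closure
  lemmas and the induction hypothesis apply.\<close>

lemma Ck_on_compose:
  assumes "open S" "open T" "g ` S \<subseteq> T" "Ck_on k f T" "Ck_on k g S"
  shows "Ck_on k (\<lambda>x. f (g x)) S"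
  using assms(4,5)
proof (induction k arbitrary: f)
  case 0
  then show ?case using assms(3) by (auto intro: continuous_on_compose2)
next
  case (Suc k)
  have D: "((\<lambda>x. f (g x)) has_derivative
      (\<lambda>v. frechet_derivative f (at (g x)) (frechet_derivative g (at x) v))) (at x)"
    if "x \<in> S" for x
  proof -
    have "(g has_derivative frechet_derivative g (at x)) (at x)"
      using Suc.prems(2) that by (auto simp: frechet_derivative_works[symmetric])
    moreover have "(f has_derivative frechet_derivative f (at (g x))) (at (g x))"
      using Suc.prems(1) that assms(3) by (auto simp: frechet_derivative_works[symmetric])
    ultimately show ?thesis by (rule has_derivative_compose)
  qed
  have "Ck_on k (\<lambda>x. frechet_derivative (\<lambda>x. f (g x)) (at x) v) S" for v
  proof (rule Ck_on_cong[OF assms(1)])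
    show "Ck_on k (\<lambda>x. \<Sum>i\<in>Basis. (frechet_derivative g (at x) v \<bullet> i) *\<^sub>R
        frechet_derivative f (at (g x)) i) S"
      using Suc.prems
      by (intro Ck_on_sum[OF assms(1)] Ck_on_bilinear[OF assms(1) bounded_bilinear_scaleR]
          Ck_on_bounded_linear[OF assms(1) bounded_linear_inner_left] Suc.IH Ck_on_SucD[of k g]) auto
    show "(\<Sum>i\<in>Basis. (frechet_derivative g (at y) v \<bullet> i) *\<^sub>R frechet_derivative f (at (g y)) i)
        = frechet_derivative (\<lambda>x. f (g x)) (at y) v" if "y \<in> S" for y
      using D[OF that, THEN frechet_derivativeI] Suc.prems(1) that assms(3)
      by (subst frechet_derivative_expand[symmetric]) auto
  qed
  then show ?case using D by (auto simp: differentiable_def)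
qed

text \<open>The induction closes because the derivative is a product of the inverse itself, of one
  order less, with the derivative of \<open>f\<close>.\<close>

lemma Ck_on_inverse:
  fixes f :: "'a::euclidean_space \<Rightarrow> real"
  assumes "open S" "\<And>x. x \<in> S \<Longrightarrow> f x \<noteq> 0" "Ck_on k f S"
  shows "Ck_on k (\<lambda>x. inverse (f x)) S"
  using assms(3)
proof (induction k)
  case 0
  then show ?case using assms(2) by (simp add: continuous_on_inverse)
next
  case (Suc k)
  have D: "((\<lambda>x. inverse (f x)) has_derivative
      (\<lambda>v. - (inverse (f x) * frechet_derivative f (at x) v * inverse (f x)))) (at x)"
    if "x \<in> S" for x
    using Suc.prems that assms(2)
    by (auto intro!: Deriv.has_derivative_inverse simp: frechet_derivative_works[symmetric])
  have "Ck_on k (\<lambda>x. frechet_derivative (\<lambda>x. inverse (f x)) (at x) v) S" for v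
  proof (rule Ck_on_cong[OF assms(1)])
    show "Ck_on k (\<lambda>x. - (inverse (f x) * frechet_derivative f (at x) v * inverse (f x))) S"
      using Suc.prems
      by (intro Ck_on_bounded_linear[OF assms(1) bounded_linear_minus[OF bounded_linear_ident]]
          Ck_on_bilinear[OF assms(1) bounded_bilinear_mult] Suc.IH Ck_on_SucD[of k f]) auto
  qed (use D[THEN frechet_derivativeI] in auto)
  then show ?case using D by (auto simp: differentiable_def)
qed

lemma smooth_on_subset: "smooth_on S f \<Longrightarrow> T \<subseteq> S \<Longrightarrow> smooth_on T f"
  using Ck_on_subset[of _ f S T] by (simp add: smooth_on_def)

lemma smooth_on_cong:
  "open S \<Longrightarrow> (\<And>y. y \<in> S \<Longrightarrow> f y = g y) \<Longrightarrow> smooth_on S f \<Longrightarrow> smooth_on S g"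
  using Ck_on_cong[of S f g] by (simp add: smooth_on_def)

lemma smooth_on_local:
  assumes "\<And>x. x \<in> S \<Longrightarrow> \<exists>T. open T \<and> x \<in> T \<and> smooth_on T f"
  shows "smooth_on S f"
  unfolding smooth_on_def
proof
  show "Ck_on k f S" for k
    by (rule Ck_on_local) (use assms in \<open>force simp: smooth_on_def\<close>)
qed

lemma smooth_on_const: "smooth_on S (\<lambda>x. c)"
  by (simp add: smooth_on_def Ck_on_const)

lemma smooth_on_bounded_linear:
  "open S \<Longrightarrow> bounded_linear L \<Longrightarrow> smooth_on S f \<Longrightarrow> smooth_on S (\<lambda>x. L (f x))"
  by (simp add: smooth_on_def Ck_on_bounded_linear)

lemma smooth_on_sum:
  "open S \<Longrightarrow> (\<And>i. i \<in> I \<Longrightarrow> smooth_on S (f i)) \<Longrightarrow> smooth_on S (\<lambda>x. \<Sum>i\<in>I. f i x)"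
  by (simp add: smooth_on_def Ck_on_sum)

lemma smooth_on_add:
  "open S \<Longrightarrow> smooth_on S f \<Longrightarrow> smooth_on S g \<Longrightarrow> smooth_on S (\<lambda>x. f x + g x)"
  by (simp add: smooth_on_def Ck_on_add)

lemma smooth_on_bilinear:
  "open S \<Longrightarrow> bounded_bilinear p \<Longrightarrow> smooth_on S f \<Longrightarrow> smooth_on S g
    \<Longrightarrow> smooth_on S (\<lambda>x. p (f x) (g x))"
  by (simp add: smooth_on_def Ck_on_bilinear)

lemma smooth_on_compose:
  "open S \<Longrightarrow> open T \<Longrightarrow> g ` S \<subseteq> T \<Longrightarrow> smooth_on T f \<Longrightarrow> smooth_on S g
    \<Longrightarrow> smooth_on S (\<lambda>x. f (g x))"
  using Ck_on_compose[of S T g _ f] by (simp add: smooth_on_def)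

lemma smooth_on_inverse:
  fixes f :: "'a::euclidean_space \<Rightarrow> real"
  shows "open S \<Longrightarrow> (\<And>x. x \<in> S \<Longrightarrow> f x \<noteq> 0) \<Longrightarrow> smooth_on S f \<Longrightarrow> smooth_on S (\<lambda>x. inverse (f x))"
  by (simp add: smooth_on_def Ck_on_inverse)

lemma smooth_on_differentiable: "smooth_on S f \<Longrightarrow> x \<in> S \<Longrightarrow> f differentiable (at x)"
  unfolding smooth_on_def using Ck_on.simps(2)[of 0 f S] by blast

lemma smooth_on_has_derivative:
  "smooth_on S f \<Longrightarrow> x \<in> S \<Longrightarrow> (f has_derivative frechet_derivative f (at x)) (at x)"
  using frechet_derivative_works smooth_on_differentiable by blast

lemma smooth_on_continuous: "smooth_on S f \<Longrightarrow> continuous_on S f"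
  unfolding smooth_on_def using Ck_on.simps(1)[of f S] by blast

lemma smooth_on_frechet_derivative:
  "smooth_on S f \<Longrightarrow> smooth_on S (\<lambda>x. frechet_derivative f (at x) v)"
  unfolding smooth_on_def using Ck_on.simps(2)[of _ f S] by blast

section \<open>Symmetry of second derivatives\<close>

lemma DERIV_along_line:
  fixes f :: "'a::euclidean_space \<Rightarrow> real"
  assumes "smooth_on S f" "p + s *\<^sub>R u \<in> S"
  shows "((\<lambda>s. f (p + s *\<^sub>R u)) has_real_derivative
    frechet_derivative f (at (p + s *\<^sub>R u)) u) (at s)"
proof -
  have "((\<lambda>s. p + s *\<^sub>R u) has_derivative (\<lambda>h. h *\<^sub>R u)) (at s)"
    by (auto intro!: derivative_eq_intros)
  from has_derivative_compose[OF this smooth_on_has_derivative[OF assms]]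
  have "((\<lambda>s. f (p + s *\<^sub>R u)) has_derivative
      (\<lambda>h. frechet_derivative f (at (p + s *\<^sub>R u)) (h *\<^sub>R u))) (at s)" .
  moreover have "(\<lambda>h. frechet_derivative f (at (p + s *\<^sub>R u)) (h *\<^sub>R u))
      = (*) (frechet_derivative f (at (p + s *\<^sub>R u)) u)"
    using linear_frechet_derivative[OF smooth_on_differentiable[OF assms]]
    by (auto simp: linear_cmul)
  ultimately show ?thesis by (simp add: has_field_derivative_def)
qed

text \<open>Two mean value theorems on the second difference over a parallelogram: along
  \<open>u\<close> for the difference of \<open>f\<close> on the two opposite edges, then along
  \<open>v\<close> for the derivative of \<open>f\<close> in direction \<open>u\<close>.\<close>

lemma mixed_difference_mvt:
  fixes f :: "'a::euclidean_space \<Rightarrow> real"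
  assumes f: "smooth_on S f" and "0 < t"
    and S: "\<And>a b. 0 \<le> a \<Longrightarrow> a \<le> t \<Longrightarrow> 0 \<le> b \<Longrightarrow> b \<le> t \<Longrightarrow> x + a *\<^sub>R u + b *\<^sub>R v \<in> S"
  shows "\<exists>a b. 0 < a \<and> a < t \<and> 0 < b \<and> b < t \<and>
    f (x + t *\<^sub>R u + t *\<^sub>R v) - f (x + t *\<^sub>R u) - f (x + t *\<^sub>R v) + f x
    = t * t * frechet_derivative (\<lambda>y. frechet_derivative f (at y) u) (at (x + a *\<^sub>R u + b *\<^sub>R v)) v"
proof -
  let ?D = "\<lambda>y. frechet_derivative f (at y) u"
  have "\<exists>a. 0 < a \<and> a < t \<and>
      (f ((x + t *\<^sub>R v) + t *\<^sub>R u) - f (x + t *\<^sub>R u)) - (f ((x + t *\<^sub>R v) + 0 *\<^sub>R u) - f (x + 0 *\<^sub>R u))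
      = (t - 0) * (?D ((x + t *\<^sub>R v) + a *\<^sub>R u) - ?D (x + a *\<^sub>R u))"
  proof (rule MVT2[OF \<open>0 < t\<close>])
    fix a assume a: "0 \<le> a" "a \<le> t"
    have "x + t *\<^sub>R v + a *\<^sub>R u \<in> S" "x + a *\<^sub>R u \<in> S"
      using S[OF a, of t] S[OF a, of 0] \<open>0 < t\<close> by (auto simp: add_ac)
    then show "((\<lambda>a. f ((x + t *\<^sub>R v) + a *\<^sub>R u) - f (x + a *\<^sub>R u)) has_real_derivative
        ?D ((x + t *\<^sub>R v) + a *\<^sub>R u) - ?D (x + a *\<^sub>R u)) (at a)"
      by (intro DERIV_diff DERIV_along_line[OF f])
  qed
  then obtain a where a: "0 < a" "a < t" and
    1: "f (x + t *\<^sub>R u + t *\<^sub>R v) - f (x + t *\<^sub>R u) - f (x + t *\<^sub>R v) + f x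
      = t * (?D (x + a *\<^sub>R u + t *\<^sub>R v) - ?D (x + a *\<^sub>R u))"
    by (auto simp: algebra_simps)
  have "\<exists>b. 0 < b \<and> b < t \<and>
      ?D ((x + a *\<^sub>R u) + t *\<^sub>R v) - ?D ((x + a *\<^sub>R u) + 0 *\<^sub>R v)
      = (t - 0) * frechet_derivative ?D (at ((x + a *\<^sub>R u) + b *\<^sub>R v)) v"
    by (rule MVT2[OF \<open>0 < t\<close>])
      (use a S in \<open>auto intro!: DERIV_along_line[OF smooth_on_frechet_derivative[OF f]]\<close>)
  then obtain b where b: "0 < b" "b < t" and
    2: "?D (x + a *\<^sub>R u + t *\<^sub>R v) - ?D (x + a *\<^sub>R u)
      = t * frechet_derivative ?D (at (x + a *\<^sub>R u + b *\<^sub>R v)) v"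
    by auto
  show ?thesis
    using a b 1 2 by (intro exI[of _ a] exI[of _ b]) simp
qed

text \<open>The second difference over a parallelogram is symmetric in \<open>u\<close> and
  \<open>v\<close>, so the two mixed derivatives agree at some pair of points of every small
  parallelogram; continuity carries this to the corner \<open>x\<close>.\<close>

lemma second_derivative_symmetric_real:
  fixes f :: "'a::euclidean_space \<Rightarrow> real"
  assumes "open S" "smooth_on S f" "x \<in> S"
  shows "frechet_derivative (\<lambda>y. frechet_derivative f (at y) u) (at x) v
    = frechet_derivative (\<lambda>y. frechet_derivative f (at y) v) (at x) u" (is "?P x = ?Q x")
proof (rule ccontr)
  assume ne: "?P x \<noteq> ?Q x"
  \<comment> \<open>Half the gap: values within \<open>e\<close> of the two limits cannot
    coincide.\<close>
  define e where "e = \<bar>?P x - ?Q x\<bar> / 2"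
  have "e > 0" using ne by (simp add: e_def)
  have "continuous_on S ?P" "continuous_on S ?Q"
    by (intro smooth_on_continuous smooth_on_frechet_derivative assms)+
  then have "isCont ?P x" "isCont ?Q x"
    using assms by (auto simp: continuous_on_eq_continuous_at)
  then have "\<forall>\<^sub>F y in nhds x. dist (?P y) (?P x) < e" "\<forall>\<^sub>F y in nhds x. dist (?Q y) (?Q x) < e"
    using \<open>e > 0\<close> tendsto_at_iff_tendsto_nhds[of ?P x] tendsto_at_iff_tendsto_nhds[of ?Q x]
    by (auto simp: isCont_def dest: tendstoD)
  moreover have "\<forall>\<^sub>F y in nhds x. y \<in> S"
    using assms eventually_nhds_in_open by blast
  ultimately have "\<forall>\<^sub>F y in nhds x. dist (?P y) (?P x) < e \<and> dist (?Q y) (?Q x) < e \<and> y \<in> S"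
    by eventually_elim auto
  then obtain r where "r > 0" and r: "\<And>y. dist y x < r \<Longrightarrow>
      dist (?P y) (?P x) < e \<and> dist (?Q y) (?Q x) < e \<and> y \<in> S"
    unfolding eventually_nhds_metric by auto
  \<comment> \<open>Keeps the whole parallelogram in the ball of radius \<open>r\<close>; the
    summand 1 makes the bound strict and the denominator positive even if \<open>u\<close> and
    \<open>v\<close> vanish.\<close>
  define t where "t = r / (norm u + norm v + 1)"
  have "t > 0" using \<open>r > 0\<close> by (simp add: t_def add_nonneg_pos)
  have tr: "t * (norm u + norm v + 1) = r"
    by (simp add: t_def) (metis add_nonneg_pos norm_ge_zero add_nonneg_nonneg less_irrefl zero_less_one)
  have near: "dist (x + a *\<^sub>R u + b *\<^sub>R v) x < r" if "0 \<le> a" "a \<le> t" "0 \<le> b" "b \<le> t" for a b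
  proof -
    have "dist (x + a *\<^sub>R u + b *\<^sub>R v) x = norm (a *\<^sub>R u + b *\<^sub>R v)"
      by (simp add: dist_norm)
    also have "\<dots> \<le> a * norm u + b * norm v"
      using that norm_triangle_ineq[of "a *\<^sub>R u" "b *\<^sub>R v"] by simp
    also have "\<dots> \<le> t * norm u + t * norm v"
      using that by (intro add_mono mult_right_mono) auto
    also have "\<dots> < r" using tr \<open>t > 0\<close> by (simp add: algebra_simps)
    finally show ?thesis .
  qed
  have near': "dist (x + a *\<^sub>R v + b *\<^sub>R u) x < r" if "0 \<le> a" "a \<le> t" "0 \<le> b" "b \<le> t" for a b
    using near[of b a] that by (simp add: add_ac)
  obtain a b where 1: "0 < a" "a < t" "0 < b" "b < t"
    "f (x + t *\<^sub>R u + t *\<^sub>R v) - f (x + t *\<^sub>R u) - f (x + t *\<^sub>R v) + f x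
      = t * t * ?P (x + a *\<^sub>R u + b *\<^sub>R v)"
    using mixed_difference_mvt[OF assms(2) \<open>t > 0\<close>, of x u v] near r by blast
  obtain a' b' where 2: "0 < a'" "a' < t" "0 < b'" "b' < t"
    "f (x + t *\<^sub>R v + t *\<^sub>R u) - f (x + t *\<^sub>R v) - f (x + t *\<^sub>R u) + f x
      = t * t * ?Q (x + a' *\<^sub>R v + b' *\<^sub>R u)"
    using mixed_difference_mvt[OF assms(2) \<open>t > 0\<close>, of x v u] near' r by blast
  have "x + t *\<^sub>R v + t *\<^sub>R u = x + t *\<^sub>R u + t *\<^sub>R v" by simp
  with 1(5) 2(5) have "t * t * ?P (x + a *\<^sub>R u + b *\<^sub>R v) = t * t * ?Q (x + a' *\<^sub>R v + b' *\<^sub>R u)"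
    by (simp only:)
  then have "?P (x + a *\<^sub>R u + b *\<^sub>R v) = ?Q (x + a' *\<^sub>R v + b' *\<^sub>R u)"
    using \<open>t > 0\<close> by simp
  moreover have "dist (?P (x + a *\<^sub>R u + b *\<^sub>R v)) (?P x) < e"
    using r[OF near[of a b]] 1 by simp
  moreover have "dist (?Q (x + a' *\<^sub>R v + b' *\<^sub>R u)) (?Q x) < e"
    using r[OF near'[of a' b']] 2 by simp
  ultimately show False unfolding e_def dist_real_def by argo
qed

lemma second_derivative_symmetric:
  fixes f :: "'a::euclidean_space \<Rightarrow> 'b::euclidean_space"
  assumes "open S" "smooth_on S f" "x \<in> S"
  shows "frechet_derivative (\<lambda>y. frechet_derivative f (at y) u) (at x) v
    = frechet_derivative (\<lambda>y. frechet_derivative f (at y) v) (at x) u"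
proof (rule euclidean_eqI)
  fix i :: 'b assume "i \<in> Basis"
  have inner: "frechet_derivative (\<lambda>y. h y \<bullet> i) (at y) w = frechet_derivative h (at y) w \<bullet> i"
    if "smooth_on S h" "y \<in> S" for h :: "'a \<Rightarrow> 'b" and y w
    using has_derivative_inner_left[OF smooth_on_has_derivative[OF that], of i]
    by (simp add: frechet_derivativeI)
  have second: "frechet_derivative (\<lambda>y. frechet_derivative (\<lambda>y. f y \<bullet> i) (at y) u) (at x) v
      = frechet_derivative (\<lambda>y. frechet_derivative f (at y) u) (at x) v \<bullet> i" for u v
  proof -
    have "frechet_derivative (\<lambda>y. frechet_derivative (\<lambda>y. f y \<bullet> i) (at y) u) (at x)
        = frechet_derivative (\<lambda>y. frechet_derivative f (at y) u \<bullet> i) (at x)"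
      by (rule frechet_derivative_cong_open[OF assms(1,3)]) (rule inner[OF assms(2)])
    then show ?thesis
      using inner[OF smooth_on_frechet_derivative[OF assms(2)] assms(3)] by simp
  qed
  have "smooth_on S (\<lambda>y. f y \<bullet> i)"
    by (rule smooth_on_bounded_linear[OF assms(1) bounded_linear_inner_left assms(2)])
  from second_derivative_symmetric_real[OF assms(1) this assms(3)]
  show "frechet_derivative (\<lambda>y. frechet_derivative f (at y) u) (at x) v \<bullet> i
    = frechet_derivative (\<lambda>y. frechet_derivative f (at y) v) (at x) u \<bullet> i"
    by (simp only: second)
qed

section \<open>Smooth functions and fields on manifolds\<close>

locale smooth_mfd =
  fixes A :: "('p::{t2_space,second_countable_topology}, 'e::euclidean_space) atlas"
  assumes smooth_manifold: "smooth_manifold A"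
begin

lemma ex_chart: "\<exists>c\<in>A. p \<in> fst c"
  using smooth_manifold unfolding smooth_manifold_def by blast

lemma chart_at: "chart_at A p \<in> A" "p \<in> fst (chart_at A p)"
proof -
  obtain c where "c \<in> A \<and> p \<in> fst c" using ex_chart by blast
  then have "chart_at A p \<in> A \<and> p \<in> fst (chart_at A p)" unfolding chart_at_def by (rule someI)
  then show "chart_at A p \<in> A" "p \<in> fst (chart_at A p)" by auto
qed

lemma chart:
  assumes "c \<in> A"
  shows "open (fst c)" "open (snd c ` fst c)"
    "homeomorphism (fst c) (snd c ` fst c) (snd c) (chart_inv c)"
  using smooth_manifold assms unfolding smooth_manifold_def by blast+

lemma chart_inv_chart: "c \<in> A \<Longrightarrow> p \<in> fst c \<Longrightarrow> chart_inv c (snd c p) = p"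
  using chart(3) by (meson homeomorphism_apply1)

lemma chart_image_open:
  assumes "c \<in> A" "open W" "W \<subseteq> fst c"
  shows "open (snd c ` W)"
proof -
  have "openin (top_of_set (snd c ` fst c)) (snd c ` W)"
    by (rule homeomorphism_imp_open_map[OF chart(3)[OF assms(1)]])
      (use assms chart(1) in \<open>auto simp: openin_open_eq\<close>)
  then show ?thesis using chart(2)[OF assms(1)] by (simp add: openin_open_eq)
qed

lemma open_Int_chart: "c \<in> A \<Longrightarrow> open U \<Longrightarrow> open (U \<inter> fst c)" "c \<in> A \<Longrightarrow> open U \<Longrightarrow> open (fst c \<inter> U)"
  using chart(1) by blast+

lemma chart_image_open_Int: "c \<in> A \<Longrightarrow> open U \<Longrightarrow> open (snd c ` (fst c \<inter> U))"
  by (intro chart_image_open open_Int_chart) auto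

lemma transition_smooth:
  "c \<in> A \<Longrightarrow> d \<in> A \<Longrightarrow> smooth_on (snd c ` (fst c \<inter> fst d)) (snd d \<circ> chart_inv c)"
  using smooth_manifold unfolding smooth_manifold_def by blast

text \<open>\<open>smooth_fun\<close> asks for smoothness in every chart; one chart near each point
  suffices because transition maps are smooth.\<close>

lemma smooth_funI:
  assumes "\<And>p. p \<in> U \<Longrightarrow> \<exists>c\<in>A. \<exists>W. open W \<and> p \<in> W \<and> W \<subseteq> fst c \<and>
    smooth_on (snd c ` W) (h \<circ> chart_inv c)"
  shows "smooth_fun A U h"
  unfolding smooth_fun_def
proof (intro ballI smooth_on_local)
  fix d y assume d: "d \<in> A" and "y \<in> snd d ` (fst d \<inter> U)"
  then obtain p where p: "p \<in> fst d" "p \<in> U" "y = snd d p" by auto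
  obtain c W where c: "c \<in> A" "open W" "p \<in> W" "W \<subseteq> fst c"
    and sm: "smooth_on (snd c ` W) (h \<circ> chart_inv c)"
    using assms[OF p(2)] by blast
  define T where "T = snd d ` (W \<inter> fst d)"
  have "open T" unfolding T_def using c d by (intro chart_image_open open_Int_chart) auto
  moreover have "y \<in> T" using p c by (auto simp: T_def)
  moreover have "smooth_on T (h \<circ> chart_inv d)"
  proof (rule smooth_on_cong[OF \<open>open T\<close>])
    show "smooth_on T (\<lambda>z. (h \<circ> chart_inv c) ((snd c \<circ> chart_inv d) z))"
    proof (rule smooth_on_compose[OF \<open>open T\<close> chart_image_open[OF c(1,2,4)] _ sm])
      show "(snd c \<circ> chart_inv d) ` T \<subseteq> snd c ` W"
        unfolding T_def using d by (auto simp: chart_inv_chart)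
      show "smooth_on T (snd c \<circ> chart_inv d)"
        by (rule smooth_on_subset[OF transition_smooth[OF d c(1)]]) (use c in \<open>auto simp: T_def\<close>)
    qed
    show "(h \<circ> chart_inv c) ((snd c \<circ> chart_inv d) z) = (h \<circ> chart_inv d) z" if "z \<in> T" for z
      using that c d by (auto simp: T_def chart_inv_chart subset_iff)
  qed
  ultimately show "\<exists>T. open T \<and> y \<in> T \<and> smooth_on T (h \<circ> chart_inv d)" by blast
qed

lemma smooth_funD:
  assumes "smooth_fun A U h" "open U" "c \<in> A" "p \<in> fst c" "p \<in> U"
  shows "open (snd c ` (fst c \<inter> U))" "snd c p \<in> snd c ` (fst c \<inter> U)"
    "smooth_on (snd c ` (fst c \<inter> U)) (h \<circ> chart_inv c)"
  using assms by (auto intro!: chart_image_open_Int simp: smooth_fun_def)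

lemma smooth_fun_local:
  assumes "\<And>p. p \<in> U \<Longrightarrow> \<exists>V. open V \<and> p \<in> V \<and> smooth_fun A V h"
  shows "smooth_fun A U h"
proof (rule smooth_funI)
  fix p assume "p \<in> U"
  then obtain V where V: "open V" "p \<in> V" "smooth_fun A V h" using assms by blast
  have c: "chart_at A p \<in> A" "p \<in> fst (chart_at A p)" by (rule chart_at)+
  show "\<exists>c\<in>A. \<exists>W. open W \<and> p \<in> W \<and> W \<subseteq> fst c \<and> smooth_on (snd c ` W) (h \<circ> chart_inv c)"
    using c V open_Int_chart(2)[OF c(1) V(1)]
    by (intro bexI[of _ "chart_at A p"] exI[of _ "fst (chart_at A p) \<inter> V"])
      (auto simp: smooth_fun_def)
qed

lemma smooth_fun_subset: "smooth_fun A U h \<Longrightarrow> V \<subseteq> U \<Longrightarrow> smooth_fun A V h"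
  unfolding smooth_fun_def by (meson image_mono inf_mono order_refl smooth_on_subset)

lemma smooth_fun_cong:
  assumes "open U" "\<And>p. p \<in> U \<Longrightarrow> h p = k p" "smooth_fun A U h"
  shows "smooth_fun A U k"
  unfolding smooth_fun_def
proof
  fix c assume c: "c \<in> A"
  show "smooth_on (snd c ` (fst c \<inter> U)) (k \<circ> chart_inv c)"
  proof (rule smooth_on_cong)
    show "open (snd c ` (fst c \<inter> U))" using c assms(1) by (rule chart_image_open_Int)
    show "smooth_on (snd c ` (fst c \<inter> U)) (h \<circ> chart_inv c)"
      using assms(3) c by (simp add: smooth_fun_def)
  qed (use c assms(2) in \<open>auto simp: chart_inv_chart\<close>)
qed

lemma smooth_fun_chartwise:
  "smooth_fun A U h \<longleftrightarrow> (\<forall>c\<in>A. smooth_on (snd c ` (fst c \<inter> U)) (\<lambda>x. h (chart_inv c x)))"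
  by (simp add: smooth_fun_def comp_def)

lemma smooth_fun_const: "smooth_fun A U (\<lambda>p. a)"
  by (simp add: smooth_fun_chartwise smooth_on_const)

lemma smooth_fun_bounded_linear:
  assumes "open U" "bounded_linear L" "smooth_fun A U h"
  shows "smooth_fun A U (\<lambda>p. L (h p))"
  unfolding smooth_fun_chartwise
proof
  fix c assume c: "c \<in> A"
  show "smooth_on (snd c ` (fst c \<inter> U)) (\<lambda>x. L (h (chart_inv c x)))"
    by (rule smooth_on_bounded_linear[OF chart_image_open_Int[OF c assms(1)] assms(2)])
      (use assms(3) c in \<open>simp add: smooth_fun_chartwise\<close>)
qed

lemma smooth_fun_bilinear:
  assumes "open U" "bounded_bilinear b" "smooth_fun A U h" "smooth_fun A U k"
  shows "smooth_fun A U (\<lambda>p. b (h p) (k p))"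
  unfolding smooth_fun_chartwise
proof
  fix c assume c: "c \<in> A"
  show "smooth_on (snd c ` (fst c \<inter> U)) (\<lambda>x. b (h (chart_inv c x)) (k (chart_inv c x)))"
    by (rule smooth_on_bilinear[OF chart_image_open_Int[OF c assms(1)] assms(2)])
      (use assms(3,4) c in \<open>simp_all add: smooth_fun_chartwise\<close>)
qed

lemma smooth_fun_add:
  assumes "open U" "smooth_fun A U h" "smooth_fun A U k"
  shows "smooth_fun A U (\<lambda>p. h p + k p)"
  unfolding smooth_fun_chartwise
proof
  fix c assume c: "c \<in> A"
  show "smooth_on (snd c ` (fst c \<inter> U)) (\<lambda>x. h (chart_inv c x) + k (chart_inv c x))"
    by (rule smooth_on_add[OF chart_image_open_Int[OF c assms(1)]])
      (use assms(2,3) c in \<open>simp_all add: smooth_fun_chartwise\<close>)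
qed

lemmas smooth_fun_scaleR = smooth_fun_bilinear[OF _ bounded_bilinear_scaleR]
lemmas smooth_fun_mult = smooth_fun_bilinear[OF _ bounded_bilinear_mult]
lemmas smooth_fun_inner_left = smooth_fun_bounded_linear[OF _ bounded_linear_inner_left]

lemma smooth_fun_inverse:
  fixes h :: "'p \<Rightarrow> real"
  assumes "open U" "smooth_fun A U h" "\<And>p. p \<in> U \<Longrightarrow> h p \<noteq> 0"
  shows "smooth_fun A U (\<lambda>p. inverse (h p))"
  unfolding smooth_fun_def comp_def
proof
  fix c assume c: "c \<in> A"
  show "smooth_on (snd c ` (fst c \<inter> U)) (\<lambda>x. inverse (h (chart_inv c x)))"
  proof (rule smooth_on_inverse[OF chart_image_open_Int[OF c assms(1)]])
    show "smooth_on (snd c ` (fst c \<inter> U)) (\<lambda>x. h (chart_inv c x))"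
      using assms(2) c by (simp add: smooth_fun_def comp_def)
  qed (use c assms(3) in \<open>auto simp: chart_inv_chart\<close>)
qed

text \<open>Covers derivatives whose base point and direction both vary. The change of components
  between two charts and the derivative along a vector field have this shape.\<close>

lemma smooth_fun_directional:
  assumes "open U" "smooth_fun A U h" "smooth_fun A U v" "open T" "h ` U \<subseteq> T" "smooth_on T k"
  shows "smooth_fun A U (\<lambda>p. frechet_derivative k (at (h p)) (v p))"
  unfolding smooth_fun_def
proof
  fix c assume c: "c \<in> A"
  let ?S = "snd c ` (fst c \<inter> U)"
  have S: "open ?S" using c assms(1) by (rule chart_image_open_Int)
  have h: "smooth_on ?S (h \<circ> chart_inv c)" and v: "smooth_on ?S (v \<circ> chart_inv c)"
    using assms c by (auto simp: smooth_fun_def)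
  have im: "(h \<circ> chart_inv c) ` ?S \<subseteq> T" using c assms(5) by (auto simp: chart_inv_chart)
  show "smooth_on ?S ((\<lambda>p. frechet_derivative k (at (h p)) (v p)) \<circ> chart_inv c)"
  proof (rule smooth_on_cong[OF S])
    show "smooth_on ?S (\<lambda>y. \<Sum>i\<in>Basis. ((v \<circ> chart_inv c) y \<bullet> i) *\<^sub>R
        frechet_derivative k (at ((h \<circ> chart_inv c) y)) i)"
    proof (rule smooth_on_sum[OF S])
      fix i
      have "smooth_on ?S (\<lambda>y. (v \<circ> chart_inv c) y \<bullet> i)"
        by (rule smooth_on_bounded_linear[OF S bounded_linear_inner_left v])
      moreover have "smooth_on ?S (\<lambda>y. frechet_derivative k (at ((h \<circ> chart_inv c) y)) i)"
        by (rule smooth_on_compose[OF S assms(4) im smooth_on_frechet_derivative[OF assms(6)] h])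
      ultimately show "smooth_on ?S (\<lambda>y. ((v \<circ> chart_inv c) y \<bullet> i) *\<^sub>R
          frechet_derivative k (at ((h \<circ> chart_inv c) y)) i)"
        by (rule smooth_on_bilinear[OF S bounded_bilinear_scaleR])
    qed
    show "(\<Sum>i\<in>Basis. ((v \<circ> chart_inv c) y \<bullet> i) *\<^sub>R frechet_derivative k (at ((h \<circ> chart_inv c) y)) i)
        = ((\<lambda>p. frechet_derivative k (at (h p)) (v p)) \<circ> chart_inv c) y" if "y \<in> ?S" for y
    proof -
      have "h (chart_inv c y) \<in> T" using im that by auto
      then show ?thesis unfolding comp_apply
        by (rule frechet_derivative_expand[OF smooth_on_differentiable[OF assms(6)], symmetric])
    qed
  qed
qed

lemma smooth_fun_chart: "c \<in> A \<Longrightarrow> smooth_fun A (fst c) (snd c)"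
  using transition_smooth by (auto simp: smooth_fun_def)

lemma rep_has_derivative:
  assumes "smooth_fun A U h" "open U" "c \<in> A" "p \<in> fst c" "p \<in> U"
  shows "((h \<circ> chart_inv c) has_derivative frechet_derivative (h \<circ> chart_inv c) (at (snd c p)))
    (at (snd c p))"
  using smooth_on_has_derivative[OF smooth_funD(3,2)[OF assms]] .

lemma dird_has_derivative:
  assumes "smooth_fun A U h" "open U" "p \<in> U"
  shows "((h \<circ> chart_inv (chart_at A p)) has_derivative dird A h p) (at (snd (chart_at A p) p))"
proof -
  have "dird A h p = frechet_derivative (h \<circ> chart_inv (chart_at A p)) (at (snd (chart_at A p) p))"
    by (intro ext) (simp only: dird_def)
  then show ?thesis using rep_has_derivative[OF assms(1,2) chart_at assms(3)] by (simp only:)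
qed

lemma dirdI:
  "((h \<circ> chart_inv (chart_at A p)) has_derivative D) (at (snd (chart_at A p) p)) \<Longrightarrow> dird A h p = D"
  by (intro ext) (simp only: dird_def frechet_derivativeI)

lemma dird_linear: "smooth_fun A U h \<Longrightarrow> open U \<Longrightarrow> p \<in> U \<Longrightarrow> linear (dird A h p)"
  by (rule has_derivative_linear[OF dird_has_derivative])

lemma dird_cong:
  assumes "open U" "p \<in> U" "\<And>p. p \<in> U \<Longrightarrow> h p = k p"
  shows "dird A h p v = dird A k p v"
proof -
  let ?c = "chart_at A p"
  have "frechet_derivative (h \<circ> chart_inv ?c) (at (snd ?c p))
      = frechet_derivative (k \<circ> chart_inv ?c) (at (snd ?c p))"
    by (rule frechet_derivative_cong_open[of "snd ?c ` (fst ?c \<inter> U)"])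
      (use assms chart_at[of p] in \<open>auto intro!: chart_image_open_Int simp: chart_inv_chart\<close>)
  then show ?thesis by (simp add: dird_def)
qed

lemma dird_const: "dird A (\<lambda>p. a) p v = 0"
  by (simp add: dird_def comp_def frechet_derivative_const)

lemma dird_add:
  assumes "smooth_fun A U h" "smooth_fun A U k" "open U" "p \<in> U"
  shows "dird A (\<lambda>p. h p + k p) p v = dird A h p v + dird A k p v"
proof -
  have "dird A (\<lambda>p. h p + k p) p = (\<lambda>v. dird A h p v + dird A k p v)"
    by (rule dirdI, unfold comp_def)
      (rule has_derivative_add[OF dird_has_derivative[OF assms(1,3,4), unfolded comp_def]
        dird_has_derivative[OF assms(2-4), unfolded comp_def]])
  then show ?thesis by simp
qed

lemma dird_bounded_linear:
  assumes "smooth_fun A U h" "open U" "p \<in> U" "bounded_linear L"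
  shows "dird A (\<lambda>p. L (h p)) p v = L (dird A h p v)"
proof -
  have "dird A (\<lambda>p. L (h p)) p = (\<lambda>v. L (dird A h p v))"
    by (rule dirdI, unfold comp_def)
      (rule bounded_linear.has_derivative[OF assms(4) dird_has_derivative[OF assms(1-3), unfolded comp_def]])
  then show ?thesis by simp
qed

lemma dird_bilinear:
  assumes "bounded_bilinear b" "smooth_fun A U h" "smooth_fun A U k" "open U" "p \<in> U"
  shows "dird A (\<lambda>p. b (h p) (k p)) p v = b (dird A h p v) (k p) + b (h p) (dird A k p v)"
proof -
  have "dird A (\<lambda>p. b (h p) (k p)) p = (\<lambda>v. b (h p) (dird A k p v) + b (dird A h p v) (k p))"
    by (rule dirdI, unfold comp_def)
      (rule bounded_bilinear.FDERIV[OF assms(1) dird_has_derivative[OF assms(2,4,5), unfolded comp_def]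
          dird_has_derivative[OF assms(3-5), unfolded comp_def],
          unfolded chart_inv_chart[OF chart_at[of p]]])
  then show ?thesis by simp
qed

lemmas dird_scaleR = dird_bilinear[OF bounded_bilinear_scaleR]
lemmas dird_mult = dird_bilinear[OF bounded_bilinear_mult]

text \<open>\<open>dird\<close> reads everything in the preferred chart at \<open>p\<close>, which
  may jump with \<open>p\<close>. The chain rule through the transition map replaces it by one fixed
  chart, in which dependence on \<open>p\<close> can be studied.\<close>

lemma dird_chart:
  assumes "c \<in> A" "p \<in> fst c" "open U" "p \<in> U" "smooth_fun A U h"
  shows "dird A h p v = frechet_derivative (h \<circ> chart_inv c) (at (snd c p)) (comps A c p v)"
proof -
  let ?c = "chart_at A p"
  have "((snd c \<circ> chart_inv ?c) has_derivative comps A c p) (at (snd ?c p))"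
    using dird_has_derivative[OF smooth_fun_chart[OF assms(1)] chart(1)[OF assms(1)] assms(2)]
    unfolding comps_def by simp
  moreover have "((h \<circ> chart_inv c) has_derivative frechet_derivative (h \<circ> chart_inv c) (at (snd c p)))
      (at ((snd c \<circ> chart_inv ?c) (snd ?c p)))"
    using rep_has_derivative[OF assms(5,3,1,2,4)] chart_at[of p] by (simp add: chart_inv_chart)
  ultimately have D: "((\<lambda>y. (h \<circ> chart_inv c) ((snd c \<circ> chart_inv ?c) y)) has_derivative
      (\<lambda>v. frechet_derivative (h \<circ> chart_inv c) (at (snd c p)) (comps A c p v))) (at (snd ?c p))"
    by (rule has_derivative_compose)
  have "((h \<circ> chart_inv ?c) has_derivative
      (\<lambda>v. frechet_derivative (h \<circ> chart_inv c) (at (snd c p)) (comps A c p v))) (at (snd ?c p))"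
    by (rule has_derivative_transform_within_open[OF D, of "snd ?c ` (fst ?c \<inter> fst c)"])
      (use assms(1,2) chart_at[of p] in \<open>auto intro!: chart_image_open_Int[OF _ chart(1)] simp: chart_inv_chart\<close>)
  then show ?thesis by (simp add: dirdI)
qed

lemma comps_transition:
  assumes "c \<in> A" "p \<in> fst c" "d \<in> A" "p \<in> fst d"
  shows "comps A d p v = frechet_derivative (snd d \<circ> chart_inv c) (at (snd c p)) (comps A c p v)"
  unfolding comps_def[of A d]
  using dird_chart[OF assms(1,2) chart(1)[OF assms(3)] assms(4) smooth_fun_chart[OF assms(3)]] .

lemma comps_linear: "c \<in> A \<Longrightarrow> p \<in> fst c \<Longrightarrow> linear (comps A c p)"
  unfolding comps_def using dird_linear[OF smooth_fun_chart chart(1)] by simp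

lemma transition_self:
  assumes "c \<in> A" "p \<in> fst c"
  shows "frechet_derivative (snd c \<circ> chart_inv c) (at (snd c p)) v = v"
proof -
  have "frechet_derivative (snd c \<circ> chart_inv c) (at (snd c p)) = frechet_derivative (\<lambda>x. x) (at (snd c p))"
    by (rule frechet_derivative_cong_open[OF chart(2)[OF assms(1)]])
      (use assms in \<open>auto simp: chart_inv_chart\<close>)
  then show ?thesis by (simp add: frechet_derivativeI[OF has_derivative_ident])
qed

lemma comps_chart_at [simp]: "comps A (chart_at A p) p v = v"
  by (simp add: comps_def dird_def transition_self chart_at)

lemma transition_inverse:
  assumes "c \<in> A" "d \<in> A" "p \<in> fst c" "p \<in> fst d"
  shows "frechet_derivative (snd c \<circ> chart_inv d) (at (snd d p))
    (frechet_derivative (snd d \<circ> chart_inv c) (at (snd c p)) v) = v"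
proof -
  let ?S = "snd c ` (fst c \<inter> fst d)"
  have S: "open ?S" using assms by (intro chart_image_open_Int chart(1))
  have 1: "((snd d \<circ> chart_inv c) has_derivative frechet_derivative (snd d \<circ> chart_inv c) (at (snd c p)))
      (at (snd c p))"
    using rep_has_derivative[OF smooth_fun_chart chart(1)] assms by auto
  have 2: "((snd c \<circ> chart_inv d) has_derivative frechet_derivative (snd c \<circ> chart_inv d) (at (snd d p)))
      (at ((snd d \<circ> chart_inv c) (snd c p)))"
    using rep_has_derivative[OF smooth_fun_chart chart(1)] assms by (auto simp: chart_inv_chart)
  have "((\<lambda>x. x) has_derivative (\<lambda>v. frechet_derivative (snd c \<circ> chart_inv d) (at (snd d p))
    (frechet_derivative (snd d \<circ> chart_inv c) (at (snd c p)) v))) (at (snd c p))"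
    by (rule has_derivative_transform_within_open[OF has_derivative_compose[OF 1 2] S])
      (use assms in \<open>auto simp: chart_inv_chart\<close>)
  from has_derivative_unique[OF this has_derivative_ident] show ?thesis by (rule fun_cong)
qed

lemma coord_field_comps:
  assumes "c \<in> A" "p \<in> fst c"
  shows "coord_field A c (comps A c p v) p = v"
  unfolding coord_field_def comps_def dird_def
  by (rule transition_inverse[OF chart_at(1) assms(1) chart_at(2) assms(2)])

lemma comps_coord_field:
  assumes "c \<in> A" "p \<in> fst c"
  shows "comps A c p (coord_field A c u p) = u"
  unfolding coord_field_def comps_def dird_def
  by (rule transition_inverse[OF assms(1) chart_at(1) assms(2) chart_at(2)])

lemma coord_field_linear:
  assumes "c \<in> A" "p \<in> fst c"
  shows "linear (\<lambda>u. coord_field A c u p)"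
proof -
  have "linear (frechet_derivative (snd (chart_at A p) \<circ> chart_inv c) (at (snd c p)))"
    by (rule has_derivative_linear[OF rep_has_derivative[OF smooth_fun_chart[OF chart_at(1)]
            chart(1)[OF chart_at(1)] assms chart_at(2)]])
  then show ?thesis by (simp add: coord_field_def)
qed

lemma coord_field_expand:
  assumes "c \<in> A" "p \<in> fst c"
  shows "v = (\<Sum>i\<in>Basis. (comps A c p v \<bullet> i) *\<^sub>R coord_field A c i p)"
proof -
  have "coord_field A c (comps A c p v) p = (\<Sum>i\<in>Basis. (comps A c p v \<bullet> i) *\<^sub>R coord_field A c i p)"
    by (rule linear_euclidean_expand[OF coord_field_linear[OF assms]])
  then show ?thesis unfolding coord_field_comps[OF assms] .
qed

end

section \<open>Smooth maps and vector fields along them\<close>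

locale smooth_mfd_map = src: smooth_mfd B + tgt: smooth_mfd A
  for B :: "('q::{t2_space,second_countable_topology}, 'f::euclidean_space) atlas"
    and A :: "('p::{t2_space,second_countable_topology}, 'e::euclidean_space) atlas" +
  fixes f :: "'q \<Rightarrow> 'p"
  assumes smooth_map: "smooth_map B A f"
begin

lemma continuous: "continuous_on UNIV f"
  using smooth_map by (simp add: smooth_map_def)

lemma open_vimage_map: "open O' \<Longrightarrow> open (f -` O')"
  using continuous by (simp add: continuous_on_open_vimage)

lemma open_dom: "open U \<Longrightarrow> d \<in> A \<Longrightarrow> open (U \<inter> f -` fst d)"
  using open_vimage_map tgt.chart(1) by blast

lemma smooth_fun_coords: "d \<in> A \<Longrightarrow> smooth_fun B (f -` fst d) (snd d \<circ> f)"
  using smooth_map by (simp add: smooth_map_def)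

lemma field_alongI:
  assumes "\<And>q. q \<in> U \<Longrightarrow> \<exists>d\<in>A. \<exists>W. open W \<and> q \<in> W \<and> W \<subseteq> f -` fst d \<and>
    smooth_fun B W (\<lambda>q. comps A d (f q) (V q))"
  shows "field_along B A f U V"
  unfolding field_along_def
proof (intro ballI src.smooth_fun_local)
  fix d' q assume d': "d' \<in> A" and "q \<in> U \<inter> f -` fst d'"
  then have q: "q \<in> U" "f q \<in> fst d'" by auto
  then obtain d W where d: "d \<in> A" "open W" "q \<in> W" "W \<subseteq> f -` fst d"
    and sm: "smooth_fun B W (\<lambda>q. comps A d (f q) (V q))" using assms by blast
  define N where "N = W \<inter> f -` fst d'"
  have N: "open N" "q \<in> N" "N \<subseteq> W" using open_dom[OF d(2) d'] q d by (auto simp: N_def)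
  let ?k = "snd d' \<circ> chart_inv d" and ?T = "snd d ` (fst d \<inter> fst d')"
  have "smooth_fun B N (\<lambda>q. frechet_derivative ?k (at ((snd d \<circ> f) q)) (comps A d (f q) (V q)))"
  proof (rule src.smooth_fun_directional[OF N(1)])
    show "smooth_fun B N (snd d \<circ> f)"
      by (rule src.smooth_fun_subset[OF smooth_fun_coords[OF d(1)]]) (use N d in auto)
    show "smooth_fun B N (\<lambda>q. comps A d (f q) (V q))"
      by (rule src.smooth_fun_subset[OF sm N(3)])
    show "open ?T" using d d' by (intro tgt.chart_image_open_Int tgt.chart(1))
    show "(snd d \<circ> f) ` N \<subseteq> ?T" using d by (auto simp: N_def)
    show "smooth_on ?T ?k" by (rule tgt.transition_smooth[OF d(1) d'])
  qed
  then have "smooth_fun B N (\<lambda>q. comps A d' (f q) (V q))"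
    by (rule src.smooth_fun_cong[OF N(1), rotated])
      (use d d' in \<open>auto simp: N_def tgt.comps_transition[of d _ d']\<close>)
  then show "\<exists>V'. open V' \<and> q \<in> V' \<and> smooth_fun B V' (\<lambda>q. comps A d' (f q) (V q))"
    using N by blast
qed

lemma field_alongD:
  "field_along B A f U V \<Longrightarrow> d \<in> A \<Longrightarrow> smooth_fun B (U \<inter> f -` fst d) (\<lambda>q. comps A d (f q) (V q))"
  by (simp add: field_along_def)

lemma field_along_subset: "field_along B A f U V \<Longrightarrow> U' \<subseteq> U \<Longrightarrow> field_along B A f U' V"
  unfolding field_along_def by (meson inf_mono order_refl src.smooth_fun_subset)

lemma field_along_local:
  assumes "\<And>q. q \<in> U \<Longrightarrow> \<exists>N. open N \<and> q \<in> N \<and> field_along B A f N V"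
  shows "field_along B A f U V"
proof (rule field_alongI)
  fix q assume "q \<in> U"
  then obtain N where N: "open N" "q \<in> N" "field_along B A f N V" using assms by blast
  let ?d = "chart_at A (f q)"
  show "\<exists>d\<in>A. \<exists>W. open W \<and> q \<in> W \<and> W \<subseteq> f -` fst d \<and> smooth_fun B W (\<lambda>q. comps A d (f q) (V q))"
    using field_alongD[OF N(3), of ?d] open_dom[OF N(1), of ?d] N tgt.chart_at[of "f q"]
    by (intro bexI[of _ ?d] exI[of _ "N \<inter> f -` fst ?d"]) auto
qed

lemma field_along_cong:
  assumes "open U" "\<And>q. q \<in> U \<Longrightarrow> V q = W q" "field_along B A f U V"
  shows "field_along B A f U W"
  unfolding field_along_def
  by (intro ballI src.smooth_fun_cong[OF open_dom[OF assms(1)] _ field_alongD[OF assms(3)]])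
    (use assms(2) in auto)

lemma field_along_add:
  assumes "open U" "field_along B A f U V" "field_along B A f U W"
  shows "field_along B A f U (\<lambda>q. V q + W q)"
  unfolding field_along_def
proof
  fix d assume d: "d \<in> A"
  show "smooth_fun B (U \<inter> f -` fst d) (\<lambda>q. comps A d (f q) (V q + W q))"
    by (rule src.smooth_fun_cong[OF open_dom[OF assms(1) d] _
          src.smooth_fun_add[OF open_dom[OF assms(1) d] field_alongD[OF assms(2) d] field_alongD[OF assms(3) d]]])
      (use d in \<open>auto simp: linear_add[OF tgt.comps_linear]\<close>)
qed

lemma field_along_scaleR:
  assumes "open U" "smooth_fun B U h" "field_along B A f U V"
  shows "field_along B A f U (\<lambda>q. h q *\<^sub>R V q)"
  unfolding field_along_def
proof
  fix d assume d: "d \<in> A"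
  have h: "smooth_fun B (U \<inter> f -` fst d) h"
    by (rule src.smooth_fun_subset[OF assms(2)]) auto
  show "smooth_fun B (U \<inter> f -` fst d) (\<lambda>q. comps A d (f q) (h q *\<^sub>R V q))"
    by (rule src.smooth_fun_cong[OF open_dom[OF assms(1) d] _
          src.smooth_fun_scaleR[OF open_dom[OF assms(1) d] h field_alongD[OF assms(3) d]]])
      (use d in \<open>auto simp: linear_cmul[OF tgt.comps_linear]\<close>)
qed

lemma field_along_zero: "field_along B A f U (\<lambda>q. 0)"
  unfolding field_along_def
proof
  fix d assume d: "d \<in> A"
  have "open (f -` fst d)" using open_vimage_map tgt.chart(1)[OF d] by blast
  then have "smooth_fun B (f -` fst d) (\<lambda>q. comps A d (f q) 0)"
    by (rule src.smooth_fun_cong[OF _ _ src.smooth_fun_const[of _ 0]])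
      (use d in \<open>auto simp: linear_0[OF tgt.comps_linear]\<close>)
  then show "smooth_fun B (U \<inter> f -` fst d) (\<lambda>q. comps A d (f q) 0)"
    by (rule src.smooth_fun_subset) auto
qed

lemma field_along_sum:
  assumes "open U" "\<And>i. i \<in> I \<Longrightarrow> field_along B A f U (V i)"
  shows "field_along B A f U (\<lambda>q. \<Sum>i\<in>I. V i q)"
  using assms(2)
  by (induction I rule: infinite_finite_induct) (auto intro: field_along_zero field_along_add[OF assms(1)])

lemma field_along_minus:
  assumes "open U" "field_along B A f U V"
  shows "field_along B A f U (\<lambda>q. - V q)"
  using field_along_scaleR[OF assms(1) src.smooth_fun_const[of _ "-1"] assms(2)] by simp

lemma field_along_diff:
  assumes "open U" "field_along B A f U V" "field_along B A f U W"
  shows "field_along B A f U (\<lambda>q. V q - W q)"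
  using field_along_add[OF assms(1,2) field_along_minus[OF assms(1,3)]] by simp

end

context smooth_mfd
begin

lemma smooth_mfd_map_id: "smooth_mfd_map A A (\<lambda>p. p)"
proof
  show "smooth_map A A (\<lambda>p. p)"
    by (simp add: smooth_map_def comp_def smooth_fun_chart)
qed

text \<open>Vector fields are the fields along the identity, so the closure and locality facts about
  \<open>field_along\<close> become available for them without separate proofs.\<close>

sublocale idm: smooth_mfd_map A A "\<lambda>p. p"
  rewrites "field_along A A (\<lambda>p. p) = vector_field A"
proof -
  show "smooth_mfd_map A A (\<lambda>p. p)" by (rule smooth_mfd_map_id)
  show "field_along A A (\<lambda>p. p) = vector_field A"
    by (intro ext) (simp add: field_along_def vector_field_def)
qed

lemma coord_field_vector_field: "c \<in> A \<Longrightarrow> vector_field A (fst c) (coord_field A c u)"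
proof (rule idm.field_alongI)
  fix p assume c: "c \<in> A" "p \<in> fst c"
  have "smooth_fun A (fst c) (\<lambda>p. comps A c p (coord_field A c u p))"
    by (rule smooth_fun_cong[OF chart(1) _ smooth_fun_const[of _ u]])
      (use c in \<open>auto simp: comps_coord_field\<close>)
  then show "\<exists>d\<in>A. \<exists>W. open W \<and> p \<in> W \<and> W \<subseteq> (\<lambda>p. p) -` fst d \<and>
      smooth_fun A W (\<lambda>q. comps A d q (coord_field A c u q))"
    using c chart(1) by (intro bexI[of _ c] exI[of _ "fst c"]) auto
qed

lemma vector_field_comps:
  "vector_field A U X \<Longrightarrow> c \<in> A \<Longrightarrow> smooth_fun A (U \<inter> fst c) (\<lambda>p. comps A c p (X p))"
  by (simp add: vector_field_def)

lemma dird_smooth: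
  assumes "open U" "smooth_fun A U h" "vector_field A U X"
  shows "smooth_fun A U (\<lambda>p. dird A h p (X p))"
proof (rule smooth_fun_local)
  fix p assume p: "p \<in> U"
  let ?c = "chart_at A p"
  let ?N = "U \<inter> fst ?c"
  have N: "open ?N" "p \<in> ?N" using assms(1) p chart_at[of p] by (auto intro: open_Int_chart)
  have sm: "smooth_fun A ?N (\<lambda>q. frechet_derivative (h \<circ> chart_inv ?c) (at (snd ?c q)) (comps A ?c q (X q)))"
  proof (rule smooth_fun_directional[OF N(1) _ vector_field_comps[OF assms(3) chart_at(1)]])
    show "smooth_fun A ?N (snd ?c)"
      by (rule smooth_fun_subset[OF smooth_fun_chart[OF chart_at(1)]]) auto
    show "open (snd ?c ` (fst ?c \<inter> U))" "smooth_on (snd ?c ` (fst ?c \<inter> U)) (h \<circ> chart_inv ?c)"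
      using smooth_funD[OF assms(2,1) chart_at p] by auto
  qed auto
  have "smooth_fun A ?N (\<lambda>p. dird A h p (X p))"
    by (rule smooth_fun_cong[OF N(1) _ sm]) (use dird_chart[OF chart_at(1) _ assms(1) _ assms(2)] in auto)
  with N show "\<exists>V. open V \<and> p \<in> V \<and> smooth_fun A V (\<lambda>p. dird A h p (X p))" by blast
qed

end

section \<open>Lie brackets and pullbacks\<close>

text \<open>A product rule for a derivative taken in a moving direction. The second order term is
  isolated because symmetry will cancel it in the Lie bracket.\<close>

lemma frechet_derivative_directional:
  assumes "open S" "smooth_on S H" "smooth_on S y" "x \<in> S"
  shows "frechet_derivative (\<lambda>x. frechet_derivative H (at x) (y x)) (at x) v =
    frechet_derivative H (at x) (frechet_derivative y (at x) v)
    + frechet_derivative (\<lambda>z. frechet_derivative H (at z) (y x)) (at x) v"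
proof -
  let ?D = "\<lambda>i z. frechet_derivative H (at z) i"
  have expand: "frechet_derivative H (at z) w = (\<Sum>i\<in>Basis. (w \<bullet> i) *\<^sub>R ?D i z)" if "z \<in> S" for z w
    by (rule frechet_derivative_expand[OF smooth_on_differentiable[OF assms(2) that]])
  have D: "(?D i has_derivative frechet_derivative (?D i) (at x)) (at x)" for i
    by (rule smooth_on_has_derivative[OF smooth_on_frechet_derivative[OF assms(2)] assms(4)])
  have y: "((\<lambda>x. y x \<bullet> i) has_derivative (\<lambda>v. frechet_derivative y (at x) v \<bullet> i)) (at x)" for i
    by (rule has_derivative_inner_left[OF smooth_on_has_derivative[OF assms(3,4)]])
  have 1: "((\<lambda>x. \<Sum>i\<in>Basis. (y x \<bullet> i) *\<^sub>R ?D i x) has_derivative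
      (\<lambda>v. \<Sum>i\<in>Basis. (y x \<bullet> i) *\<^sub>R frechet_derivative (?D i) (at x) v
        + (frechet_derivative y (at x) v \<bullet> i) *\<^sub>R ?D i x)) (at x)"
    by (rule has_derivative_sum) (rule has_derivative_scaleR[OF y D])
  have 2: "((\<lambda>z. \<Sum>i\<in>Basis. (y x \<bullet> i) *\<^sub>R ?D i z) has_derivative
      (\<lambda>v. \<Sum>i\<in>Basis. (y x \<bullet> i) *\<^sub>R frechet_derivative (?D i) (at x) v)) (at x)"
    by (rule has_derivative_sum) (rule has_derivative_scaleR_right[OF D])
  have "((\<lambda>x. frechet_derivative H (at x) (y x)) has_derivative
      (\<lambda>v. \<Sum>i\<in>Basis. (y x \<bullet> i) *\<^sub>R frechet_derivative (?D i) (at x) v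
        + (frechet_derivative y (at x) v \<bullet> i) *\<^sub>R ?D i x)) (at x)"
    by (rule has_derivative_transform_within_open[OF 1 assms(1,4)]) (rule expand[symmetric])
  moreover have "((\<lambda>z. frechet_derivative H (at z) (y x)) has_derivative
      (\<lambda>v. \<Sum>i\<in>Basis. (y x \<bullet> i) *\<^sub>R frechet_derivative (?D i) (at x) v)) (at x)"
    by (rule has_derivative_transform_within_open[OF 2 assms(1,4)]) (rule expand[symmetric])
  ultimately show ?thesis
    using expand[OF assms(4), of "frechet_derivative y (at x) v"]
    by (simp add: frechet_derivativeI sum.distrib)
qed

context smooth_mfd
begin

text \<open>In the preferred chart each iterated derivative splits into a first order term, which
  makes up the bracket, and a second derivative of \<open>h\<close>, which is symmetric and drops
  out of the difference.\<close>

lemma dird_lie_bracket: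
  assumes U: "open U" "p \<in> U" and h: "smooth_fun A U h"
    and X: "vector_field A U X" and Y: "vector_field A U Y"
  shows "dird A h p (lie_bracket A X Y p) =
    dird A (\<lambda>p. dird A h p (Y p)) p (X p) - dird A (\<lambda>p. dird A h p (X p)) p (Y p)"
proof -
  let ?c = "chart_at A p"
  have c: "?c \<in> A" "p \<in> fst ?c" by (rule chart_at)+
  let ?S = "snd ?c ` (fst ?c \<inter> U)" and ?N = "fst ?c \<inter> U"
  have S: "open ?S" and pS: "snd ?c p \<in> ?S" using chart_image_open_Int[OF c(1) U(1)] c U by auto
  let ?H = "h \<circ> chart_inv ?c"
  define xi where "xi X = (\<lambda>q. comps A ?c q (X q)) \<circ> chart_inv ?c" for X
  have H: "smooth_on ?S ?H" using h c by (simp add: smooth_fun_def)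
  have xi: "smooth_on ?S (xi X)" if "vector_field A U X" for X
  proof -
    have "smooth_on (snd ?c ` (fst ?c \<inter> (U \<inter> fst ?c))) (xi X)"
      using vector_field_comps[OF that c(1)] c(1) unfolding smooth_fun_def xi_def by blast
    then show ?thesis by (rule smooth_on_subset) auto
  qed
  have xip: "xi X (snd ?c p) = X p" for X using c by (simp add: xi_def chart_inv_chart)
  have key: "dird A (\<lambda>p. dird A h p (Y p)) p v =
      frechet_derivative ?H (at (snd ?c p)) (dird A (\<lambda>q. comps A ?c q (Y q)) p v)
      + frechet_derivative (\<lambda>z. frechet_derivative ?H (at z) (Y p)) (at (snd ?c p)) v"
    if Y: "vector_field A U Y" for Y v
  proof -
    have "dird A (\<lambda>p. dird A h p (Y p)) p v
        = frechet_derivative (\<lambda>x. frechet_derivative ?H (at x) (xi Y x)) (at (snd ?c p)) v"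
      unfolding dird_def[of A _ p]
    proof (rule fun_cong[OF frechet_derivative_cong_open[OF S pS]])
      fix z assume "z \<in> ?S"
      then obtain q where q: "q \<in> fst ?c" "q \<in> U" "z = snd ?c q" by auto
      show "((\<lambda>p. dird A h p (Y p)) \<circ> chart_inv ?c) z = frechet_derivative ?H (at z) (xi Y z)"
        using q dird_chart[OF c(1) q(1) U(1) q(2) h] c(1) by (simp add: xi_def chart_inv_chart)
    qed
    also have "\<dots> = frechet_derivative ?H (at (snd ?c p)) (frechet_derivative (xi Y) (at (snd ?c p)) v)
      + frechet_derivative (\<lambda>z. frechet_derivative ?H (at z) (xi Y (snd ?c p))) (at (snd ?c p)) v"
      by (rule frechet_derivative_directional[OF S H xi[OF Y] pS])
    finally show ?thesis unfolding xip unfolding dird_def[of A "\<lambda>q. comps A ?c q (Y q)"] xi_def .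
  qed
  have sym: "frechet_derivative (\<lambda>z. frechet_derivative ?H (at z) (Y p)) (at (snd ?c p)) (X p)
      = frechet_derivative (\<lambda>z. frechet_derivative ?H (at z) (X p)) (at (snd ?c p)) (Y p)"
    by (rule second_derivative_symmetric[OF S H pS])
  have "dird A h p (lie_bracket A X Y p)
      = frechet_derivative ?H (at (snd ?c p)) (lie_bracket A X Y p)"
    by (simp only: dird_def)
  also have "\<dots> = frechet_derivative ?H (at (snd ?c p)) (dird A (\<lambda>q. comps A ?c q (Y q)) p (X p))
      - frechet_derivative ?H (at (snd ?c p)) (dird A (\<lambda>q. comps A ?c q (X q)) p (Y p))"
    unfolding lie_bracket_def
    by (rule linear_diff[OF linear_frechet_derivative[OF smooth_on_differentiable[OF H pS]]])
  finally show ?thesis unfolding key[OF X] key[OF Y] sym by simp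
qed

text \<open>The previous lemma for the chart map itself. The definition of the bracket uses a
  different chart at each point; smoothness of the bracket needs the formula in one fixed
  chart.\<close>

lemma comps_lie_bracket:
  assumes "open U" "p \<in> U" "c \<in> A" "p \<in> fst c" "vector_field A U X" "vector_field A U Y"
  shows "comps A c p (lie_bracket A X Y p) =
    dird A (\<lambda>p. comps A c p (Y p)) p (X p) - dird A (\<lambda>p. comps A c p (X p)) p (Y p)"
proof -
  have "smooth_fun A (U \<inter> fst c) (snd c)"
    by (rule smooth_fun_subset[OF smooth_fun_chart[OF assms(3)]]) auto
  from dird_lie_bracket[OF open_Int_chart(1)[OF assms(3,1)] _ this
      idm.field_along_subset[OF assms(5)] idm.field_along_subset[OF assms(6)]]
  show ?thesis using assms(2,4) by (simp add: comps_def)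
qed

lemma lie_bracket_vector_field:
  assumes "open U" "vector_field A U X" "vector_field A U Y"
  shows "vector_field A U (lie_bracket A X Y)"
  unfolding vector_field_def
proof
  fix c assume c: "c \<in> A"
  let ?N = "U \<inter> fst c"
  have N: "open ?N" by (rule open_Int_chart(1)[OF c assms(1)])
  have D: "smooth_fun A ?N (\<lambda>p. dird A (\<lambda>p. comps A c p (V p)) p (W p))"
    if "vector_field A U V" "vector_field A U W" for V W
    by (rule dird_smooth[OF N vector_field_comps[OF that(1) c] idm.field_along_subset[OF that(2)]]) auto
  have "smooth_fun A ?N (\<lambda>p. dird A (\<lambda>p. comps A c p (Y p)) p (X p)
      + (-1) *\<^sub>R dird A (\<lambda>p. comps A c p (X p)) p (Y p))"
    by (intro smooth_fun_add[OF N] smooth_fun_bounded_linear[OF N bounded_linear_scaleR_right] D assms)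
  then show "smooth_fun A ?N (\<lambda>p. comps A c p (lie_bracket A X Y p))"
    by (rule smooth_fun_cong[OF N, rotated]) (use assms c in \<open>simp add: comps_lie_bracket\<close>)
qed

lemma lie_bracket_coord_field:
  assumes "c \<in> A" "p \<in> fst c"
  shows "lie_bracket A (coord_field A c u) (coord_field A c w) p = 0"
proof -
  have D: "dird A (\<lambda>p. comps A c p (coord_field A c a p)) p b = 0" for a b
    using dird_cong[OF chart(1)[OF assms(1)] assms(2), of "\<lambda>p. comps A c p (coord_field A c a p)" "\<lambda>p. a"]
    by (simp add: comps_coord_field assms dird_const)
  have "comps A c p (lie_bracket A (coord_field A c u) (coord_field A c w) p) = 0"
    using comps_lie_bracket[OF chart(1) assms(2,1,2) coord_field_vector_field coord_field_vector_field,
        OF assms(1) assms(1) assms(1)] by (simp add: D)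
  then show ?thesis
    using coord_field_comps[OF assms] linear_0[OF coord_field_linear[OF assms]] by metis
qed

lemma smooth_fun_compose:
  assumes "open U" "smooth_fun A U h" "open T" "h ` U \<subseteq> T" "smooth_on T k"
  shows "smooth_fun A U (\<lambda>p. k (h p))"
  unfolding smooth_fun_chartwise
proof
  fix c assume c: "c \<in> A"
  show "smooth_on (snd c ` (fst c \<inter> U)) (\<lambda>x. k (h (chart_inv c x)))"
    by (rule smooth_on_compose[OF chart_image_open_Int[OF c assms(1)] assms(3) _ assms(5)])
      (use assms(2,4) c in \<open>auto simp: smooth_fun_chartwise chart_inv_chart\<close>)
qed

lemma dird_compose:
  assumes "open U" "p \<in> U" "smooth_fun A U h" "h p \<in> T" "smooth_on T k"
  shows "dird A (\<lambda>p. k (h p)) p v = frechet_derivative k (at (h p)) (dird A h p v)"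
proof -
  let ?c = "chart_at A p"
  have 1: "((\<lambda>y. h (chart_inv ?c y)) has_derivative dird A h p) (at (snd ?c p))"
    using dird_has_derivative[OF assms(3,1,2)] by (simp add: comp_def)
  have 2: "(k has_derivative frechet_derivative k (at (h p))) (at (h (chart_inv ?c (snd ?c p))))"
    using smooth_on_has_derivative[OF assms(5,4)] by (simp add: chart_inv_chart chart_at)
  have "dird A (\<lambda>p. k (h p)) p = (\<lambda>v. frechet_derivative k (at (h p)) (dird A h p v))"
    by (rule dirdI, unfold comp_def) (rule has_derivative_compose[OF 1 2])
  then show ?thesis by simp
qed

end

context smooth_mfd_map
begin

text \<open>Near \<open>q\<close> the composite factors through the chart at \<open>f q\<close>, and
  this single factorization yields both smoothness and the chain rule.\<close>

lemma map_locally: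
  assumes "open U" "q \<in> U" "open O'" "smooth_fun A O' h" "f q \<in> O'"
  obtains N where "open N" "q \<in> N" "N \<subseteq> U" "N \<subseteq> f -` O'" "smooth_fun B N (\<lambda>q. h (f q))"
    "\<And>v. dird B (\<lambda>q. h (f q)) q v = dird A h (f q) (dmap B A f q v)"
proof -
  let ?c = "chart_at A (f q)"
  have c: "?c \<in> A" "f q \<in> fst ?c" by (rule tgt.chart_at)+
  let ?T = "snd ?c ` (fst ?c \<inter> O')" and ?k = "h \<circ> chart_inv ?c"
  define N where "N = U \<inter> f -` (fst ?c \<inter> O')"
  have N: "open N" "q \<in> N"
    using open_Int[OF assms(1) open_vimage_map[OF tgt.open_Int_chart(2)[OF c(1) assms(3)]]] assms c
    by (auto simp: N_def)
  have T: "open ?T" by (rule tgt.chart_image_open_Int[OF c(1) assms(3)])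
  have k: "smooth_on ?T ?k" using assms(4) c by (simp add: smooth_fun_def)
  have F: "smooth_fun B N (snd ?c \<circ> f)"
    by (rule src.smooth_fun_subset[OF smooth_fun_coords[OF c(1)]]) (auto simp: N_def)
  have eq: "?k ((snd ?c \<circ> f) q) = h (f q)" if "q \<in> N" for q
    using that c by (simp add: N_def tgt.chart_inv_chart)
  have "smooth_fun B N (\<lambda>q. h (f q))"
    by (rule src.smooth_fun_cong[OF N(1) eq src.smooth_fun_compose[OF N(1) F T _ k]])
      (auto simp: N_def)
  moreover have "dird B (\<lambda>q. h (f q)) q v = dird A h (f q) (dmap B A f q v)" for v
  proof -
    have "dird B (\<lambda>q. h (f q)) q v = dird B (\<lambda>q. ?k ((snd ?c \<circ> f) q)) q v"
      by (rule src.dird_cong[OF N]) (rule eq[symmetric])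
    also have "\<dots> = frechet_derivative ?k (at ((snd ?c \<circ> f) q)) (dird B (snd ?c \<circ> f) q v)"
      by (rule src.dird_compose[OF N F _ k]) (use N in \<open>auto simp: N_def\<close>)
    finally show ?thesis by (simp add: dird_def[of A] dmap_def)
  qed
  ultimately show ?thesis using that[of N] N by (auto simp: N_def)
qed

lemma smooth_fun_pullback:
  assumes "open U" "open O'" "smooth_fun A O' h" "U \<subseteq> f -` O'"
  shows "smooth_fun B U (\<lambda>q. h (f q))"
proof (rule src.smooth_fun_local)
  fix q assume "q \<in> U"
  then show "\<exists>V. open V \<and> q \<in> V \<and> smooth_fun B V (\<lambda>q. h (f q))"
    using map_locally[OF assms(1) _ assms(2,3)] assms(4) by (metis subsetD vimageD)
qed

lemma dird_pullback:
  assumes "open O'" "smooth_fun A O' h" "f q \<in> O'"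
  shows "dird B (\<lambda>q. h (f q)) q v = dird A h (f q) (dmap B A f q v)"
  using map_locally[OF open_UNIV _ assms] by (metis UNIV_I)

lemma dmap_linear: "linear (dmap B A f q)"
proof -
  let ?c = "chart_at A (f q)"
  have "dmap B A f q = dird B (snd ?c \<circ> f) q" by (intro ext) (simp add: dmap_def)
  then show ?thesis
    using src.dird_linear[OF smooth_fun_coords[OF tgt.chart_at(1)]
        open_vimage_map[OF tgt.chart(1)[OF tgt.chart_at(1)]], of q] tgt.chart_at[of "f q"] by simp
qed

lemma comps_dmap:
  assumes "d \<in> A" "f q \<in> fst d"
  shows "comps A d (f q) (dmap B A f q v) = dird B (snd d \<circ> f) q v"
  using dird_pullback[OF tgt.chart(1)[OF assms(1)] tgt.smooth_fun_chart[OF assms(1)] assms(2), of v]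
  by (simp add: comps_def comp_def)

lemma field_along_dmap:
  assumes "open U" "vector_field B U X"
  shows "field_along B A f U (\<lambda>q. dmap B A f q (X q))"
  unfolding field_along_def
proof
  fix d assume d: "d \<in> A"
  let ?N = "U \<inter> f -` fst d"
  have N: "open ?N" by (rule open_dom[OF assms(1) d])
  have "smooth_fun B ?N (snd d \<circ> f)"
    by (rule src.smooth_fun_subset[OF smooth_fun_coords[OF d]]) auto
  from src.dird_smooth[OF N this src.idm.field_along_subset[OF assms(2)]]
  have "smooth_fun B ?N (\<lambda>q. dird B (snd d \<circ> f) q (X q))" by auto
  then show "smooth_fun B ?N (\<lambda>q. comps A d (f q) (dmap B A f q (X q)))"
    by (rule src.smooth_fun_cong[OF N, rotated]) (use d in \<open>simp add: comps_dmap\<close>)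
qed

lemma field_along_pullback:
  assumes "open U" "open O'" "vector_field A O' W" "U \<subseteq> f -` O'"
  shows "field_along B A f U (\<lambda>q. W (f q))"
  unfolding field_along_def
proof
  fix d assume d: "d \<in> A"
  show "smooth_fun B (U \<inter> f -` fst d) (\<lambda>q. comps A d (f q) (W (f q)))"
    by (rule smooth_fun_pullback[OF open_dom[OF assms(1) d] tgt.open_Int_chart(1)[OF d assms(2)]
          tgt.vector_field_comps[OF assms(3) d]]) (use assms(4) in auto)
qed

text \<open>A property of germs of fields along \<open>f\<close> at \<open>q\<close> need only be checked on restrictions of
  ambient coordinate fields, as these generate the germs over the smooth functions.\<close>

lemma field_along_germ_induct [consumes 3, case_names add scale coord cong]:
  assumes U: "open U" "q \<in> U" and V: "field_along B A f U V"
    and add: "\<And>N V W. \<lbrakk>open N; q \<in> N; N \<subseteq> U; field_along B A f N V; field_along B A f N W; P V; P W\<rbrakk>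
      \<Longrightarrow> P (\<lambda>q. V q + W q)"
    and scale: "\<And>N h V. \<lbrakk>open N; q \<in> N; N \<subseteq> U; smooth_fun B N h; field_along B A f N V; P V\<rbrakk>
      \<Longrightarrow> P (\<lambda>q. h q *\<^sub>R V q)"
    and coord: "\<And>d u. d \<in> A \<Longrightarrow> f q \<in> fst d \<Longrightarrow> P (\<lambda>q. coord_field A d u (f q))"
    and cong: "\<And>N V W. \<lbrakk>open N; q \<in> N; N \<subseteq> U; \<And>q. q \<in> N \<Longrightarrow> V q = W q; P V\<rbrakk> \<Longrightarrow> P W"
  shows "P V"
proof -
  let ?d = "chart_at A (f q)"
  have d: "?d \<in> A" "f q \<in> fst ?d" by (rule tgt.chart_at)+
  define N where "N = U \<inter> f -` fst ?d"
  have N: "open N" "q \<in> N" "N \<subseteq> U" using open_dom[OF U(1) d(1)] U d by (auto simp: N_def)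
  let ?E = "\<lambda>i q. coord_field A ?d i (f q)" and ?h = "\<lambda>i q. comps A ?d (f q) (V q) \<bullet> i"
  have E: "field_along B A f N (?E i)" for i
    by (rule field_along_pullback[OF N(1) tgt.chart(1)[OF d(1)] tgt.coord_field_vector_field[OF d(1)]])
      (auto simp: N_def)
  have h: "smooth_fun B N (?h i)" for i
    using src.smooth_fun_inner_left[OF N(1) field_alongD[OF V d(1), folded N_def]] .
  have hE: "field_along B A f N (\<lambda>q. ?h i q *\<^sub>R ?E i q)" for i
    by (rule field_along_scaleR[OF N(1) h E])
  have "P (\<lambda>q. \<Sum>i\<in>I. ?h i q *\<^sub>R ?E i q)" if "finite I" for I
    using that
  proof induction
    case empty
    \<comment> \<open>There is no rule for the zero field; it arises as zero times a coordinate
      field.\<close>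
    show ?case
      by (rule cong[OF N _ scale[OF N src.smooth_fun_const[of _ 0] E coord[OF d]]]) simp
  next
    case (insert i I)
    have "P (\<lambda>q. ?h i q *\<^sub>R ?E i q + (\<Sum>i\<in>I. ?h i q *\<^sub>R ?E i q))"
      by (rule add[OF N hE field_along_sum[OF N(1) hE] scale[OF N h E coord[OF d]] insert.IH])
    then show ?case using insert.hyps by simp
  qed
  from this[OF finite_Basis] show ?thesis
    by (rule cong[OF N, rotated])
      (use tgt.coord_field_expand[OF d(1), symmetric] in \<open>auto simp: N_def\<close>)
qed

end

section \<open>Connections along a map\<close>

locale mfd_connection = smooth_mfd A
  for A :: "('p::{t2_space,second_countable_topology}, 'e::euclidean_space) atlas" +
  fixes nabla :: "('p \<Rightarrow> 'e) \<Rightarrow> ('p \<Rightarrow> 'e) \<Rightarrow> 'p \<Rightarrow> 'e"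
  assumes connection: "connection A nabla"
begin

lemma connectionD:
  assumes "open U" "vector_field A U X" "vector_field A U Y"
  shows "\<forall>X' Y'. (\<forall>p\<in>U. X' p = X p \<and> Y' p = Y p) \<longrightarrow> (\<forall>p\<in>U. nabla X' Y' p = nabla X Y p)"
    and "vector_field A U (nabla X Y)"
    and "\<forall>X'. vector_field A U X' \<longrightarrow>
      (\<forall>p\<in>U. nabla (\<lambda>p. X p + X' p) Y p = nabla X Y p + nabla X' Y p)"
    and "\<forall>Y'. vector_field A U Y' \<longrightarrow>
      (\<forall>p\<in>U. nabla X (\<lambda>p. Y p + Y' p) p = nabla X Y p + nabla X Y' p)"
    and "\<forall>h. smooth_fun A U h \<longrightarrow>
      (\<forall>p\<in>U. nabla (\<lambda>p. h p *\<^sub>R X p) Y p = h p *\<^sub>R nabla X Y p \<and>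
        nabla X (\<lambda>p. h p *\<^sub>R Y p) p = dird A h p (X p) *\<^sub>R Y p + h p *\<^sub>R nabla X Y p)"
  using connection[unfolded connection_def, THEN spec, THEN spec, THEN spec, THEN mp,
      OF conjI[OF assms(1) conjI[OF assms(2,3)]]]
  by - (elim conjE, assumption)+

lemma nabla_cong:
  assumes "open U" "vector_field A U X" "vector_field A U Y" "p \<in> U"
    "\<And>p. p \<in> U \<Longrightarrow> X' p = X p" "\<And>p. p \<in> U \<Longrightarrow> Y' p = Y p"
  shows "nabla X' Y' p = nabla X Y p"
  using connectionD(1)[OF assms(1-3), rule_format, of X' Y' p] assms(4-6) by simp

lemmas nabla_vector_field = connectionD(2)

lemma nabla_add_left:
  assumes "open U" "vector_field A U X" "vector_field A U X'" "vector_field A U Y" "p \<in> U"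
  shows "nabla (\<lambda>p. X p + X' p) Y p = nabla X Y p + nabla X' Y p"
  using connectionD(3)[OF assms(1,2,4), rule_format, OF assms(3,5)] .

lemma nabla_add_right:
  assumes "open U" "vector_field A U X" "vector_field A U Y" "vector_field A U Y'" "p \<in> U"
  shows "nabla X (\<lambda>p. Y p + Y' p) p = nabla X Y p + nabla X Y' p"
  using connectionD(4)[OF assms(1,2,3), rule_format, OF assms(4,5)] .

lemma
  assumes "open U" "vector_field A U X" "vector_field A U Y" "smooth_fun A U h" "p \<in> U"
  shows nabla_scale_left: "nabla (\<lambda>p. h p *\<^sub>R X p) Y p = h p *\<^sub>R nabla X Y p"
    and nabla_leibniz: "nabla X (\<lambda>p. h p *\<^sub>R Y p) p = dird A h p (X p) *\<^sub>R Y p + h p *\<^sub>R nabla X Y p"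
  using connectionD(5)[OF assms(1-3), THEN spec, THEN mp, OF assms(4), THEN bspec, OF assms(5)]
  by - (elim conjE, assumption)+

lemma nabla_lincomb_left:
  assumes "finite I" "open U" "vector_field A U Y" "p \<in> U"
    and "\<And>i. i \<in> I \<Longrightarrow> smooth_fun A U (h i)" "\<And>i. i \<in> I \<Longrightarrow> vector_field A U (X i)"
  shows "nabla (\<lambda>p. \<Sum>i\<in>I. h i p *\<^sub>R X i p) Y p = (\<Sum>i\<in>I. h i p *\<^sub>R nabla (X i) Y p)"
  using assms(1,5,6)
proof induction
  case empty
  show ?case
    using nabla_scale_left[OF assms(2) idm.field_along_zero assms(3) smooth_fun_const[of _ 0] assms(4)]
    by simp
next
  case (insert i I)
  have hX: "vector_field A U (\<lambda>p. h j p *\<^sub>R X j p)" if "j \<in> insert i I" for j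
    using idm.field_along_scaleR[OF assms(2)] insert.prems that by blast
  have "nabla (\<lambda>p. h i p *\<^sub>R X i p + (\<Sum>i\<in>I. h i p *\<^sub>R X i p)) Y p
      = nabla (\<lambda>p. h i p *\<^sub>R X i p) Y p + nabla (\<lambda>p. \<Sum>i\<in>I. h i p *\<^sub>R X i p) Y p"
    by (rule nabla_add_left[OF assms(2) hX idm.field_along_sum[OF assms(2) hX] assms(3,4)]) auto
  also have "nabla (\<lambda>p. h i p *\<^sub>R X i p) Y p = h i p *\<^sub>R nabla (X i) Y p"
    by (rule nabla_scale_left[OF assms(2) _ assms(3) _ assms(4)]) (use insert.prems in auto)
  finally show ?case using insert by simp
qed

lemma nabla_lincomb_right:
  assumes "finite I" "open U" "vector_field A U X" "p \<in> U"
    and "\<And>i. i \<in> I \<Longrightarrow> smooth_fun A U (h i)" "\<And>i. i \<in> I \<Longrightarrow> vector_field A U (Y i)"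
  shows "nabla X (\<lambda>p. \<Sum>i\<in>I. h i p *\<^sub>R Y i p) p =
    (\<Sum>i\<in>I. dird A (h i) p (X p) *\<^sub>R Y i p + h i p *\<^sub>R nabla X (Y i) p)"
  using assms(1,5,6)
proof induction
  case empty
  show ?case
    using nabla_leibniz[OF assms(2,3) idm.field_along_zero smooth_fun_const[of _ 0] assms(4)]
    by (simp add: dird_const)
next
  case (insert i I)
  have hY: "vector_field A U (\<lambda>p. h j p *\<^sub>R Y j p)" if "j \<in> insert i I" for j
    using idm.field_along_scaleR[OF assms(2)] insert.prems that by blast
  have "nabla X (\<lambda>p. h i p *\<^sub>R Y i p + (\<Sum>i\<in>I. h i p *\<^sub>R Y i p)) p
      = nabla X (\<lambda>p. h i p *\<^sub>R Y i p) p + nabla X (\<lambda>p. \<Sum>i\<in>I. h i p *\<^sub>R Y i p) p"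
    by (rule nabla_add_right[OF assms(2,3) hY idm.field_along_sum[OF assms(2) hY] assms(4)]) auto
  also have "nabla X (\<lambda>p. h i p *\<^sub>R Y i p) p = dird A (h i) p (X p) *\<^sub>R Y i p + h i p *\<^sub>R nabla X (Y i) p"
    by (rule nabla_leibniz[OF assms(2,3) _ _ assms(4)]) (use insert.prems in auto)
  finally show ?case using insert by simp
qed

text \<open>Linearity over smooth functions, applied to the expansion of \<open>Y\<close> in the
  coordinate frame. It follows that the value at \<open>p\<close> depends on \<open>Y\<close> only
  through \<open>Y p\<close>.\<close>

lemma nabla_left_tensorial:
  assumes "open U" "vector_field A U Y" "vector_field A U W" "p \<in> U" "c \<in> A" "p \<in> fst c"
  shows "nabla Y W p = (\<Sum>i\<in>Basis. (comps A c p (Y p) \<bullet> i) *\<^sub>R nabla (coord_field A c i) W p)"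
proof -
  let ?N = "U \<inter> fst c"
  have N: "open ?N" "p \<in> ?N" using open_Int_chart(1)[OF assms(5,1)] assms by auto
  have E: "vector_field A ?N (coord_field A c i)" for i
    by (rule idm.field_along_subset[OF coord_field_vector_field[OF assms(5)]]) auto
  have h: "smooth_fun A ?N (\<lambda>p. comps A c p (Y p) \<bullet> i)" for i
    by (rule smooth_fun_inner_left[OF N(1) vector_field_comps[OF assms(2,5)]])
  have W: "vector_field A ?N W" by (rule idm.field_along_subset[OF assms(3)]) auto
  have Y: "vector_field A ?N Y" by (rule idm.field_along_subset[OF assms(2)]) auto
  have "nabla (\<lambda>p. \<Sum>i\<in>Basis. (comps A c p (Y p) \<bullet> i) *\<^sub>R coord_field A c i p) W p = nabla Y W p"
    by (rule nabla_cong[OF N(1) Y W N(2)]) (use coord_field_expand[OF assms(5), symmetric] in auto)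
  then show ?thesis by (simp add: nabla_lincomb_left[OF finite_Basis N(1) W N(2) h E])
qed

lemma christoffel_expand:
  "christoffel A nabla p u w = (\<Sum>i\<in>Basis. \<Sum>j\<in>Basis. (w \<bullet> i) *\<^sub>R (u \<bullet> j) *\<^sub>R
    nabla (coord_field A (chart_at A p) j) (coord_field A (chart_at A p) i) p)"
proof -
  let ?c = "chart_at A p"
  let ?U = "fst ?c"
  have c: "?c \<in> A" "p \<in> ?U" by (rule chart_at)+
  have U: "open ?U" by (rule chart(1)[OF c(1)])
  have E: "vector_field A ?U (coord_field A ?c u)" for u
    by (rule coord_field_vector_field[OF c(1)])
  have hE: "vector_field A ?U (\<lambda>p. \<Sum>i\<in>Basis. (w \<bullet> i) *\<^sub>R coord_field A ?c i p)"
    by (intro idm.field_along_sum[OF U] idm.field_along_scaleR[OF U smooth_fun_const E])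
  have "nabla (coord_field A ?c u) (\<lambda>p. \<Sum>i\<in>Basis. (w \<bullet> i) *\<^sub>R coord_field A ?c i p) p
      = nabla (coord_field A ?c u) (coord_field A ?c w) p"
    by (rule nabla_cong[OF U E E c(2)])
      (use linear_euclidean_expand[OF coord_field_linear[OF c(1)], symmetric] in auto)
  then have "christoffel A nabla p u w
      = (\<Sum>i\<in>Basis. (w \<bullet> i) *\<^sub>R nabla (coord_field A ?c u) (coord_field A ?c i) p)"
    by (simp add: christoffel_def dird_const
        nabla_lincomb_right[OF finite_Basis U E c(2) smooth_fun_const E])
  moreover have "nabla (coord_field A ?c u) (coord_field A ?c i) p
      = (\<Sum>j\<in>Basis. (u \<bullet> j) *\<^sub>R nabla (coord_field A ?c j) (coord_field A ?c i) p)" for i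
    using nabla_left_tensorial[OF U E[of u] E[of i] c(2) c] unfolding comps_coord_field[OF c] .
  ultimately show ?thesis by (simp only: scaleR_sum_right)
qed

lemma christoffel_bilinear: "bilinear (christoffel A nabla p)"
  unfolding bilinear_def
  by (auto intro!: linearI simp: christoffel_expand inner_left_distrib scaleR_left_distrib
      scaleR_right_distrib sum.distrib scaleR_sum_right mult_ac distrib_left distrib_right)

text \<open>The link between the axiomatic connection and the coordinate formula by which
  \<open>cov_along\<close> is defined: expand \<open>W\<close> in the coordinate frame and apply the
  Leibniz rule.\<close>

lemma nabla_coordinates:
  assumes "open U" "vector_field A U Y" "vector_field A U W" "p \<in> U"
  shows "nabla Y W p = dird A (\<lambda>p'. comps A (chart_at A p) p' (W p')) p (Y p)
    + christoffel A nabla p (Y p) (W p)"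
proof -
  let ?c = "chart_at A p"
  let ?N = "U \<inter> fst ?c"
  have c: "?c \<in> A" "p \<in> fst ?c" by (rule chart_at)+
  have N: "open ?N" "p \<in> ?N" using open_Int_chart(1)[OF c(1) assms(1)] assms c by auto
  have E: "vector_field A ?N (coord_field A ?c i)" for i
    by (rule idm.field_along_subset[OF coord_field_vector_field[OF c(1)]]) auto
  have W: "vector_field A ?N W" by (rule idm.field_along_subset[OF assms(3)]) auto
  have Y: "vector_field A ?N Y" by (rule idm.field_along_subset[OF assms(2)]) auto
  let ?w = "\<lambda>p. comps A ?c p (W p)"
  have w: "smooth_fun A ?N ?w" by (rule vector_field_comps[OF assms(3) c(1)])
  have h: "smooth_fun A ?N (\<lambda>p. ?w p \<bullet> i)" for i
    by (rule smooth_fun_inner_left[OF N(1) w])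
  have D: "dird A (\<lambda>p. ?w p \<bullet> i) p v = dird A ?w p v \<bullet> i" for i v
    by (rule dird_bounded_linear[OF w N bounded_linear_inner_left])
  have 1: "(\<Sum>i\<in>Basis. (v \<bullet> i) *\<^sub>R coord_field A ?c i p) = v" for v
    using coord_field_expand[OF c, of v] by simp
  have "nabla Y (\<lambda>p. \<Sum>i\<in>Basis. (?w p \<bullet> i) *\<^sub>R coord_field A ?c i p) p = nabla Y W p"
    by (rule nabla_cong[OF N(1) Y W N(2)]) (use coord_field_expand[OF c(1), symmetric] in auto)
  then have "nabla Y W p = (\<Sum>i\<in>Basis. (dird A ?w p (Y p) \<bullet> i) *\<^sub>R coord_field A ?c i p
      + (W p \<bullet> i) *\<^sub>R nabla Y (coord_field A ?c i) p)"
    by (simp add: nabla_lincomb_right[OF finite_Basis N(1) Y N(2) h E] D)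
  then show ?thesis
    by (simp add: sum.distrib 1 nabla_left_tensorial[OF N(1) Y E N(2) c] christoffel_expand scaleR_sum_right)
qed

end

section \<open>The covariant derivative along a map\<close>

locale map_connection = smooth_mfd_map B A f + mfd_connection A nabla
  for B :: "('q::{t2_space,second_countable_topology}, 'f::euclidean_space) atlas"
    and A :: "('p::{t2_space,second_countable_topology}, 'e::euclidean_space) atlas"
    and f :: "'q \<Rightarrow> 'p"
    and nabla :: "('p \<Rightarrow> 'e) \<Rightarrow> ('p \<Rightarrow> 'e) \<Rightarrow> 'p \<Rightarrow> 'e"
begin

abbreviation cov :: "('q \<Rightarrow> 'f) \<Rightarrow> ('q \<Rightarrow> 'e) \<Rightarrow> 'q \<Rightarrow> 'e" where
  "cov \<equiv> cov_along B A f nabla"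

lemma germ_chart:
  assumes "open U" "q \<in> U"
  shows "open (U \<inter> f -` fst (chart_at A (f q)))" "q \<in> U \<inter> f -` fst (chart_at A (f q))"
  using open_dom[OF assms(1) tgt.chart_at(1)] assms(2) tgt.chart_at(2) by auto

lemma cov_cong:
  assumes "open U" "q \<in> U" "\<And>q. q \<in> U \<Longrightarrow> V q = W q" "X q = X' q"
  shows "cov X V q = cov X' W q"
proof -
  have "dird B (\<lambda>q'. comps A (chart_at A (f q)) (f q') (V q')) q v
      = dird B (\<lambda>q'. comps A (chart_at A (f q)) (f q') (W q')) q v" for v
    by (rule src.dird_cong[OF assms(1,2)]) (simp add: assms(3))
  then show ?thesis using assms by (simp add: cov_along_def)
qed

lemma cov_add:
  assumes U: "open U" "q \<in> U" and V: "field_along B A f U V" and W: "field_along B A f U W"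
  shows "cov X (\<lambda>q. V q + W q) q = cov X V q + cov X W q"
proof -
  let ?d = "chart_at A (f q)"
  let ?N = "U \<inter> f -` fst ?d"
  have d: "?d \<in> A" by (rule tgt.chart_at)
  note N = germ_chart[OF U]
  have "dird B (\<lambda>q'. comps A ?d (f q') (V q' + W q')) q v
      = dird B (\<lambda>q'. comps A ?d (f q') (V q') + comps A ?d (f q') (W q')) q v" for v
    by (rule src.dird_cong[OF N]) (use d in \<open>auto simp: linear_add[OF tgt.comps_linear]\<close>)
  also have "\<dots> v = dird B (\<lambda>q'. comps A ?d (f q') (V q')) q v + dird B (\<lambda>q'. comps A ?d (f q') (W q')) q v" for v
    by (rule src.dird_add[OF field_alongD[OF V d] field_alongD[OF W d] N])
  finally show ?thesis
    by (simp add: cov_along_def bilinear_radd[OF christoffel_bilinear])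
qed

lemma cov_scaleR:
  assumes U: "open U" "q \<in> U" and V: "field_along B A f U V" and h: "smooth_fun B U h"
  shows "cov X (\<lambda>q. h q *\<^sub>R V q) q = dird B h q (X q) *\<^sub>R V q + h q *\<^sub>R cov X V q"
proof -
  let ?d = "chart_at A (f q)"
  let ?N = "U \<inter> f -` fst ?d"
  have d: "?d \<in> A" by (rule tgt.chart_at)
  note N = germ_chart[OF U]
  have h': "smooth_fun B ?N h" by (rule src.smooth_fun_subset[OF h]) auto
  have "dird B (\<lambda>q'. comps A ?d (f q') (h q' *\<^sub>R V q')) q (X q)
      = dird B (\<lambda>q'. h q' *\<^sub>R comps A ?d (f q') (V q')) q (X q)"
    by (rule src.dird_cong[OF N]) (use d in \<open>auto simp: linear_cmul[OF tgt.comps_linear]\<close>)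
  also have "\<dots> = dird B h q (X q) *\<^sub>R comps A ?d (f q) (V q)
      + h q *\<^sub>R dird B (\<lambda>q'. comps A ?d (f q') (V q')) q (X q)"
    by (rule src.dird_scaleR[OF h' field_alongD[OF V d] N])
  finally show ?thesis
    by (simp add: cov_along_def bilinear_rmul[OF christoffel_bilinear] scaleR_right_distrib)
qed

lemma cov_left_linear:
  assumes U: "open U" "q \<in> U" and V: "field_along B A f U V"
  shows "linear (\<lambda>v. cov (\<lambda>_. v) V q)"
proof -
  let ?d = "chart_at A (f q)"
  have "linear (dird B (\<lambda>q'. comps A ?d (f q') (V q')) q)"
    by (rule src.dird_linear[OF field_alongD[OF V tgt.chart_at(1)] germ_chart[OF U]])
  then show ?thesis
    by (auto intro!: linearI simp: cov_along_def linear_add linear_cmul linear_add[OF dmap_linear]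
        linear_cmul[OF dmap_linear] bilinear_ladd[OF christoffel_bilinear]
        bilinear_lmul[OF christoffel_bilinear] scaleR_right_distrib)
qed

lemma cov_pointwise: "cov X V q = cov (\<lambda>_. X q) V q"
  by (simp add: cov_along_def)

text \<open>The base case of the germ arguments: the chain rule turns the derivative term into the
  ambient one and the Christoffel terms agree. \<open>Y\<close> may be any ambient field extending
  the single vector \<open>df X\<close> at \<open>f q\<close>.\<close>

lemma cov_pullback:
  assumes "open O'" "f q \<in> O'" "vector_field A O' W" "vector_field A O' Y"
    and "Y (f q) = dmap B A f q (X q)"
  shows "cov X (\<lambda>q. W (f q)) q = nabla Y W (f q)"
proof -
  let ?d = "chart_at A (f q)"
  have d: "?d \<in> A" "f q \<in> fst ?d" by (rule tgt.chart_at)+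
  have "dird B (\<lambda>q. comps A ?d (f q) (W (f q))) q v
      = dird A (\<lambda>p. comps A ?d p (W p)) (f q) (dmap B A f q v)" for v
    by (rule dird_pullback[OF tgt.open_Int_chart(1)[OF d(1) assms(1)] tgt.vector_field_comps[OF assms(3) d(1)]])
      (use assms d in auto)
  then show ?thesis
    by (simp add: cov_along_def nabla_coordinates[OF assms(1,4,3,2)] assms(5))
qed

text \<open>The extension \<open>Y\<close> in \<open>cov_pullback\<close> depends on
  \<open>q\<close>. Here the dependence on \<open>q\<close> sits in scalar coefficients and in
  restrictions of fixed ambient fields, so that the result can be differentiated again.\<close>

lemma cov_pullback_coords:
  assumes "open O'" "f q \<in> O'" "vector_field A O' W" "d \<in> A" "f q \<in> fst d"
  shows "cov X (\<lambda>q. W (f q)) q =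
    (\<Sum>i\<in>Basis. (dird B (snd d \<circ> f) q (X q) \<bullet> i) *\<^sub>R nabla (coord_field A d i) W (f q))"
proof -
  \<comment> \<open>The second field extends the vector \<open>df X\<close> at \<open>f q\<close>
    with constant components in \<open>d\<close>.\<close>
  let ?N = "O' \<inter> fst d" and ?Y = "coord_field A d (dird B (snd d \<circ> f) q (X q))"
  have N: "open ?N" "f q \<in> ?N" using tgt.open_Int_chart(1)[OF assms(4,1)] assms by auto
  have Y: "vector_field A ?N ?Y"
    by (rule tgt.idm.field_along_subset[OF tgt.coord_field_vector_field[OF assms(4)]]) auto
  have W: "vector_field A ?N W" by (rule tgt.idm.field_along_subset[OF assms(3)]) auto
  have Yq: "?Y (f q) = dmap B A f q (X q)"
    using tgt.coord_field_comps[OF assms(4,5)] by (simp add: comps_dmap[OF assms(4,5), symmetric])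
  have "cov X (\<lambda>q. W (f q)) q = nabla ?Y W (f q)"
    by (rule cov_pullback[OF N W Y]) (rule Yq)
  then show ?thesis
    by (simp add: nabla_left_tensorial[OF N(1) Y W N(2) assms(4,5)] tgt.comps_coord_field[OF assms(4,5)])
qed

lemma smooth_fun_dird_coords:
  assumes "open U" "vector_field B U X" "d \<in> A" "U \<subseteq> f -` fst d"
  shows "smooth_fun B U (\<lambda>q. dird B (snd d \<circ> f) q (X q) \<bullet> i)"
  by (intro src.smooth_fun_inner_left[OF assms(1)] src.dird_smooth[OF assms(1) _ assms(2)]
      src.smooth_fun_subset[OF smooth_fun_coords[OF assms(3)] assms(4)])

text \<open>Smoothness is not visible from the definition, whose chart changes with the point;
  induction on germs reduces it to coordinate fields, where \<open>cov_pullback_coords\<close> shows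
  it.\<close>

lemma cov_field_along:
  assumes "open U" "vector_field B U X" "field_along B A f U V"
  shows "field_along B A f U (cov X V)"
proof (rule field_along_local)
  fix q assume "q \<in> U"
  from assms(1) this assms(3) show "\<exists>N. open N \<and> q \<in> N \<and> field_along B A f N (cov X V)"
  proof (induction rule: field_along_germ_induct)
    case (add N V W)
    then obtain N1 N2 where N: "open N1" "q \<in> N1" "field_along B A f N1 (cov X V)"
      "open N2" "q \<in> N2" "field_along B A f N2 (cov X W)" by blast
    let ?M = "N \<inter> N1 \<inter> N2"
    have M: "open ?M" using add N by auto
    have "field_along B A f ?M (\<lambda>q. cov X V q + cov X W q)"
      by (rule field_along_add[OF M field_along_subset[OF N(3)] field_along_subset[OF N(6)]]) auto
    then have "field_along B A f ?M (cov X (\<lambda>q. V q + W q))"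
      by (rule field_along_cong[OF M, rotated])
        (use cov_add[OF add.hyps(1) _ add.hyps(4,5)] in auto)
    then show ?case using M N add.hyps by blast
  next
    case (scale N h V)
    then obtain N1 where N: "open N1" "q \<in> N1" "field_along B A f N1 (cov X V)" by blast
    let ?M = "N \<inter> N1"
    have M: "open ?M" using scale N by auto
    have h: "smooth_fun B ?M h" by (rule src.smooth_fun_subset[OF scale.hyps(4)]) auto
    have X: "vector_field B ?M X" by (rule src.idm.field_along_subset[OF assms(2)]) (use scale in auto)
    have V: "field_along B A f ?M V" by (rule field_along_subset[OF scale.hyps(5)]) auto
    have "field_along B A f ?M (\<lambda>q. dird B h q (X q) *\<^sub>R V q + h q *\<^sub>R cov X V q)"
      by (intro field_along_add[OF M] field_along_scaleR[OF M] src.dird_smooth[OF M] h X V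
          field_along_subset[OF N(3)]) auto
    then have "field_along B A f ?M (cov X (\<lambda>q. h q *\<^sub>R V q))"
      by (rule field_along_cong[OF M, rotated])
        (use cov_scaleR[OF scale.hyps(1) _ scale.hyps(5,4)] in auto)
    then show ?case using M N scale.hyps by blast
  next
    case (coord d u)
    let ?M = "U \<inter> f -` fst d"
    have M: "open ?M" "q \<in> ?M" using open_dom[OF assms(1) coord(1)] coord \<open>q \<in> U\<close> by auto
    have X: "vector_field B ?M X" by (rule src.idm.field_along_subset[OF assms(2)]) auto
    have E: "vector_field A (fst d) (coord_field A d u)" for u
      by (rule tgt.coord_field_vector_field[OF coord(1)])
    have "field_along B A f ?M (\<lambda>q. \<Sum>i\<in>Basis. (dird B (snd d \<circ> f) q (X q) \<bullet> i) *\<^sub>R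
        nabla (coord_field A d i) (coord_field A d u) (f q))"
      by (intro field_along_sum[OF M(1)] field_along_scaleR[OF M(1)]
          smooth_fun_dird_coords[OF M(1) X coord(1)] tgt.chart(1)[OF coord(1)]
          field_along_pullback[OF M(1) tgt.chart(1)[OF coord(1)]] nabla_vector_field E) auto
    then have "field_along B A f ?M (cov X (\<lambda>q. coord_field A d u (f q)))"
      by (rule field_along_cong[OF M(1), rotated])
        (use cov_pullback_coords[OF tgt.chart(1)[OF coord(1)] _ E coord(1), symmetric] in auto)
    then show ?case using M by blast
  next
    case (cong N V W)
    then obtain N1 where N: "open N1" "q \<in> N1" "field_along B A f N1 (cov X V)" by blast
    let ?M = "N \<inter> N1"
    have M: "open ?M" using cong N by auto
    have "field_along B A f ?M (cov X V)" by (rule field_along_subset[OF N(3)]) auto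
    then have "field_along B A f ?M (cov X W)"
      by (rule field_along_cong[OF M, rotated])
        (use cov_cong[OF cong.hyps(1) _ cong.hyps(4)] in auto)
    then show ?case using M N cong.hyps by blast
  qed
qed

end

section \<open>Kaehler manifolds of constant holomorphic curvature\<close>

context map_connection
begin

lemma cov_lincomb:
  assumes "finite I" "open U" "q \<in> U"
    and "\<And>i. i \<in> I \<Longrightarrow> smooth_fun B U (h i)" "\<And>i. i \<in> I \<Longrightarrow> field_along B A f U (V i)"
  shows "cov X (\<lambda>q. \<Sum>i\<in>I. h i q *\<^sub>R V i q) q =
    (\<Sum>i\<in>I. dird B (h i) q (X q) *\<^sub>R V i q + h i q *\<^sub>R cov X (V i) q)"
  using assms(1,4,5)
proof induction
  case empty
  show ?case
    using cov_scaleR[OF assms(2,3) field_along_zero src.smooth_fun_const[of _ 0], of X]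
    by (simp add: src.dird_const)
next
  case (insert i I)
  have hV: "field_along B A f U (\<lambda>q. h j q *\<^sub>R V j q)" if "j \<in> insert i I" for j
    using field_along_scaleR[OF assms(2)] insert.prems that by blast
  have "cov X (\<lambda>q. h i q *\<^sub>R V i q + (\<Sum>i\<in>I. h i q *\<^sub>R V i q)) q
      = cov X (\<lambda>q. h i q *\<^sub>R V i q) q + cov X (\<lambda>q. \<Sum>i\<in>I. h i q *\<^sub>R V i q) q"
    by (rule cov_add[OF assms(2,3) hV field_along_sum[OF assms(2) hV]]) auto
  also have "cov X (\<lambda>q. h i q *\<^sub>R V i q) q = dird B (h i) q (X q) *\<^sub>R V i q + h i q *\<^sub>R cov X (V i) q"
    by (rule cov_scaleR[OF assms(2,3)]) (use insert.prems in auto)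
  finally show ?case using insert by simp
qed

lemma cov_diff:
  assumes U: "open U" "q \<in> U" and V: "field_along B A f U V" and W: "field_along B A f U W"
  shows "cov X (\<lambda>q. V q - W q) q = cov X V q - cov X W q"
proof -
  have "cov X (\<lambda>q. (V q - W q) + W q) q = cov X (\<lambda>q. V q - W q) q + cov X W q"
    by (rule cov_add[OF U field_along_diff[OF U(1) V W] W])
  then show ?thesis by simp
qed

lemma christoffel_symmetric:
  assumes "torsion_free A nabla"
  shows "christoffel A nabla p u w = christoffel A nabla p w u"
proof -
  let ?c = "chart_at A p"
  have c: "?c \<in> A" "p \<in> fst ?c" by (rule tgt.chart_at)+
  have "\<forall>p\<in>fst ?c. nabla (coord_field A ?c u) (coord_field A ?c w) p
      - nabla (coord_field A ?c w) (coord_field A ?c u) p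
      = lie_bracket A (coord_field A ?c u) (coord_field A ?c w) p"
    using assms[unfolded torsion_free_def, THEN spec, THEN spec, THEN spec, THEN mp,
        OF conjI[OF tgt.chart(1)[OF c(1)] conjI[OF tgt.coord_field_vector_field[OF c(1)]
            tgt.coord_field_vector_field[OF c(1)]]]] .
  then show ?thesis
    using c by (simp add: christoffel_def tgt.lie_bracket_coord_field)
qed

text \<open>In a chart at \<open>f q\<close> the components of \<open>df Y\<close> are the
  derivatives of \<open>f\<close> along \<open>Y\<close>. The derivative terms thus give the
  bracket, and the Christoffel terms cancel by symmetry.\<close>

lemma cov_torsion_free:
  assumes tf: "torsion_free A nabla"
    and U: "open U" "q \<in> U" and X: "vector_field B U X" and Y: "vector_field B U Y"
  shows "cov X (\<lambda>q. dmap B A f q (Y q)) q - cov Y (\<lambda>q. dmap B A f q (X q)) q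
    = dmap B A f q (lie_bracket B X Y q)"
proof -
  let ?d = "chart_at A (f q)"
  have d: "?d \<in> A" by (rule tgt.chart_at)
  let ?N = "U \<inter> f -` fst ?d" and ?F = "snd ?d \<circ> f"
  note N = germ_chart[OF U]
  have F: "smooth_fun B ?N ?F" by (rule src.smooth_fun_subset[OF smooth_fun_coords[OF d]]) auto
  have D: "dird B (\<lambda>q'. comps A ?d (f q') (dmap B A f q' (Y q'))) q v
      = dird B (\<lambda>q. dird B ?F q (Y q)) q v" for Y v
    by (rule src.dird_cong[OF N]) (use d in \<open>auto simp: comps_dmap\<close>)
  have "dmap B A f q (lie_bracket B X Y q) = dird B ?F q (lie_bracket B X Y q)"
    by (simp add: dmap_def)
  also have "\<dots> = dird B (\<lambda>q. dird B ?F q (Y q)) q (X q) - dird B (\<lambda>q. dird B ?F q (X q)) q (Y q)"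
    by (rule src.dird_lie_bracket[OF N F]) (use X Y in \<open>auto elim: src.idm.field_along_subset\<close>)
  finally show ?thesis
    by (simp add: cov_along_def D christoffel_symmetric[OF tf, of _ "dmap B A f q (X q)"])
qed

end

section \<open>Transfer of \<open>J\<close>, the metric and the curvature to fields along a
  map\<close>

locale kaehler_map = map_connection B A f nabla
  for B :: "('q::{t2_space,second_countable_topology}, 'f::euclidean_space) atlas"
    and A :: "('p::{t2_space,second_countable_topology}, 'e::euclidean_space) atlas"
    and f :: "'q \<Rightarrow> 'p"
    and nabla :: "('p \<Rightarrow> 'e) \<Rightarrow> ('p \<Rightarrow> 'e) \<Rightarrow> 'p \<Rightarrow> 'e" +
  fixes J :: "'p \<Rightarrow> 'e \<Rightarrow> 'e" and g :: "'p \<Rightarrow> 'e \<Rightarrow> 'e \<Rightarrow> real" and c :: real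
  assumes kaehler: "kaehler_manifold A J g nabla"
    and space_form: "const_holo_sect_curvature A J g nabla c"
begin

lemma kaehlerD:
  shows "almost_complex A J" "riemannian_metric A g" "levi_civita A g nabla"
    and g_J: "g p (J p u) (J p v) = g p u v"
    and parallel_J: "\<forall>U X Y. open U \<and> vector_field A U X \<and> vector_field A U Y \<longrightarrow>
        (\<forall>p\<in>U. nabla X (\<lambda>p. J p (Y p)) p = J p (nabla X Y p))"
  using kaehler unfolding kaehler_manifold_def by - (elim conjE, (assumption | simp only:))+

lemma g_bilinear: "bilinear (g p)"
  and g_commute: "g p u v = g p v u"
  and g_pos: "v \<noteq> 0 \<Longrightarrow> g p v v > 0"
  using kaehlerD(2) unfolding riemannian_metric_def by blast+

lemma g_smooth:
  "open U \<Longrightarrow> vector_field A U X \<Longrightarrow> vector_field A U Y \<Longrightarrow> smooth_fun A U (\<lambda>p. g p (X p) (Y p))"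
  using kaehlerD(2)[unfolded riemannian_metric_def, THEN conjunct2, THEN spec, THEN spec, THEN spec, THEN mp]
  by simp

lemmas g_simps [simp] = bilinear_ladd[OF g_bilinear] bilinear_radd[OF g_bilinear]
  bilinear_lmul[OF g_bilinear] bilinear_rmul[OF g_bilinear] bilinear_lneg[OF g_bilinear]
  bilinear_rneg[OF g_bilinear] bilinear_lsub[OF g_bilinear] bilinear_rsub[OF g_bilinear]
  bilinear_lzero[OF g_bilinear] bilinear_rzero[OF g_bilinear]

lemma g_eq_0 [simp]: "g p v v = 0 \<longleftrightarrow> v = 0"
  using g_pos[of v p] by (cases "v = 0") auto

lemma J_linear: "linear (J p)"
  and J_J [simp]: "J p (J p v) = - v"
  using kaehlerD(1) unfolding almost_complex_def by blast+

lemma J_vector_field: "open U \<Longrightarrow> vector_field A U X \<Longrightarrow> vector_field A U (\<lambda>p. J p (X p))"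
  using kaehlerD(1)[unfolded almost_complex_def, THEN conjunct2, THEN spec, THEN spec, THEN mp] by simp

lemmas J_simps [simp] = linear_add[OF J_linear] linear_cmul[OF J_linear] linear_neg[OF J_linear]
  linear_diff[OF J_linear] linear_0[OF J_linear]

lemma g_J_left: "g p (J p u) v = - g p u (J p v)"
  using g_J[of p u "J p v"] by simp

lemma g_J_self [simp]: "g p (J p u) u = 0"
  using g_J_left[of p u u] g_commute[of p u "J p u"] by simp

lemma nabla_J:
  "open U \<Longrightarrow> vector_field A U X \<Longrightarrow> vector_field A U Y \<Longrightarrow> p \<in> U
    \<Longrightarrow> nabla X (\<lambda>p. J p (Y p)) p = J p (nabla X Y p)"
  using parallel_J[THEN spec, THEN spec, THEN spec, THEN mp] by blast

lemma torsion_free: "torsion_free A nabla"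
  and metric_connection: "metric_connection A g nabla"
  using kaehlerD(3) by (simp_all add: levi_civita_def)

lemma nabla_metric:
  assumes "open U" "vector_field A U X" "vector_field A U Y" "vector_field A U Z" "p \<in> U"
  shows "dird A (\<lambda>p. g p (Y p) (Z p)) p (X p) = g p (nabla X Y p) (Z p) + g p (Y p) (nabla X Z p)"
  using metric_connection[unfolded metric_connection_def, THEN spec, THEN spec, THEN spec, THEN spec, THEN mp,
      OF conjI[OF assms(1) conjI[OF assms(2) conjI[OF assms(3,4)]]], THEN bspec, OF assms(5)] .

text \<open>The curvature tensor of the complex space form as a pointwise trilinear map, so that it
  can be evaluated on vectors along \<open>f\<close>.\<close>

definition Rt :: "'p \<Rightarrow> 'e \<Rightarrow> 'e \<Rightarrow> 'e \<Rightarrow> 'e" where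
  "Rt p x y z = (c / 4) *\<^sub>R (g p y z *\<^sub>R x - g p x z *\<^sub>R y + g p (J p y) z *\<^sub>R J p x
    - g p (J p x) z *\<^sub>R J p y + (2 * g p x (J p y)) *\<^sub>R J p z)"

lemma Rt_linear:
  "linear (\<lambda>x. Rt p x y z)" "linear (\<lambda>y. Rt p x y z)" "linear (\<lambda>z. Rt p x y z)"
  by (auto intro!: linearI simp: Rt_def algebra_simps add_divide_distrib)

lemma curvature_Rt:
  assumes "open U" "vector_field A U X" "vector_field A U Y" "vector_field A U Z" "p \<in> U"
  shows "curvature A nabla X Y Z p = Rt p (X p) (Y p) (Z p)"
  unfolding Rt_def
  using space_form[unfolded const_holo_sect_curvature_def, THEN spec, THEN spec, THEN spec, THEN spec, THEN mp,
      OF conjI[OF assms(1) conjI[OF assms(2) conjI[OF assms(3,4)]]], THEN bspec, OF assms(5)] .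

text \<open>Smoothness of \<open>J\<close> is given only through its action on ambient fields, hence
  the passage through germs.\<close>

lemma J_field_along:
  assumes "open U" "field_along B A f U V"
  shows "field_along B A f U (\<lambda>q. J (f q) (V q))"
proof (rule field_along_local)
  fix q assume "q \<in> U"
  from assms(1) this assms(2) show "\<exists>N. open N \<and> q \<in> N \<and> field_along B A f N (\<lambda>q. J (f q) (V q))"
  proof (induction rule: field_along_germ_induct)
    case (add N V W)
    then obtain N1 N2 where N: "open N1" "q \<in> N1" "field_along B A f N1 (\<lambda>q. J (f q) (V q))"
      "open N2" "q \<in> N2" "field_along B A f N2 (\<lambda>q. J (f q) (W q))" by blast
    have M: "open (N1 \<inter> N2)" using N by auto
    have "field_along B A f (N1 \<inter> N2) (\<lambda>q. J (f q) (V q) + J (f q) (W q))"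
      by (rule field_along_add[OF M field_along_subset[OF N(3)] field_along_subset[OF N(6)]]) auto
    then show ?case using M N by (intro exI[of _ "N1 \<inter> N2"]) simp
  next
    case (scale N h V)
    then obtain N1 where N: "open N1" "q \<in> N1" "field_along B A f N1 (\<lambda>q. J (f q) (V q))" by blast
    have M: "open (N \<inter> N1)" using scale N by auto
    have "field_along B A f (N \<inter> N1) (\<lambda>q. h q *\<^sub>R J (f q) (V q))"
      by (rule field_along_scaleR[OF M src.smooth_fun_subset[OF scale.hyps(4)] field_along_subset[OF N(3)]]) auto
    then show ?case using M N scale.hyps by (intro exI[of _ "N \<inter> N1"]) simp
  next
    case (coord d u)
    have O': "open (fst d)" by (rule tgt.chart(1)[OF coord(1)])
    have "field_along B A f (f -` fst d) (\<lambda>q. J (f q) (coord_field A d u (f q)))"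
      using field_along_pullback[OF open_vimage_map[OF O'] O'
          J_vector_field[OF O' tgt.coord_field_vector_field[OF coord(1)]]] by auto
    then show ?case using open_vimage_map[OF O'] coord(2) by auto
  next
    case (cong N V W)
    then obtain N1 where N: "open N1" "q \<in> N1" "field_along B A f N1 (\<lambda>q. J (f q) (V q))" by blast
    have M: "open (N \<inter> N1)" using cong N by auto
    have "field_along B A f (N \<inter> N1) (\<lambda>q. J (f q) (W q))"
      by (rule field_along_cong[OF M _ field_along_subset[OF N(3)]]) (use cong.hyps(4) in auto)
    then show ?case using M N cong.hyps by blast
  qed
qed

lemma cov_J:
  assumes "open U" "q \<in> U" "field_along B A f U V"
  shows "cov X (\<lambda>q. J (f q) (V q)) q = J (f q) (cov X V q)"
  using assms
proof (induction rule: field_along_germ_induct)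
  case (add N V W)
  have "cov X (\<lambda>q. J (f q) (V q) + J (f q) (W q)) q
      = cov X (\<lambda>q. J (f q) (V q)) q + cov X (\<lambda>q. J (f q) (W q)) q"
    by (rule cov_add[OF add.hyps(1,2)]) (intro J_field_along add.hyps)+
  then show ?case using add.IH cov_add[OF add.hyps(1,2,4,5)] by simp
next
  case (scale N h V)
  have "cov X (\<lambda>q. h q *\<^sub>R J (f q) (V q)) q
      = dird B h q (X q) *\<^sub>R J (f q) (V q) + h q *\<^sub>R cov X (\<lambda>q. J (f q) (V q)) q"
    by (rule cov_scaleR[OF scale.hyps(1,2)]) (intro J_field_along scale.hyps)+
  then show ?case using scale.IH cov_scaleR[OF scale.hyps(1,2,5,4)] by simp
next
  case (coord d u)
  have O': "open (fst d)" by (rule tgt.chart(1)[OF coord(1)])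
  have E: "vector_field A (fst d) (coord_field A d u)" for u
    by (rule tgt.coord_field_vector_field[OF coord(1)])
  let ?Y = "coord_field A d (comps A d (f q) (dmap B A f q (X q)))"
  have Y: "?Y (f q) = dmap B A f q (X q)" by (rule tgt.coord_field_comps[OF coord])
  have "cov X (\<lambda>q. J (f q) (coord_field A d u (f q))) q = nabla ?Y (\<lambda>p. J p (coord_field A d u p)) (f q)"
    by (rule cov_pullback[OF O' coord(2) J_vector_field[OF O' E] E]) (rule Y)
  also have "\<dots> = J (f q) (nabla ?Y (coord_field A d u) (f q))"
    by (rule nabla_J[OF O' E E coord(2)])
  also have "nabla ?Y (coord_field A d u) (f q) = cov X (\<lambda>q. coord_field A d u (f q)) q"
    by (rule cov_pullback[OF O' coord(2) E E, symmetric]) (rule Y)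
  finally show ?case .
next
  case (cong N V W)
  have "cov X (\<lambda>q. J (f q) (W q)) q = cov X (\<lambda>q. J (f q) (V q)) q"
    by (rule cov_cong[OF cong.hyps(1,2)]) (simp_all add: cong.hyps(4))
  also have "\<dots> = J (f q) (cov X V q)" by (rule cong.IH)
  also have "cov X V q = cov X W q"
    by (rule cov_cong[OF cong.hyps(1,2)]) (simp_all add: cong.hyps(4))
  finally show ?case .
qed

text \<open>The Leibniz rule is bundled with local smoothness of the scalar function, because the
  sum and product rules for \<open>dird\<close> require that smoothness at each step of the germ
  induction.\<close>

definition metric_leibniz_at :: "('q \<Rightarrow> 'f) \<Rightarrow> 'q \<Rightarrow> ('q \<Rightarrow> 'e) \<Rightarrow> ('q \<Rightarrow> 'e) \<Rightarrow> bool" where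
  "metric_leibniz_at X q V W \<longleftrightarrow>
    (\<exists>M. open M \<and> q \<in> M \<and> smooth_fun B M (\<lambda>q. g (f q) (V q) (W q))) \<and>
    dird B (\<lambda>q. g (f q) (V q) (W q)) q (X q) = g (f q) (cov X V q) (W q) + g (f q) (V q) (cov X W q)"

lemma metric_leibniz_at_commute: "metric_leibniz_at X q V W \<Longrightarrow> metric_leibniz_at X q W V"
  by (simp add: metric_leibniz_at_def g_commute[of _ "V _"] g_commute[of _ "cov X V q"] add.commute)

lemma metric_leibniz_at_extend:
  assumes "open U" "q \<in> U" "field_along B A f U V"
    and base: "\<And>d u. d \<in> A \<Longrightarrow> f q \<in> fst d \<Longrightarrow> metric_leibniz_at X q (\<lambda>q. coord_field A d u (f q)) W"
  shows "metric_leibniz_at X q V W"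
  using assms(1-3)
proof (induction rule: field_along_germ_induct)
  case (add N V V')
  then obtain N1 N2 where N: "open N1" "q \<in> N1" "smooth_fun B N1 (\<lambda>q. g (f q) (V q) (W q))"
    "open N2" "q \<in> N2" "smooth_fun B N2 (\<lambda>q. g (f q) (V' q) (W q))"
    unfolding metric_leibniz_at_def by blast
  let ?M = "N1 \<inter> N2"
  have M: "open ?M" "q \<in> ?M" using N by auto
  have sm: "smooth_fun B ?M (\<lambda>q. g (f q) (V q) (W q))" "smooth_fun B ?M (\<lambda>q. g (f q) (V' q) (W q))"
    by (rule src.smooth_fun_subset[OF N(3)] src.smooth_fun_subset[OF N(6)]; simp)+
  have "smooth_fun B ?M (\<lambda>q. g (f q) (V q + V' q) (W q))"
    using src.smooth_fun_add[OF M(1) sm] by simp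
  moreover have "dird B (\<lambda>q. g (f q) (V q + V' q) (W q)) q (X q)
      = g (f q) (cov X (\<lambda>q. V q + V' q) q) (W q) + g (f q) (V q + V' q) (cov X W q)"
    using src.dird_add[OF sm M, of "X q"] add.IH cov_add[OF add.hyps(1,2,4,5)]
    by (simp add: metric_leibniz_at_def)
  ultimately show ?case using M unfolding metric_leibniz_at_def by blast
next
  case (scale N h V)
  then obtain N1 where N: "open N1" "q \<in> N1" "smooth_fun B N1 (\<lambda>q. g (f q) (V q) (W q))"
    unfolding metric_leibniz_at_def by blast
  let ?M = "N \<inter> N1"
  have M: "open ?M" "q \<in> ?M" using N scale by auto
  have sm: "smooth_fun B ?M (\<lambda>q. g (f q) (V q) (W q))" "smooth_fun B ?M h"
    by (rule src.smooth_fun_subset[OF N(3)] src.smooth_fun_subset[OF scale.hyps(4)]; simp)+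
  have "smooth_fun B ?M (\<lambda>q. g (f q) (h q *\<^sub>R V q) (W q))"
    using src.smooth_fun_mult[OF M(1) sm(2,1)] by simp
  moreover have "dird B (\<lambda>q. g (f q) (h q *\<^sub>R V q) (W q)) q (X q)
      = g (f q) (cov X (\<lambda>q. h q *\<^sub>R V q) q) (W q) + g (f q) (h q *\<^sub>R V q) (cov X W q)"
    using src.dird_mult[OF sm(2,1) M, of "X q"] scale.IH cov_scaleR[OF scale.hyps(1,2,5,4), of X]
    by (simp add: metric_leibniz_at_def distrib_left)
  ultimately show ?case using M unfolding metric_leibniz_at_def by blast
next
  case (cong N V V')
  then obtain N1 where N: "open N1" "q \<in> N1" "smooth_fun B N1 (\<lambda>q. g (f q) (V q) (W q))"
    unfolding metric_leibniz_at_def by blast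
  let ?M = "N \<inter> N1"
  have M: "open ?M" "q \<in> ?M" using N cong by auto
  have "smooth_fun B ?M (\<lambda>q. g (f q) (V' q) (W q))"
    by (rule src.smooth_fun_cong[OF M(1) _ src.smooth_fun_subset[OF N(3)]]) (auto simp: cong.hyps(4))
  moreover have "dird B (\<lambda>q. g (f q) (V' q) (W q)) q (X q) = dird B (\<lambda>q. g (f q) (V q) (W q)) q (X q)"
    by (rule src.dird_cong[OF cong.hyps(1,2)]) (simp add: cong.hyps(4))
  moreover have "cov X V' q = cov X V q"
    by (rule cov_cong[OF cong.hyps(1,2)]) (simp_all add: cong.hyps(4))
  ultimately show ?case
    using M cong.IH cong.hyps(4)[OF cong.hyps(2)] unfolding metric_leibniz_at_def by auto
qed (rule base)

text \<open>The extension lemma is used once per slot, with a swap in between. What remains is a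
  pair of ambient coordinate fields, possibly of different charts, and ambient metricity on the
  overlap settles it.\<close>

lemma metric_leibniz_at_fields:
  assumes "open U" "q \<in> U" "field_along B A f U V" "field_along B A f U W"
  shows "metric_leibniz_at X q V W"
proof (rule metric_leibniz_at_extend[OF assms(1-3)], rule metric_leibniz_at_commute,
    rule metric_leibniz_at_extend[OF assms(1,2,4)])
  fix d u d' u' assume d: "d \<in> A" "f q \<in> fst d" and d': "d' \<in> A" "f q \<in> fst d'"
  let ?O = "fst d \<inter> fst d'" and ?E = "coord_field A d u" and ?E' = "coord_field A d' u'"
  let ?Y = "coord_field A d (comps A d (f q) (dmap B A f q (X q)))"
  have O': "open ?O" "f q \<in> ?O" using open_Int[OF tgt.chart(1)[OF d(1)] tgt.chart(1)[OF d'(1)]] d d' by auto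
  have E: "vector_field A ?O (coord_field A d u)" for u
    by (rule tgt.idm.field_along_subset[OF tgt.coord_field_vector_field[OF d(1)]]) auto
  have E': "vector_field A ?O ?E'"
    by (rule tgt.idm.field_along_subset[OF tgt.coord_field_vector_field[OF d'(1)]]) auto
  have sm: "smooth_fun A ?O (\<lambda>p. g p (?E' p) (?E p))" by (rule g_smooth[OF O'(1) E' E])
  have Y: "?Y (f q) = dmap B A f q (X q)" by (rule tgt.coord_field_comps[OF d])
  have "smooth_fun B (f -` ?O) (\<lambda>q. g (f q) (?E' (f q)) (?E (f q)))"
    by (rule smooth_fun_pullback[OF open_vimage_map[OF O'(1)] O'(1) sm]) auto
  moreover have "dird B (\<lambda>q. g (f q) (?E' (f q)) (?E (f q))) q (X q)
      = dird A (\<lambda>p. g p (?E' p) (?E p)) (f q) (?Y (f q))"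
    unfolding Y by (rule dird_pullback[OF O'(1) sm O'(2)])
  moreover have "cov X (\<lambda>q. ?E (f q)) q = nabla ?Y ?E (f q)"
    by (rule cov_pullback[OF O' E E]) (rule Y)
  moreover have "cov X (\<lambda>q. ?E' (f q)) q = nabla ?Y ?E' (f q)"
    by (rule cov_pullback[OF O' E' E]) (rule Y)
  ultimately show "metric_leibniz_at X q (\<lambda>q. ?E' (f q)) (\<lambda>q. ?E (f q))"
    using open_vimage_map[OF O'(1)] O'(2) nabla_metric[OF O'(1) E E' E O'(2)]
    unfolding metric_leibniz_at_def by auto
qed

lemma metric_smooth:
  assumes "open U" "field_along B A f U V" "field_along B A f U W"
  shows "smooth_fun B U (\<lambda>q. g (f q) (V q) (W q))"
  by (rule src.smooth_fun_local)
    (use metric_leibniz_at_fields[OF assms(1) _ assms(2,3)] in \<open>auto simp: metric_leibniz_at_def\<close>)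

lemma cov_metric:
  assumes "open U" "q \<in> U" "field_along B A f U V" "field_along B A f U W"
  shows "dird B (\<lambda>q. g (f q) (V q) (W q)) q (X q) = g (f q) (cov X V q) (W q) + g (f q) (V q) (cov X W q)"
  using metric_leibniz_at_fields[OF assms, of X] by (simp add: metric_leibniz_at_def)

lemma nabla_curvature_coord_fields:
  assumes "d \<in> A" "p \<in> fst d"
  shows "nabla (coord_field A d i) (nabla (coord_field A d j) (coord_field A d u)) p
      - nabla (coord_field A d j) (nabla (coord_field A d i) (coord_field A d u)) p
    = Rt p (coord_field A d i p) (coord_field A d j p) (coord_field A d u p)"
proof -
  have O': "open (fst d)" by (rule tgt.chart(1)[OF assms(1)])
  have E: "vector_field A (fst d) (coord_field A d u)" for u
    by (rule tgt.coord_field_vector_field[OF assms(1)])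
  have "nabla (lie_bracket A (coord_field A d i) (coord_field A d j)) (coord_field A d u) p
      = nabla (\<lambda>p. 0) (coord_field A d u) p"
    by (rule nabla_cong[OF O' tgt.idm.field_along_zero E assms(2)])
      (simp_all add: tgt.lie_bracket_coord_field assms)
  \<comment> \<open>The zero field is the empty linear combination.\<close>
  also have "\<dots> = 0"
    using nabla_lincomb_left[of "{}", OF _ O' E assms(2)] by simp
  finally show ?thesis
    using curvature_Rt[OF O' E E E assms(2), of i j u] by (simp add: curvature_def)
qed

text \<open>The curvature of the pulled-back connection is the pulled-back curvature. As
  \<open>X\<close> and \<open>Y\<close> need not be \<open>f\<close>-related to ambient fields, the
  coordinate case expands both derivatives: the double sums assemble the ambient curvature, and the
  second derivatives of \<open>f\<close> are cancelled by the bracket term.\<close>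

lemma cov_curvature:
  assumes "open U" "q \<in> U" "field_along B A f U V"
    and X: "vector_field B U X" and Y: "vector_field B U Y"
  shows "cov X (cov Y V) q - cov Y (cov X V) q - cov (lie_bracket B X Y) V q
    = Rt (f q) (dmap B A f q (X q)) (dmap B A f q (Y q)) (V q)"
  using assms(1-3)
proof (induction rule: field_along_germ_induct)
  case (add N V W)
  have XN: "vector_field B N X" "vector_field B N Y"
    using src.idm.field_along_subset X Y add.hyps(3) by blast+
  have 1: "cov X (cov Y (\<lambda>q. V q + W q)) q = cov X (cov Y V) q + cov X (cov Y W) q"
    if "vector_field B N Y" for X Y
  proof -
    have "cov X (cov Y (\<lambda>q. V q + W q)) q = cov X (\<lambda>q. cov Y V q + cov Y W q) q"
      by (rule cov_cong[OF add.hyps(1,2)]) (simp_all add: cov_add[OF add.hyps(1) _ add.hyps(4,5)])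
    also have "\<dots> = cov X (cov Y V) q + cov X (cov Y W) q"
      by (rule cov_add[OF add.hyps(1,2)]) (intro cov_field_along add.hyps that)+
    finally show ?thesis .
  qed
  show ?case
    using add.IH by (simp add: 1[OF XN(1)] 1[OF XN(2)] cov_add[OF add.hyps(1,2,4,5)]
        linear_add[OF Rt_linear(3)] algebra_simps)
next
  case (scale N h V)
  note N = scale.hyps(1,2)
  have XN: "vector_field B N X" "vector_field B N Y"
    using src.idm.field_along_subset X Y scale.hyps(3) by blast+
  have 1: "cov X (cov Y (\<lambda>q. h q *\<^sub>R V q)) q = dird B (\<lambda>q. dird B h q (Y q)) q (X q) *\<^sub>R V q
      + dird B h q (Y q) *\<^sub>R cov X V q + (dird B h q (X q) *\<^sub>R cov Y V q + h q *\<^sub>R cov X (cov Y V) q)"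
    if "vector_field B N Y" for X Y
  proof -
    have "cov X (cov Y (\<lambda>q. h q *\<^sub>R V q)) q = cov X (\<lambda>q. dird B h q (Y q) *\<^sub>R V q + h q *\<^sub>R cov Y V q) q"
      by (rule cov_cong[OF N]) (simp_all add: cov_scaleR[OF N(1) _ scale.hyps(5,4)])
    also have "\<dots> = cov X (\<lambda>q. dird B h q (Y q) *\<^sub>R V q) q + cov X (\<lambda>q. h q *\<^sub>R cov Y V q) q"
      by (rule cov_add[OF N]) (intro field_along_scaleR cov_field_along src.dird_smooth scale.hyps that)+
    also have "cov X (\<lambda>q. dird B h q (Y q) *\<^sub>R V q) q
        = dird B (\<lambda>q. dird B h q (Y q)) q (X q) *\<^sub>R V q + dird B h q (Y q) *\<^sub>R cov X V q"
      by (rule cov_scaleR[OF N]) (intro src.dird_smooth scale.hyps that)+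
    also have "cov X (\<lambda>q. h q *\<^sub>R cov Y V q) q = dird B h q (X q) *\<^sub>R cov Y V q + h q *\<^sub>R cov X (cov Y V) q"
      by (rule cov_scaleR[OF N]) (intro cov_field_along scale.hyps that)+
    finally show ?thesis .
  qed
  \<comment> \<open>First order cross terms cancel by their symmetry in \<open>X\<close> and
    \<open>Y\<close>; the second derivatives of \<open>h\<close> are absorbed by the
    bracket.\<close>
  have 2: "dird B h q (lie_bracket B X Y q) =
      dird B (\<lambda>q. dird B h q (Y q)) q (X q) - dird B (\<lambda>q. dird B h q (X q)) q (Y q)"
    by (rule src.dird_lie_bracket[OF N scale.hyps(4) XN])
  show ?case
    unfolding 1[OF XN(1)] 1[OF XN(2)] cov_scaleR[OF N scale.hyps(5,4)] 2
      linear_cmul[OF Rt_linear(3)] scale.IH[symmetric]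
    by (simp add: algebra_simps)
next
  case (coord d u)
  let ?M = "U \<inter> f -` fst d" and ?F = "snd d \<circ> f" and ?E = "coord_field A d"
  have M: "open ?M" "q \<in> ?M" using open_dom[OF assms(1) coord(1)] coord assms(2) by auto
  have XM: "vector_field B ?M X" "vector_field B ?M Y"
    by (rule src.idm.field_along_subset[OF X] src.idm.field_along_subset[OF Y]; simp)+
  have O': "open (fst d)" by (rule tgt.chart(1)[OF coord(1)])
  have E: "vector_field A (fst d) (?E u)" for u
    by (rule tgt.coord_field_vector_field[OF coord(1)])
  define K where "K i j = nabla (?E i) (nabla (?E j) (?E u)) (f q)" for i j
  define a where "a X = dird B ?F q (X q)" for X
  have NE: "vector_field A (fst d) (nabla (?E j) (?E u))" for j
    by (rule nabla_vector_field[OF O' E E])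
  have F: "smooth_fun B ?M ?F"
    by (rule src.smooth_fun_subset[OF smooth_fun_coords[OF coord(1)]]) auto
  have 1: "cov X (cov Y (\<lambda>q. ?E u (f q))) q =
      (\<Sum>j\<in>Basis. (dird B (\<lambda>q. dird B ?F q (Y q)) q (X q) \<bullet> j) *\<^sub>R nabla (?E j) (?E u) (f q))
      + (\<Sum>j\<in>Basis. \<Sum>i\<in>Basis. (a Y \<bullet> j) *\<^sub>R (a X \<bullet> i) *\<^sub>R K i j)"
    if Y: "vector_field B ?M Y" for X Y
  proof -
    have d1: "dird B (\<lambda>q. dird B ?F q (Y q) \<bullet> j) q (X q) = dird B (\<lambda>q. dird B ?F q (Y q)) q (X q) \<bullet> j" for j
      by (rule src.dird_bounded_linear[OF src.dird_smooth[OF M(1) F Y] M bounded_linear_inner_left])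
    have d2: "cov X (\<lambda>q. nabla (?E j) (?E u) (f q)) q = (\<Sum>i\<in>Basis. (a X \<bullet> i) *\<^sub>R K i j)" for j
      unfolding K_def a_def by (rule cov_pullback_coords[OF O' coord(2) NE coord])
    have "cov X (cov Y (\<lambda>q. ?E u (f q))) q
        = cov X (\<lambda>q. \<Sum>j\<in>Basis. (dird B ?F q (Y q) \<bullet> j) *\<^sub>R nabla (?E j) (?E u) (f q)) q"
      by (rule cov_cong[OF M]) (use cov_pullback_coords[OF O' _ E coord(1)] in auto)
    also have "\<dots> = (\<Sum>j\<in>Basis. dird B (\<lambda>q. dird B ?F q (Y q) \<bullet> j) q (X q) *\<^sub>R nabla (?E j) (?E u) (f q)
        + (dird B ?F q (Y q) \<bullet> j) *\<^sub>R cov X (\<lambda>q. nabla (?E j) (?E u) (f q)) q)"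
      by (rule cov_lincomb[OF finite_Basis M smooth_fun_dird_coords[OF M(1) Y coord(1)]
            field_along_pullback[OF M(1) O' NE]]) auto
    finally show ?thesis
      by (simp add: d1 d2 sum.distrib scaleR_sum_right a_def[of Y])
  qed
  have 2: "cov (lie_bracket B X Y) (\<lambda>q. ?E u (f q)) q
      = (\<Sum>j\<in>Basis. (dird B (\<lambda>q. dird B ?F q (Y q)) q (X q) \<bullet> j) *\<^sub>R nabla (?E j) (?E u) (f q))
      - (\<Sum>j\<in>Basis. (dird B (\<lambda>q. dird B ?F q (X q)) q (Y q) \<bullet> j) *\<^sub>R nabla (?E j) (?E u) (f q))"
    using cov_pullback_coords[OF O' coord(2) E coord, of "lie_bracket B X Y" u]
    by (simp add: src.dird_lie_bracket[OF M F XM] inner_diff_left scaleR_left_diff_distrib sum_subtractf)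
  have 3: "dmap B A f q v = (\<Sum>i\<in>Basis. (dird B ?F q v \<bullet> i) *\<^sub>R ?E i (f q))" for v
    unfolding comps_dmap[OF coord, symmetric] by (rule tgt.coord_field_expand[OF coord])
  have "(\<Sum>j\<in>Basis. \<Sum>i\<in>Basis. (a Y \<bullet> j) *\<^sub>R (a X \<bullet> i) *\<^sub>R K i j)
      - (\<Sum>j\<in>Basis. \<Sum>i\<in>Basis. (a X \<bullet> j) *\<^sub>R (a Y \<bullet> i) *\<^sub>R K i j)
      = (\<Sum>i\<in>Basis. \<Sum>j\<in>Basis. (a X \<bullet> i) *\<^sub>R (a Y \<bullet> j) *\<^sub>R (K i j - K j i))"
    by (subst sum.swap) (simp add: sum_subtractf scaleR_diff_right mult.commute)
  also have "\<dots> = (\<Sum>i\<in>Basis. \<Sum>j\<in>Basis. (a X \<bullet> i) *\<^sub>R (a Y \<bullet> j) *\<^sub>R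
      Rt (f q) (?E i (f q)) (?E j (f q)) (?E u (f q)))"
    unfolding K_def nabla_curvature_coord_fields[OF coord] ..
  also have "\<dots> = Rt (f q) (dmap B A f q (X q)) (dmap B A f q (Y q)) (?E u (f q))"
    unfolding 3 a_def
    by (simp add: linear_sum[OF Rt_linear(1)] linear_sum[OF Rt_linear(2)]
        linear_cmul[OF Rt_linear(1)] linear_cmul[OF Rt_linear(2)] scaleR_sum_right)
      (subst sum.swap, simp add: mult.commute)
  finally show ?case by (simp add: 1[OF XM(1)] 1[OF XM(2)] 2)
next
  case (cong N V W)
  have 1: "cov Y W q' = cov Y V q'" if "q' \<in> N" for Y q'
    by (rule cov_cong[OF cong.hyps(1) that]) (simp_all add: cong.hyps(4))
  have "cov X (cov Y W) q = cov X (cov Y V) q" for X Y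
    by (rule cov_cong[OF cong.hyps(1,2) 1]) auto
  then show ?case using cong.IH 1[OF cong.hyps(2)] cong.hyps(4)[OF cong.hyps(2)] by simp
qed

end

section \<open>Tangential and normal parts\<close>

locale kaehler_sub = kaehler_map B A f nabla J g c + ind: mfd_connection B nab
  for B :: "('q::{t2_space,second_countable_topology}, 'f::euclidean_space) atlas"
    and A :: "('p::{t2_space,second_countable_topology}, 'e::euclidean_space) atlas"
    and f :: "'q \<Rightarrow> 'p"
    and nabla :: "('p \<Rightarrow> 'e) \<Rightarrow> ('p \<Rightarrow> 'e) \<Rightarrow> 'p \<Rightarrow> 'e"
    and J :: "'p \<Rightarrow> 'e \<Rightarrow> 'e" and g :: "'p \<Rightarrow> 'e \<Rightarrow> 'e \<Rightarrow> real" and c :: real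
    and nab :: "('q \<Rightarrow> 'f) \<Rightarrow> ('q \<Rightarrow> 'f) \<Rightarrow> 'q \<Rightarrow> 'f" +
  assumes submanifold: "kaehler_submanifold B A f J"
    and levi_civita_induced: "levi_civita B (induced_metric B A f g) nab"
begin

abbreviation df :: "'q \<Rightarrow> 'f \<Rightarrow> 'e" where "df \<equiv> dmap B A f"
abbreviation NS :: "'q \<Rightarrow> 'e set" where "NS \<equiv> normal_space B A f g"
abbreviation np :: "'q \<Rightarrow> 'e \<Rightarrow> 'e" where "np \<equiv> normal_part B A f g"

lemmas df_simps [simp] = linear_add[OF dmap_linear] linear_cmul[OF dmap_linear]
  linear_neg[OF dmap_linear] linear_diff[OF dmap_linear] linear_0[OF dmap_linear]

lemma df_inj: "inj (df q)"
  using submanifold by (simp add: kaehler_submanifold_def immersion_def)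

lemma df_eq_iff [simp]: "df q u = df q v \<longleftrightarrow> u = v"
  using df_inj by (auto dest: injD)

lemma df_eq_0 [simp]: "df q u = 0 \<longleftrightarrow> u = 0"
  using df_eq_iff[of q u 0] by (simp del: df_eq_iff)

lemma J_df_tangent: "J (f q) (df q v) \<in> range (df q)"
  using submanifold by (simp add: kaehler_submanifold_def)

lemma NS_D: "\<xi> \<in> NS q \<Longrightarrow> g (f q) \<xi> (df q v) = 0" "\<xi> \<in> NS q \<Longrightarrow> g (f q) (df q v) \<xi> = 0"
  by (simp_all add: normal_space_def g_commute[of _ "df q v"])

lemma NS_subspace: "0 \<in> NS q" "\<xi> \<in> NS q \<Longrightarrow> \<eta> \<in> NS q \<Longrightarrow> \<xi> + \<eta> \<in> NS q"
  "\<xi> \<in> NS q \<Longrightarrow> a *\<^sub>R \<xi> \<in> NS q" "\<xi> \<in> NS q \<Longrightarrow> \<eta> \<in> NS q \<Longrightarrow> \<xi> - \<eta> \<in> NS q"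
  "\<xi> \<in> NS q \<Longrightarrow> - \<xi> \<in> NS q"
  by (simp_all add: normal_space_def)

lemma tangent_normal_unique:
  assumes "df q u + \<xi> = df q v + \<eta>" "\<xi> \<in> NS q" "\<eta> \<in> NS q"
  shows "u = v" "\<xi> = \<eta>"
proof -
  have eq: "df q (u - v) = \<eta> - \<xi>" using assms(1) by (simp add: algebra_simps)
  have "g (f q) (df q (u - v)) (df q (u - v)) = g (f q) (\<eta> - \<xi>) (df q (u - v))"
    by (simp only: eq)
  also have "\<dots> = 0" by (rule NS_D(1)[OF NS_subspace(4)[OF assms(3,2)]])
  finally show "u = v" by (simp del: df_simps)
  then show "\<xi> = \<eta>" using assms(1) by simp
qed

lemma orthogonal_span:
  assumes "\<And>s. s \<in> S \<Longrightarrow> g (f q) w (df q s) = 0" "y \<in> span S"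
  shows "g (f q) w (df q y) = 0"
  using assms(2)
  by (induction rule: span_induct_alt) (simp_all add: assms(1))

text \<open>Orthogonal projection onto the span of some of the coordinate fields of \<open>d\<close>, built up one
  field at a time as in the Gram--Schmidt process, which makes its smoothness evident.\<close>

lemma smooth_projection:
  assumes d: "d \<in> B" and N: "open N" "N \<subseteq> fst d"
    and S: "finite S" "S \<subseteq> Basis" and V: "field_along B A f N V"
  shows "\<exists>X. vector_field B N X \<and> (\<forall>q\<in>N. X q \<in> span ((\<lambda>i. coord_field B d i q) ` S) \<and>
    (\<forall>s\<in>S. g (f q) (V q - df q (X q)) (df q (coord_field B d s q)) = 0))"
  using S V
proof (induction S arbitrary: V)
  case empty
  show ?case by (rule exI[of _ "\<lambda>q. 0"]) (simp add: src.idm.field_along_zero)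
next
  case (insert b S)
  let ?C = "coord_field B d"
  let ?sp = "\<lambda>S q. span ((\<lambda>i. ?C i q) ` S)"
  have Cb: "vector_field B N (?C b)"
    by (rule src.idm.field_along_subset[OF src.coord_field_vector_field[OF d] N(2)])
  have "S \<subseteq> Basis" using insert.prems(1) by simp
  note IH = insert.IH[OF this]
  obtain X where X: "vector_field B N X" and XS: "\<And>q. q \<in> N \<Longrightarrow> X q \<in> ?sp S q"
    and Xo: "\<And>q s. q \<in> N \<Longrightarrow> s \<in> S \<Longrightarrow> g (f q) (V q - df q (X q)) (df q (?C s q)) = 0"
    using IH[OF insert.prems(2)] by (elim exE conjE) (simp add: Ball_def)
  \<comment> \<open>The induction hypothesis is used a second time, on the new coordinate field
    itself; \<open>T\<close> is then its part orthogonal to the earlier ones.\<close>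
  obtain Y where Y: "vector_field B N Y" and YS: "\<And>q. q \<in> N \<Longrightarrow> Y q \<in> ?sp S q"
    and Yo: "\<And>q s. q \<in> N \<Longrightarrow> s \<in> S \<Longrightarrow> g (f q) (df q (?C b q) - df q (Y q)) (df q (?C s q)) = 0"
    using IH[OF field_along_dmap[OF N(1) Cb]] by (elim exE conjE) (simp add: Ball_def)
  define T where "T q = ?C b q - Y q" for q
  have T: "vector_field B N T"
    using src.idm.field_along_diff[OF N(1) Cb Y] by (simp add: T_def[abs_def])
  \<comment> \<open>Otherwise the new coordinate field would lie in the span of the earlier ones; in
    components this contradicts the independence of \<open>Basis\<close>.\<close>
  have T0: "T q \<noteq> 0" if q: "q \<in> N" for q
  proof
    assume "T q = 0"
    have qd: "q \<in> fst d" using N(2) q by blast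
    have lin: "linear (\<lambda>u. ?C u q)" by (rule src.coord_field_linear[OF d qd])
    have "?C b q \<in> ?sp S q" using YS[OF q] \<open>T q = 0\<close> by (simp add: T_def)
    then obtain u where u: "u \<in> span S" "?C b q = ?C u q"
      unfolding linear_span_image[OF lin] by auto
    have "comps B d q (?C b q) = comps B d q (?C u q)" using u(2) by simp
    then have "b = u" by (simp only: src.comps_coord_field[OF d qd])
    have "S \<subseteq> Basis - {b}" using insert.hyps insert.prems(1) by auto
    then have "b \<in> span (Basis - {b})" using span_mono u(1) \<open>b = u\<close> by blast
    then show False using independent_Basis insert.prems(1) unfolding dependent_def by blast
  qed
  \<comment> \<open>The coefficient that removes from the residual \<open>V - df X\<close> its
    component along \<open>T\<close>.\<close>
  define h where "h q = g (f q) (V q - df q (X q)) (df q (T q)) * inverse (g (f q) (df q (T q)) (df q (T q)))" for q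
  have h: "smooth_fun B N h"
    unfolding h_def
  proof (rule src.smooth_fun_mult[OF N(1)])
    note dT = field_along_dmap[OF N(1) T]
    show "smooth_fun B N (\<lambda>q. g (f q) (V q - df q (X q)) (df q (T q)))"
      by (rule metric_smooth[OF N(1) field_along_diff[OF N(1) insert.prems(2) field_along_dmap[OF N(1) X]] dT])
    show "smooth_fun B N (\<lambda>q. inverse (g (f q) (df q (T q)) (df q (T q))))"
      by (rule src.smooth_fun_inverse[OF N(1) metric_smooth[OF N(1) dT dT]]) (simp add: T0)
  qed
  have hT: "g (f q) (V q - df q (X q + h q *\<^sub>R T q)) (df q (T q)) = 0" if "q \<in> N" for q
    using T0[OF that] by (simp add: h_def field_simps)
  have So: "g (f q) (V q - df q (X q + h q *\<^sub>R T q)) (df q (?C s q)) = 0" if "q \<in> N" "s \<in> S" for q s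
    using Xo[OF that] Yo[OF that] by (simp add: T_def)
  \<comment> \<open>The new coordinate field is \<open>T + Y\<close>: orthogonality to
    \<open>T\<close> is the choice of \<open>h\<close>, and \<open>Y\<close> lies in the span
    already dealt with.\<close>
  have "g (f q) (V q - df q (X q + h q *\<^sub>R T q)) (df q (?C b q)) = 0" if "q \<in> N" for q
  proof -
    have "g (f q) (V q - df q (X q + h q *\<^sub>R T q)) (df q (Y q)) = 0"
      by (rule orthogonal_span[OF _ YS[OF that]]) (use So that in auto)
    moreover have "?C b q = T q + Y q" by (simp add: T_def)
    ultimately show ?thesis using hT[OF that] by (simp del: g_simps add: bilinear_radd[OF g_bilinear])
  qed
  moreover have "X q + h q *\<^sub>R T q \<in> ?sp (insert b S) q" if "q \<in> N" for q
  proof -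
    have "?sp S q \<subseteq> ?sp (insert b S) q" by (rule span_mono) auto
    moreover have "?C b q \<in> ?sp (insert b S) q" by (rule span_base) auto
    ultimately show ?thesis
      using XS[OF that] YS[OF that] by (auto simp: T_def intro!: span_add span_scale span_diff)
  qed
  moreover have "vector_field B N (\<lambda>q. X q + h q *\<^sub>R T q)"
    by (intro src.idm.field_along_add[OF N(1)] src.idm.field_along_scaleR[OF N(1)] X h T)
  ultimately show ?case using So by (intro exI[of _ "\<lambda>q. X q + h q *\<^sub>R T q"]) auto
qed

lemma local_tangential_field:
  assumes "open U" "q0 \<in> U" "field_along B A f U V"
  obtains N X where "open N" "q0 \<in> N" "N \<subseteq> U" "vector_field B N X"
    "\<And>q. q \<in> N \<Longrightarrow> V q - df q (X q) \<in> NS q"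
proof -
  let ?d = "chart_at B q0"
  have d: "?d \<in> B" "q0 \<in> fst ?d" by (rule src.chart_at)+
  let ?N = "U \<inter> fst ?d"
  have N: "open ?N" "q0 \<in> ?N" using src.open_Int_chart(1)[OF d(1) assms(1)] assms d by auto
  obtain X where X: "vector_field B ?N X"
    and o: "\<And>q s. q \<in> ?N \<Longrightarrow> s \<in> Basis \<Longrightarrow> g (f q) (V q - df q (X q)) (df q (coord_field B ?d s q)) = 0"
    using smooth_projection[OF d(1) N(1) _ finite_Basis order_refl field_along_subset[OF assms(3)]] by blast
  have "V q - df q (X q) \<in> NS q" if q: "q \<in> ?N" for q
    unfolding normal_space_def
  proof (intro CollectI allI)
    fix v
    have "v \<in> span ((\<lambda>i. coord_field B ?d i q) ` Basis)"
      using src.coord_field_expand[OF d(1), of q v] q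
      by (metis (no_types, lifting) IntD2 image_eqI span_base span_scale span_sum)
    then show "g (f q) (V q - df q (X q)) (df q v) = 0"
      by (rule orthogonal_span[rotated]) (use o[OF q] in auto)
  qed
  then show ?thesis using that[OF N _ X] by auto
qed

text \<open>The tangential part, taken in the tangent space of the source rather than in its image
  under \<open>df\<close>.\<close>

definition tp :: "'q \<Rightarrow> 'e \<Rightarrow> 'f" where
  "tp q w = inv (df q) (w - np q w)"

lemma parts_unique:
  assumes "w = df q v + \<xi>" "\<xi> \<in> NS q"
  shows "np q w = \<xi>" "tp q w = v"
proof -
  show np: "np q w = \<xi>"
    unfolding normal_part_def
  proof (rule the_equality)
    show "\<xi> \<in> NS q \<and> w - \<xi> \<in> range (df q)" using assms by simp
    fix \<eta> assume "\<eta> \<in> NS q \<and> w - \<eta> \<in> range (df q)"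
    then obtain u where "\<eta> \<in> NS q" "w - \<eta> = df q u" by auto
    then show "\<eta> = \<xi>"
      using tangent_normal_unique(2)[of q u \<eta> v \<xi>] assms by (simp add: algebra_simps)
  qed
  show "tp q w = v" unfolding tp_def np using assms(1) df_inj by simp
qed

text \<open>Existence of the decomposition, on which the definite description in
  \<open>normal_part\<close> rests. The vector is extended to a coordinate field merely so that the
  projection lemma applies.\<close>

lemma parts: "np q w \<in> NS q" "w = df q (tp q w) + np q w"
proof -
  let ?d = "chart_at A (f q)"
  have d: "?d \<in> A" "f q \<in> fst ?d" by (rule tgt.chart_at)+
  have O': "open (fst ?d)" by (rule tgt.chart(1)[OF d(1)])
  let ?V = "\<lambda>q. coord_field A ?d w (f q)"
  have V: "field_along B A f (f -` fst ?d) ?V"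
    by (rule field_along_pullback[OF open_vimage_map[OF O'] O' tgt.coord_field_vector_field[OF d(1)]]) simp
  have q: "q \<in> f -` fst ?d" using d by simp
  obtain N X where "q \<in> N" "\<And>q. q \<in> N \<Longrightarrow> ?V q - df q (X q) \<in> NS q"
    using local_tangential_field[OF open_vimage_map[OF O'] q V] by metis
  moreover have "?V q = w" using tgt.coord_field_comps[OF d, of w] by simp
  ultimately have "w - df q (X q) \<in> NS q" by metis
  from parts_unique[OF _ this, of w "X q"] this
  show "np q w \<in> NS q" "w = df q (tp q w) + np q w" by simp_all
qed

lemma df_tp: "df q (tp q w) = w - np q w"
  using parts(2)[of w q] by (simp add: eq_diff_eq)

lemma parts_linear: "linear (np q)" "linear (tp q)"
proof -
  have add: "u + w = df q (tp q u + tp q w) + (np q u + np q w)" for u w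
    using parts(2)[of u q] parts(2)[of w q] by (simp add: df_tp)
  have scale: "a *\<^sub>R w = df q (a *\<^sub>R tp q w) + a *\<^sub>R np q w" for a w
    by (simp add: df_tp algebra_simps)
  show "linear (np q)"
    by (rule linearI; rule parts_unique(1)[OF add] parts_unique(1)[OF scale])
      (intro NS_subspace parts)+
  show "linear (tp q)"
    by (rule linearI; rule parts_unique(2)[OF add] parts_unique(2)[OF scale])
      (intro NS_subspace parts)+
qed

lemmas np_simps [simp] = linear_add[OF parts_linear(1)] linear_cmul[OF parts_linear(1)]
  linear_neg[OF parts_linear(1)] linear_diff[OF parts_linear(1)] linear_0[OF parts_linear(1)]
lemmas tp_simps [simp] = linear_add[OF parts_linear(2)] linear_cmul[OF parts_linear(2)]
  linear_neg[OF parts_linear(2)] linear_diff[OF parts_linear(2)] linear_0[OF parts_linear(2)]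

lemma np_df [simp]: "np q (df q v) = 0" and tp_df [simp]: "tp q (df q v) = v"
  using parts_unique[of "df q v" q v 0] NS_subspace(1) by simp_all

lemma np_normal: "\<xi> \<in> NS q \<Longrightarrow> np q \<xi> = \<xi>" and tp_normal: "\<xi> \<in> NS q \<Longrightarrow> tp q \<xi> = 0"
  using parts_unique[of \<xi> q 0 \<xi>] by simp_all

lemma g_np: "\<xi> \<in> NS q \<Longrightarrow> g (f q) \<xi> (np q w) = g (f q) \<xi> w"
  "\<xi> \<in> NS q \<Longrightarrow> g (f q) (np q w) \<xi> = g (f q) w \<xi>"
  using parts(2)[of w q] NS_D[of \<xi> q "tp q w"] by (metis g_simps(1,2) add_0)+

lemma g_df_tp: "g (f q) (df q (tp q w)) (df q v) = g (f q) w (df q v)"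
  "g (f q) (df q v) (df q (tp q w)) = g (f q) (df q v) w"
  using NS_D[OF parts(1)[of q w]] by (simp_all add: df_tp)

text \<open>The complex structure induced on the submanifold.\<close>

definition j :: "'q \<Rightarrow> 'f \<Rightarrow> 'f" where
  "j q v = tp q (J (f q) (df q v))"

lemma df_j [simp]: "df q (j q v) = J (f q) (df q v)"
proof -
  obtain u where "J (f q) (df q v) = df q u" using J_df_tangent by blast
  then show ?thesis by (simp add: j_def)
qed

text \<open>\<open>J\<close> is skew for \<open>g\<close> and preserves tangent spaces, so it
  preserves their orthogonal complements.\<close>

lemma J_normal: "\<xi> \<in> NS q \<Longrightarrow> J (f q) \<xi> \<in> NS q"
  unfolding normal_space_def by (simp add: g_J_left df_j[symmetric] del: df_j)

lemma parts_J [simp]: "np q (J (f q) w) = J (f q) (np q w)" "tp q (J (f q) w) = j q (tp q w)"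
proof -
  have "J (f q) w = df q (j q (tp q w)) + J (f q) (np q w)"
    by (subst parts(2)[of w q]) simp
  from parts_unique[OF this J_normal[OF parts(1)]]
  show "np q (J (f q) w) = J (f q) (np q w)" "tp q (J (f q) w) = j q (tp q w)" .
qed

text \<open>\<open>tp\<close> is a pointwise choice; uniqueness of the decomposition identifies it
  locally with the smooth field built by orthogonalization.\<close>

lemma tp_vector_field:
  assumes "open U" "field_along B A f U V"
  shows "vector_field B U (\<lambda>q. tp q (V q))"
proof (rule src.idm.field_along_local)
  fix q assume "q \<in> U"
  then obtain N X where N: "open N" "q \<in> N" "vector_field B N X"
    and o: "\<And>q. q \<in> N \<Longrightarrow> V q - df q (X q) \<in> NS q"
    using local_tangential_field[OF assms(1) _ assms(2)] by metis
  have "tp q (V q) = X q" if "q \<in> N" for q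
    using parts_unique(2)[OF _ o[OF that], of "V q" "X q"] by simp
  then have "vector_field B N (\<lambda>q. tp q (V q))"
    by (intro src.idm.field_along_cong[OF N(1) _ N(3)]) simp
  then show "\<exists>N. open N \<and> q \<in> N \<and> vector_field B N (\<lambda>q. tp q (V q))" using N by blast
qed

lemma np_field_along:
  assumes "open U" "field_along B A f U V"
  shows "field_along B A f U (\<lambda>q. np q (V q))"
  using field_along_diff[OF assms field_along_dmap[OF assms(1) tp_vector_field[OF assms]]]
  by (simp add: df_tp)

end

section \<open>Fundamental equations of Kaehler submanifolds\<close>

locale kaehler_sub_on = kaehler_sub B A f nabla J g c nab
  for B :: "('q::{t2_space,second_countable_topology}, 'f::euclidean_space) atlas"
    and A :: "('p::{t2_space,second_countable_topology}, 'e::euclidean_space) atlas"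
    and f :: "'q \<Rightarrow> 'p"
    and nabla :: "('p \<Rightarrow> 'e) \<Rightarrow> ('p \<Rightarrow> 'e) \<Rightarrow> 'p \<Rightarrow> 'e"
    and J :: "'p \<Rightarrow> 'e \<Rightarrow> 'e" and g :: "'p \<Rightarrow> 'e \<Rightarrow> 'e \<Rightarrow> real" and c :: real
    and nab :: "('q \<Rightarrow> 'f) \<Rightarrow> ('q \<Rightarrow> 'f) \<Rightarrow> 'q \<Rightarrow> 'f" +
  fixes U :: "'q set"
  assumes U: "open U"
begin

abbreviation vf :: "('q \<Rightarrow> 'f) \<Rightarrow> bool" where "vf \<equiv> vector_field B U"
abbreviation fa :: "('q \<Rightarrow> 'e) \<Rightarrow> bool" where "fa \<equiv> field_along B A f U"
abbreviation nf :: "('q \<Rightarrow> 'e) \<Rightarrow> bool" where "nf \<equiv> normal_field B A f g U"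
abbreviation b :: "('q \<Rightarrow> 'f) \<Rightarrow> ('q \<Rightarrow> 'f) \<Rightarrow> 'q \<Rightarrow> 'e" where "b \<equiv> second_ff B A f g nabla"
abbreviation D :: "('q \<Rightarrow> 'f) \<Rightarrow> ('q \<Rightarrow> 'e) \<Rightarrow> 'q \<Rightarrow> 'e" where "D \<equiv> normal_conn B A f g nabla"
abbreviation dF :: "('q \<Rightarrow> 'f) \<Rightarrow> 'q \<Rightarrow> 'e" where "dF X \<equiv> \<lambda>q. df q (X q)"
abbreviation JF :: "('q \<Rightarrow> 'e) \<Rightarrow> 'q \<Rightarrow> 'e" where "JF V \<equiv> \<lambda>q. J (f q) (V q)"
abbreviation jF :: "('q \<Rightarrow> 'f) \<Rightarrow> 'q \<Rightarrow> 'f" where "jF X \<equiv> \<lambda>q. j q (X q)"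

text \<open>The shape operator \<open>A_\<xi> X\<close>, with the sign of the Weingarten
  formula.\<close>

definition Aw :: "('q \<Rightarrow> 'e) \<Rightarrow> ('q \<Rightarrow> 'f) \<Rightarrow> 'q \<Rightarrow> 'f" where
  "Aw \<xi> X q = - tp q (cov X \<xi> q)"

lemma b_eq: "b X Y q = np q (cov X (dF Y) q)"
  by (simp add: second_ff_def)

lemma D_eq: "D X \<xi> q = np q (cov X \<xi> q)"
  by (simp add: normal_conn_def)

lemma b_normal [simp]: "b X Y q \<in> NS q" and D_normal [simp]: "D X \<xi> q \<in> NS q"
  by (simp_all add: b_eq D_eq parts)

lemma dF_fa: "vf Y \<Longrightarrow> fa (dF Y)"
  by (rule field_along_dmap[OF U])

lemma cov_fa: "vf X \<Longrightarrow> fa V \<Longrightarrow> fa (cov X V)"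
  by (rule cov_field_along[OF U])

lemma nf_fa: "nf \<xi> \<Longrightarrow> fa \<xi>" and nf_NS: "nf \<xi> \<Longrightarrow> q \<in> U \<Longrightarrow> \<xi> q \<in> NS q"
  by (simp_all add: normal_field_def)

lemma b_nf: "vf X \<Longrightarrow> vf Y \<Longrightarrow> nf (b X Y)"
  using np_field_along[OF U cov_fa[OF _ dF_fa]] by (simp add: normal_field_def b_eq[abs_def] parts)

lemma D_nf: "vf X \<Longrightarrow> nf \<xi> \<Longrightarrow> nf (D X \<xi>)"
  using np_field_along[OF U cov_fa[OF _ nf_fa]] by (simp add: normal_field_def D_eq[abs_def] parts)

lemma JF_nf: "nf \<xi> \<Longrightarrow> nf (JF \<xi>)"
  using J_field_along[OF U] J_normal by (simp add: normal_field_def)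

lemma Aw_vf: "vf X \<Longrightarrow> fa \<xi> \<Longrightarrow> vf (Aw \<xi> X)"
  unfolding Aw_def[abs_def]
  by (rule src.idm.field_along_minus[OF U tp_vector_field[OF U cov_fa]])

lemma jF_vf: "vf X \<Longrightarrow> vf (jF X)"
  unfolding j_def by (rule tp_vector_field[OF U J_field_along[OF U dF_fa]])

lemma nab_vf: "vf X \<Longrightarrow> vf Y \<Longrightarrow> vf (nab X Y)"
  by (rule ind.nabla_vector_field[OF U])

lemma bracket_vf: "vf X \<Longrightarrow> vf Y \<Longrightarrow> vf (lie_bracket B X Y)"
  by (rule src.lie_bracket_vector_field[OF U])

lemma zero_by_pairing:
  assumes "vf X" "q \<in> U" "\<And>Z. vf Z \<Longrightarrow> g (f q) (df q (X q)) (df q (Z q)) = 0"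
  shows "X q = 0"
  using assms(3)[OF assms(1)] by simp

lemma nab_torsion_free:
  assumes "vf X" "vf Y" "q \<in> U"
  shows "nab X Y q - nab Y X q = lie_bracket B X Y q"
proof -
  have "torsion_free B nab" using levi_civita_induced by (simp add: levi_civita_def)
  from this[unfolded torsion_free_def, THEN spec, THEN spec, THEN spec, THEN mp,
      OF conjI[OF U conjI[OF assms(1,2)]], THEN bspec, OF assms(3)]
  show ?thesis .
qed

lemma nab_metric:
  assumes "vf X" "vf Y" "vf Z" "q \<in> U"
  shows "dird B (\<lambda>q. g (f q) (df q (Y q)) (df q (Z q))) q (X q)
    = g (f q) (df q (nab X Y q)) (df q (Z q)) + g (f q) (df q (Y q)) (df q (nab X Z q))"
proof -
  have "metric_connection B (induced_metric B A f g) nab"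
    using levi_civita_induced by (simp add: levi_civita_def)
  from this[unfolded metric_connection_def, THEN spec, THEN spec, THEN spec, THEN spec, THEN mp,
      OF conjI[OF U conjI[OF assms(1) conjI[OF assms(2,3)]]], THEN bspec, OF assms(4)]
  show ?thesis by (simp add: induced_metric_def)
qed

text \<open>Uniqueness of the Levi-Civita connection: the difference of the two connections pairs to a
  trilinear form symmetric in the first two and skew in the last two arguments.\<close>

lemma nab_eq:
  assumes X: "vf X" and Y: "vf Y" and q: "q \<in> U"
  shows "nab X Y q = tp q (cov X (dF Y) q)"
proof -
  define S where "S X Y q = nab X Y q - tp q (cov X (dF Y) q)" for X Y q
  have S_vf: "vf (S X Y)" if "vf X" "vf Y" for X Y
    unfolding S_def[abs_def]
    by (rule src.idm.field_along_diff[OF U nab_vf tp_vector_field[OF U cov_fa[OF _ dF_fa]]]) (rule that)+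
  define T where "T X Y Z = g (f q) (df q (S X Y q)) (df q (Z q))" for X Y Z
  have sym: "T X Y Z = T Y X Z" if "vf X" "vf Y" for X Y Z
  proof -
    have "tp q (cov X (dF Y) q - cov Y (dF X) q) = lie_bracket B X Y q"
      by (simp only: cov_torsion_free[OF torsion_free U q that] tp_df)
    then have "S X Y q = S Y X q"
      using nab_torsion_free[OF that q] by (simp add: S_def algebra_simps)
    then show ?thesis by (simp only: T_def)
  qed
  have skew: "T X Y Z = - T X Z Y" if "vf X" "vf Y" "vf Z" for X Y Z
    using nab_metric[OF that q] cov_metric[OF U q dF_fa[OF that(2)] dF_fa[OF that(3)], of X]
    by (simp add: T_def S_def g_df_tp g_commute[of _ "df q (Y q)"])
  have "S X Y q = 0"
  proof (rule zero_by_pairing[OF S_vf[OF X Y] q])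
    fix Z assume Z: "vf Z"
    \<comment> \<open>Alternating the two symmetries runs through all six orders of the arguments
      and comes back with the opposite sign.\<close>
    have "T X Y Z = 0"
      using sym[OF X Y, of Z] skew[OF Y X Z] sym[OF Y Z, of X] skew[OF Z Y X] sym[OF Z X, of Y]
        skew[OF X Z Y] by simp
    then show "g (f q) (df q (S X Y q)) (df q (Z q)) = 0" by (simp only: T_def)
  qed
  then show ?thesis by (simp add: S_def)
qed

lemma gauss: "vf X \<Longrightarrow> vf Y \<Longrightarrow> q \<in> U \<Longrightarrow> cov X (dF Y) q = df q (nab X Y q) + b X Y q"
  unfolding nab_eq b_eq by (rule parts(2))

lemma weingarten: "cov X \<xi> q = D X \<xi> q - df q (Aw \<xi> X q)"
  by (simp add: Aw_def D_eq df_tp)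

text \<open>Tensoriality is recorded for the first slot only; the second slot is reached through
  \<open>b_sym\<close>.\<close>

lemma b_pointwise: "b X Y q = b (\<lambda>_. X q) Y q"
  unfolding b_eq by (simp only: cov_pointwise[of X])

lemma b_linear: "vf Y \<Longrightarrow> q \<in> U \<Longrightarrow> linear (\<lambda>v. b (\<lambda>_. v) Y q)"
  unfolding b_eq
  using linear_compose[OF cov_left_linear[OF U _ dF_fa] parts_linear(1), unfolded comp_def] .

text \<open>The skew part is the image under \<open>df\<close> of a Lie bracket and has no normal
  component.\<close>

lemma b_sym:
  assumes "vf X" "vf Y" "q \<in> U"
  shows "b X Y q = b Y X q"
proof -
  have "np q (cov X (dF Y) q - cov Y (dF X) q) = 0"
    by (simp only: cov_torsion_free[OF torsion_free U assms(3,1,2)] np_df)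
  then show ?thesis by (simp add: b_eq)
qed

lemma cov_dF_jF:
  assumes "vf Y" "q \<in> U"
  shows "cov X (dF (jF Y)) q = J (f q) (cov X (dF Y) q)"
  using cov_J[OF U assms(2) dF_fa[OF assms(1)]] by simp

text \<open>\<open>J\<close> commutes with the covariant derivative and, as it preserves both
  tangent and normal spaces, with the projections.\<close>

lemma b_jF_right: "vf Y \<Longrightarrow> q \<in> U \<Longrightarrow> b X (jF Y) q = J (f q) (b X Y q)"
  by (simp only: b_eq cov_dF_jF parts_J)

lemma b_jF_left: "vf X \<Longrightarrow> vf Y \<Longrightarrow> q \<in> U \<Longrightarrow> b (jF X) Y q = J (f q) (b X Y q)"
  by (simp only: b_sym[of _ Y] jF_vf b_jF_right)

lemma nab_jF: "vf X \<Longrightarrow> vf Y \<Longrightarrow> q \<in> U \<Longrightarrow> nab X (jF Y) q = j q (nab X Y q)"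
  by (simp only: nab_eq jF_vf cov_dF_jF parts_J)

lemma D_JF: "fa \<xi> \<Longrightarrow> q \<in> U \<Longrightarrow> D X (JF \<xi>) q = J (f q) (D X \<xi> q)"
  by (simp only: D_eq cov_J[OF U] parts_J)

lemma j_neg: "j q (- v) = - j q v"
  by (rule df_eq_iff[THEN iffD1, of q]) (simp del: df_eq_iff)

lemma Aw_JF: "fa \<xi> \<Longrightarrow> q \<in> U \<Longrightarrow> Aw (JF \<xi>) X q = j q (Aw \<xi> X q)"
  by (simp only: Aw_def cov_J[OF U] parts_J j_neg)

lemma D_cong: "(\<And>q. q \<in> U \<Longrightarrow> \<xi> q = \<eta> q) \<Longrightarrow> q \<in> U \<Longrightarrow> D X \<xi> q = D X \<eta> q"
  and Aw_cong: "(\<And>q. q \<in> U \<Longrightarrow> \<xi> q = \<eta> q) \<Longrightarrow> q \<in> U \<Longrightarrow> Aw \<xi> X q = Aw \<eta> X q"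
  unfolding D_eq Aw_def using cov_cong[OF U, of q \<xi> \<eta> X X] by simp_all

lemma D_add: "fa \<xi> \<Longrightarrow> fa \<eta> \<Longrightarrow> q \<in> U \<Longrightarrow> D X (\<lambda>q. \<xi> q + \<eta> q) q = D X \<xi> q + D X \<eta> q"
  by (simp add: D_eq cov_add[OF U])

lemma D_diff: "fa \<xi> \<Longrightarrow> fa \<eta> \<Longrightarrow> q \<in> U \<Longrightarrow> D X (\<lambda>q. \<xi> q - \<eta> q) q = D X \<xi> q - D X \<eta> q"
  by (simp add: D_eq cov_diff[OF U])

lemma D_scaleR:
  assumes "nf \<xi>" "smooth_fun B U h" "q \<in> U"
  shows "D X (\<lambda>q. h q *\<^sub>R \<xi> q) q = dird B h q (X q) *\<^sub>R \<xi> q + h q *\<^sub>R D X \<xi> q"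
  using assms by (simp add: D_eq cov_scaleR[OF U _ nf_fa] np_normal nf_NS)

lemma D_metric:
  assumes "nf \<xi>" "nf \<eta>" "q \<in> U"
  shows "dird B (\<lambda>q. g (f q) (\<xi> q) (\<eta> q)) q (X q) = g (f q) (D X \<xi> q) (\<eta> q) + g (f q) (\<xi> q) (D X \<eta> q)"
  using assms by (simp add: D_eq g_np nf_NS cov_metric[OF U _ nf_fa nf_fa])

text \<open>Obtained by differentiating the relation that \<open>\<xi>\<close> is orthogonal to
  \<open>df Y\<close>.\<close>

lemma Aw_adjoint:
  assumes "vf Y" "nf \<xi>" "q \<in> U"
  shows "g (f q) (df q (Aw \<xi> X q)) (df q (Y q)) = g (f q) (\<xi> q) (b X Y q)"
proof -
  have "dird B (\<lambda>q. g (f q) (\<xi> q) (df q (Y q))) q (X q) = dird B (\<lambda>q. 0) q (X q)"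
    by (rule src.dird_cong[OF U assms(3)]) (use NS_D nf_NS[OF assms(2)] in auto)
  then have "g (f q) (cov X \<xi> q) (df q (Y q)) + g (f q) (\<xi> q) (cov X (dF Y) q) = 0"
    using cov_metric[OF U assms(3) nf_fa[OF assms(2)] dF_fa[OF assms(1)], of X] by (simp add: src.dird_const)
  then show ?thesis
    using assms by (simp add: Aw_def b_eq g_df_tp g_np nf_NS)
qed

text \<open>Paired with \<open>Z\<close>, the left side gives \<open>g \<xi> (J (b X Z))\<close>.
  Since \<open>J A_\<xi>\<close> is the shape operator of \<open>J \<xi>\<close>, the other term
  gives \<open>g (J \<xi>) (b X Z)\<close>, which is its negative by skewness of
  \<open>J\<close>.\<close>

lemma Aw_jF:
  assumes "vf X" "nf \<xi>" "q \<in> U"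
  shows "Aw \<xi> (jF X) q = - j q (Aw \<xi> X q)"
proof -
  have X: "vf (Aw \<xi> (jF X))" "vf (jF (Aw \<xi> X))"
    by (intro Aw_vf jF_vf assms nf_fa)+
  have "Aw \<xi> (jF X) q + j q (Aw \<xi> X q) = 0"
  proof (rule zero_by_pairing[OF src.idm.field_along_add[OF U X] assms(3)])
    fix Z assume Z: "vf Z"
    have "g (f q) (df q (j q (Aw \<xi> X q))) (df q (Z q)) = g (f q) (df q (Aw (JF \<xi>) X q)) (df q (Z q))"
      by (simp only: Aw_JF[OF nf_fa[OF assms(2)] assms(3)])
    also have "\<dots> = g (f q) (J (f q) (\<xi> q)) (b X Z q)"
      by (rule Aw_adjoint[OF Z JF_nf[OF assms(2)] assms(3)])
    finally show "g (f q) (df q (Aw \<xi> (jF X) q + j q (Aw \<xi> X q))) (df q (Z q)) = 0"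
      using Aw_adjoint[OF Z assms(2,3), of "jF X"] b_jF_left[OF assms(1) Z assms(3)]
      by (simp add: g_J_left)
  qed
  then show ?thesis by (simp add: eq_neg_iff_add_eq_0)
qed

lemma cov_cov_normal:
  assumes "vf X" "vf Y" "nf \<xi>" "q \<in> U"
  shows "np q (cov X (cov Y \<xi>) q) = D X (D Y \<xi>) q - b X (Aw \<xi> Y) q"
proof -
  have "cov X (cov Y \<xi>) q = cov X (\<lambda>q. D Y \<xi> q - df q (Aw \<xi> Y q)) q"
    by (rule cov_cong[OF U assms(4)]) (simp_all only: weingarten)
  also have "\<dots> = cov X (D Y \<xi>) q - cov X (dF (Aw \<xi> Y)) q"
    by (rule cov_diff[OF U assms(4)]) (intro nf_fa D_nf dF_fa Aw_vf assms)+
  finally show ?thesis by (simp add: b_eq D_eq)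
qed

text \<open>The normal part of \<open>cov_curvature\<close>. For normal \<open>\<xi>\<close> the
  first four terms of \<open>Rt\<close> vanish, as \<open>\<xi>\<close> is orthogonal to tangent
  vectors and to their images under \<open>J\<close>; the last one contributes the factor
  \<open>2 * c / 4\<close>.\<close>

lemma ricci:
  assumes "vf X" "vf Y" "nf \<xi>" "q \<in> U"
  shows "normal_curv B A f g nabla X Y \<xi> q =
    (c / 2 * g (f q) (df q (X q)) (J (f q) (df q (Y q)))) *\<^sub>R J (f q) (\<xi> q)
    + (b X (Aw \<xi> Y) q - b Y (Aw \<xi> X) q)"
proof -
  have N: "\<xi> q \<in> NS q" by (rule nf_NS[OF assms(3,4)])
  have "np q (Rt (f q) (df q (X q)) (df q (Y q)) (\<xi> q))
      = (c / 2 * g (f q) (df q (X q)) (J (f q) (df q (Y q)))) *\<^sub>R J (f q) (\<xi> q)"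
    using NS_D(2)[OF N] NS_D(2)[OF N, of "j q _"]
    by (simp add: Rt_def np_normal[OF N])
  moreover have "np q (cov X (cov Y \<xi>) q - cov Y (cov X \<xi>) q - cov (lie_bracket B X Y) \<xi> q)
      = np q (Rt (f q) (df q (X q)) (df q (Y q)) (\<xi> q))"
    by (simp only: cov_curvature[OF U assms(4) nf_fa[OF assms(3)] assms(1,2)])
  ultimately show ?thesis
    using assms by (simp add: normal_curv_def cov_cov_normal D_eq[of "lie_bracket B X Y"] algebra_simps)
qed

lemma cov_cov_tangent:
  assumes "vf X" "vf Y" "vf Z" "q \<in> U"
  shows "np q (cov X (cov Y (dF Z)) q) = b X (nab Y Z) q + D X (b Y Z) q"
    and "tp q (cov X (cov Y (dF Z)) q) = nab X (nab Y Z) q - Aw (b Y Z) X q"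
proof -
  have "cov X (cov Y (dF Z)) q = cov X (\<lambda>q. df q (nab Y Z q) + b Y Z q) q"
    by (rule cov_cong[OF U assms(4)]) (simp_all add: gauss assms)
  also have "\<dots> = cov X (dF (nab Y Z)) q + cov X (b Y Z) q"
    by (rule cov_add[OF U assms(4)]) (intro nf_fa b_nf dF_fa nab_vf assms)+
  finally have *: "cov X (cov Y (dF Z)) q = cov X (dF (nab Y Z)) q + cov X (b Y Z) q" .
  show "np q (cov X (cov Y (dF Z)) q) = b X (nab Y Z) q + D X (b Y Z) q"
    unfolding * by (simp add: b_eq[of X] D_eq)
  show "tp q (cov X (cov Y (dF Z)) q) = nab X (nab Y Z) q - Aw (b Y Z) X q"
    unfolding * using assms by (simp add: nab_eq[of X] nab_vf Aw_def)
qed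

definition Rti :: "'q \<Rightarrow> 'f \<Rightarrow> 'f \<Rightarrow> 'f \<Rightarrow> 'f" where
  "Rti q x y z = tp q (Rt (f q) (df q x) (df q y) (df q z))"

text \<open>Every term of \<open>Rt\<close> is tangent when its arguments are, because tangent
  spaces are invariant under \<open>J\<close>.\<close>

lemma df_Rti: "df q (Rti q x y z) = Rt (f q) (df q x) (df q y) (df q z)"
  by (simp add: Rti_def df_tp Rt_def)

text \<open>The normal part of \<open>cov_curvature\<close> on tangent fields, where the curvature
  side is tangent and drops out. Torsion-freeness rewrites the bracket term as the two missing terms
  of the covariant derivatives of \<open>b\<close>.\<close>

lemma codazzi:
  assumes "vf X" "vf Y" "vf Z" "q \<in> U"
  shows "vdWB_second_ff B A f g nabla nab X Y Z q = vdWB_second_ff B A f g nabla nab Y X Z q"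
proof -
  have "np q (cov X (cov Y (dF Z)) q - cov Y (cov X (dF Z)) q - cov (lie_bracket B X Y) (dF Z) q) = 0"
    by (simp only: cov_curvature[OF U assms(4) dF_fa[OF assms(3)] assms(1,2)] df_Rti[symmetric] np_df)
  then have "b X (nab Y Z) q + D X (b Y Z) q - (b Y (nab X Z) q + D Y (b X Z) q)
      = b (lie_bracket B X Y) Z q"
    using assms by (simp add: cov_cov_tangent b_eq[of "lie_bracket B X Y"])
  also have "\<dots> = b (\<lambda>_. nab X Y q - nab Y X q) Z q"
    unfolding nab_torsion_free[OF assms(1,2,4)] by (rule b_pointwise)
  also have "\<dots> = b (nab X Y) Z q - b (nab Y X) Z q"
    unfolding linear_diff[OF b_linear[OF assms(3,4)]] b_pointwise[symmetric] ..
  finally show ?thesis by (simp add: vdWB_second_ff_def algebra_simps)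
qed

lemma gauss_equation:
  assumes "vf X" "vf Y" "vf Z" "q \<in> U"
  shows "curvature B nab X Y Z q
    = Rti q (X q) (Y q) (Z q) + Aw (b Y Z) X q - Aw (b X Z) Y q"
proof -
  have "tp q (cov X (cov Y (dF Z)) q - cov Y (cov X (dF Z)) q - cov (lie_bracket B X Y) (dF Z) q)
      = Rti q (X q) (Y q) (Z q)"
    by (simp only: cov_curvature[OF U assms(4) dF_fa[OF assms(3)] assms(1,2)] Rti_def)
  then show ?thesis
    using assms by (simp add: cov_cov_tangent curvature_def nab_eq[of "lie_bracket B X Y"] bracket_vf algebra_simps)
qed

text \<open>\<open>J\<close> can be pulled out of the tensor slots of the derivative of
  \<open>b\<close>, since \<open>b\<close>, \<open>D\<close> and \<open>nab\<close> are all
  compatible with it. Comparing this with the recurrence shows that the product of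
  \<open>\<mu>\<close> and \<open>b\<close> vanishes at each point, whichever factor is zero
  there.\<close>

lemma recurrent_imp_parallel:
  assumes rec: "\<And>X Y Z q. vf X \<Longrightarrow> vf Y \<Longrightarrow> vf Z \<Longrightarrow> q \<in> U \<Longrightarrow>
      vdWB_second_ff B A f g nabla nab X Y Z q = \<mu> q (X q) *\<^sub>R b Y Z q"
    and X: "vf X" and Y: "vf Y" and Z: "vf Z" and q: "q \<in> U"
  shows "vdWB_second_ff B A f g nabla nab X Y Z q = 0"
proof -
  let ?W = "vdWB_second_ff B A f g nabla nab"
  have WJ: "?W Y (jF X) Z q = J (f q) (?W Y X Z q)"
  proof -
    have "D Y (b (jF X) Z) q = D Y (JF (b X Z)) q"
      by (rule D_cong[OF _ q]) (rule b_jF_left[OF X Z])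
    also have "\<dots> = J (f q) (D Y (b X Z) q)" by (rule D_JF[OF nf_fa[OF b_nf[OF X Z]] q])
    finally have 1: "D Y (b (jF X) Z) q = J (f q) (D Y (b X Z) q)" .
    have "b (nab Y (jF X)) Z q = b (jF (nab Y X)) Z q"
      using b_pointwise[of "nab Y (jF X)" Z q] b_pointwise[of "jF (nab Y X)" Z q] nab_jF[OF Y X q] by simp
    also have "\<dots> = J (f q) (b (nab Y X) Z q)" by (rule b_jF_left[OF nab_vf[OF Y X] Z q])
    finally have 2: "b (nab Y (jF X)) Z q = J (f q) (b (nab Y X) Z q)" .
    show ?thesis
      by (simp add: vdWB_second_ff_def 1 2 b_jF_left[OF X nab_vf[OF Y Z] q])
  qed
  \<comment> \<open>Codazzi moves \<open>j X\<close> from the direction slot to a tensor slot, where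
    \<open>J\<close> comes out, and then moves \<open>X\<close> back.\<close>
  have "?W (jF X) Y Z q = J (f q) (?W X Y Z q)"
    using codazzi[OF jF_vf[OF X] Y Z q] WJ codazzi[OF X Y Z q] by simp
  then have "\<mu> q (j q (X q)) *\<^sub>R b Y Z q = \<mu> q (X q) *\<^sub>R J (f q) (b Y Z q)"
    by (simp add: rec[OF X Y Z q] rec[OF jF_vf[OF X] Y Z q])
  \<comment> \<open>Pairing with \<open>J b\<close> kills the left side, as \<open>J b\<close> is
    orthogonal to \<open>b\<close>, and leaves \<open>\<mu>\<close> times the squared length of
    \<open>b\<close> on the right.\<close>
  then have "g (f q) (J (f q) (b Y Z q)) (\<mu> q (j q (X q)) *\<^sub>R b Y Z q)
      = g (f q) (J (f q) (b Y Z q)) (\<mu> q (X q) *\<^sub>R J (f q) (b Y Z q))" by simp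
  then have "\<mu> q (X q) * g (f q) (b Y Z q) (b Y Z q) = 0" by (simp add: g_J)
  then have "\<mu> q (X q) *\<^sub>R b Y Z q = 0" by simp
  then show ?thesis by (simp add: rec[OF X Y Z q])
qed

end

section \<open>Submanifolds with parallel second fundamental form\<close>

locale kaehler_sub_parallel = kaehler_sub_on B A f nabla J g c nab U
  for B :: "('q::{t2_space,second_countable_topology}, 'f::euclidean_space) atlas"
    and A :: "('p::{t2_space,second_countable_topology}, 'e::euclidean_space) atlas"
    and f :: "'q \<Rightarrow> 'p"
    and nabla :: "('p \<Rightarrow> 'e) \<Rightarrow> ('p \<Rightarrow> 'e) \<Rightarrow> 'p \<Rightarrow> 'e"
    and J :: "'p \<Rightarrow> 'e \<Rightarrow> 'e" and g :: "'p \<Rightarrow> 'e \<Rightarrow> 'e \<Rightarrow> real" and c :: real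
    and nab :: "('q \<Rightarrow> 'f) \<Rightarrow> ('q \<Rightarrow> 'f) \<Rightarrow> 'q \<Rightarrow> 'f"
    and U :: "'q set" +
  assumes parallel: "vf X \<Longrightarrow> vf Y \<Longrightarrow> vf Z \<Longrightarrow> q \<in> U \<Longrightarrow> vdWB_second_ff B A f g nabla nab X Y Z q = 0"
begin

lemma D_b: "vf X \<Longrightarrow> vf Y \<Longrightarrow> vf Z \<Longrightarrow> q \<in> U \<Longrightarrow> D X (b Y Z) q = b (nab X Y) Z q + b Y (nab X Z) q"
  using parallel[of X Y Z q] by (simp add: vdWB_second_ff_def algebra_simps)

text \<open>Parallelism of the shape operator: differentiate the adjointness relation with
  \<open>b\<close>, use that \<open>b\<close>, the metric and the normal metric are parallel, and
  test against every \<open>Z\<close>.\<close>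

lemma nab_Aw:
  assumes X: "vf X" and Y: "vf Y" and \<xi>: "nf \<xi>" and q: "q \<in> U"
  shows "nab X (Aw \<xi> Y) q = Aw (D X \<xi>) Y q + Aw \<xi> (nab X Y) q"
proof -
  have A1: "vf (Aw \<xi> Y)" "vf (Aw (D X \<xi>) Y)" "vf (Aw \<xi> (nab X Y))"
    by (intro Aw_vf nab_vf nf_fa D_nf X Y \<xi>)+
  have "nab X (Aw \<xi> Y) q - Aw (D X \<xi>) Y q - Aw \<xi> (nab X Y) q = 0"
  proof (rule zero_by_pairing[OF src.idm.field_along_diff[OF U
          src.idm.field_along_diff[OF U nab_vf[OF X A1(1)] A1(2)] A1(3)] q])
    fix Z assume Z: "vf Z"
    have "dird B (\<lambda>q. g (f q) (df q (Aw \<xi> Y q)) (df q (Z q))) q (X q)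
        = dird B (\<lambda>q. g (f q) (\<xi> q) (b Y Z q)) q (X q)"
      by (rule src.dird_cong[OF U q]) (rule Aw_adjoint[OF Z \<xi>])
    then have "g (f q) (df q (nab X (Aw \<xi> Y) q)) (df q (Z q)) + g (f q) (df q (Aw \<xi> Y q)) (df q (nab X Z q))
        = g (f q) (D X \<xi> q) (b Y Z q) + g (f q) (\<xi> q) (D X (b Y Z) q)"
      by (simp only: nab_metric[OF X A1(1) Z q] D_metric[OF \<xi> b_nf[OF Y Z] q])
    then show "g (f q) (df q (nab X (Aw \<xi> Y) q - Aw (D X \<xi>) Y q - Aw \<xi> (nab X Y) q)) (df q (Z q)) = 0"
      by (simp add: D_b[OF X Y Z q] Aw_adjoint[OF Z D_nf[OF X \<xi>] q] Aw_adjoint[OF Z \<xi> q]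
          Aw_adjoint[OF nab_vf[OF X Z] \<xi> q])
  qed
  then show ?thesis by (simp add: algebra_simps)
qed

lemma D_b_Aw:
  assumes X: "vf X" and Y: "vf Y" and Z: "vf Z" and \<xi>: "nf \<xi>" and q: "q \<in> U"
  shows "D X (b Y (Aw \<xi> Z)) q = b (nab X Y) (Aw \<xi> Z) q + b Y (Aw (D X \<xi>) Z) q + b Y (Aw \<xi> (nab X Z)) q"
proof -
  have A1: "vf (Aw \<xi> Z)" "vf (Aw (D X \<xi>) Z)" "vf (Aw \<xi> (nab X Z))"
    by (intro Aw_vf nab_vf nf_fa D_nf X Z \<xi>)+
  have "b Y (nab X (Aw \<xi> Z)) q = b (\<lambda>_. nab X (Aw \<xi> Z) q) Y q"
    unfolding b_sym[OF Y nab_vf[OF X A1(1)] q] by (rule b_pointwise)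
  also have "\<dots> = b Y (Aw (D X \<xi>) Z) q + b Y (Aw \<xi> (nab X Z)) q"
    unfolding nab_Aw[OF X Z \<xi> q] linear_add[OF b_linear[OF Y q]] b_pointwise[symmetric]
      b_sym[OF Y A1(2) q] b_sym[OF Y A1(3) q] ..
  finally show ?thesis by (simp add: D_b[OF X Y A1(1) q] add.assoc)
qed

text \<open>Differentiating the Ricci formula by the Leibniz rule gives, term by term, the same
  formula with one of \<open>Y\<close>, \<open>Z\<close>, \<open>\<xi>\<close> replaced by its
  derivative; the Ricci formula read backwards identifies the three sums.\<close>

lemma normal_curv_parallel_on:
  assumes X: "vf X" and Y: "vf Y" and Z: "vf Z" and \<xi>: "nf \<xi>" and q: "q \<in> U"
  shows "vdWB_normal_curv B A f g nabla nab X Y Z \<xi> q = 0"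
proof -
  \<comment> \<open>The scalar coefficient in the Ricci formula, up to \<open>c / 2\<close> the
    Kaehler form.\<close>
  define k where "k Y Z q = c / 2 * g (f q) (df q (Y q)) (J (f q) (df q (Z q)))" for Y Z q
  have k_smooth: "smooth_fun B U (k Y Z)"
    unfolding k_def[abs_def]
    by (rule src.smooth_fun_bounded_linear[OF U bounded_linear_mult_right
          metric_smooth[OF U dF_fa[OF Y] J_field_along[OF U dF_fa[OF Z]]]])
  have J_tan: "g (f q) \<eta> (J (f q) (df q v)) = 0" "g (f q) (df q v) (J (f q) \<eta>) = 0" if "\<eta> \<in> NS q" for \<eta> v
    using NS_D(1)[OF that, of "j q v"] NS_D(2)[OF J_normal[OF that]] by simp_all
  \<comment> \<open>The ambient derivatives differ from the induced ones by values of
    \<open>b\<close>, which are orthogonal to the tangent vectors that occur here.\<close>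
  have dk: "dird B (k Y Z) q (X q) = k (nab X Y) Z q + k Y (nab X Z) q"
  proof -
    have "dird B (k Y Z) q (X q)
        = c / 2 * dird B (\<lambda>q. g (f q) (df q (Y q)) (J (f q) (df q (Z q)))) q (X q)"
      unfolding k_def[abs_def]
      by (rule src.dird_bounded_linear[OF metric_smooth[OF U dF_fa[OF Y] J_field_along[OF U dF_fa[OF Z]]]
            U q bounded_linear_mult_right])
    then show ?thesis
      by (simp add: cov_metric[OF U q dF_fa[OF Y] J_field_along[OF U dF_fa[OF Z]]]
          cov_J[OF U q dF_fa[OF Z]] gauss X Y Z q J_tan k_def distrib_left)
  qed
  have AwY: "vf (Aw \<xi> Y)" and AwZ: "vf (Aw \<xi> Z)" by (intro Aw_vf nf_fa Y Z \<xi>)+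
  have "D X (normal_curv B A f g nabla Y Z \<xi>) q
      = D X (\<lambda>q. k Y Z q *\<^sub>R J (f q) (\<xi> q) + (b Y (Aw \<xi> Z) q - b Z (Aw \<xi> Y) q)) q"
    by (rule D_cong[OF _ q]) (simp add: ricci Y Z \<xi> k_def)
  also have "\<dots> = D X (\<lambda>q. k Y Z q *\<^sub>R J (f q) (\<xi> q)) q + D X (\<lambda>q. b Y (Aw \<xi> Z) q - b Z (Aw \<xi> Y) q) q"
    by (rule D_add[OF field_along_scaleR[OF U k_smooth nf_fa[OF JF_nf[OF \<xi>]]]
          field_along_diff[OF U nf_fa[OF b_nf[OF Y AwZ]] nf_fa[OF b_nf[OF Z AwY]]] q])
  also have "D X (\<lambda>q. k Y Z q *\<^sub>R J (f q) (\<xi> q)) q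
      = (k (nab X Y) Z q + k Y (nab X Z) q) *\<^sub>R J (f q) (\<xi> q) + k Y Z q *\<^sub>R J (f q) (D X \<xi> q)"
    unfolding D_scaleR[OF JF_nf[OF \<xi>] k_smooth q] dk D_JF[OF nf_fa[OF \<xi>] q] ..
  also have "D X (\<lambda>q. b Y (Aw \<xi> Z) q - b Z (Aw \<xi> Y) q) q = D X (b Y (Aw \<xi> Z)) q - D X (b Z (Aw \<xi> Y)) q"
    by (rule D_diff[OF nf_fa[OF b_nf[OF Y AwZ]] nf_fa[OF b_nf[OF Z AwY]] q])
  finally show ?thesis
    by (simp add: vdWB_normal_curv_def ricci[OF nab_vf[OF X Y] Z \<xi> q] ricci[OF Y nab_vf[OF X Z] \<xi> q]
        ricci[OF Y Z D_nf[OF X \<xi>] q] D_b_Aw[OF X Y Z \<xi> q] D_b_Aw[OF X Z Y \<xi> q] k_def algebra_simps)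
qed

text \<open>Since \<open>b\<close> is parallel, two normal derivatives of \<open>b Z W\<close> fall
  entirely on \<open>Z\<close> and \<open>W\<close>. The mixed terms, with one derivative on each,
  are symmetric in \<open>X\<close> and \<open>Y\<close> and cancel in the commutator.\<close>

lemma ricci_identity:
  assumes X: "vf X" and Y: "vf Y" and Z: "vf Z" and W: "vf W" and q: "q \<in> U"
  shows "normal_curv B A f g nabla X Y (b Z W) q
    = b (curvature B nab X Y Z) W q + b Z (curvature B nab X Y W) q"
proof -
  have DD: "D X (D Y (b Z W)) q = b (nab X (nab Y Z)) W q + b (nab Y Z) (nab X W) q
      + b (nab X Z) (nab Y W) q + b Z (nab X (nab Y W)) q" if X: "vf X" and Y: "vf Y" for X Y
  proof -
    have "D X (D Y (b Z W)) q = D X (\<lambda>q. b (nab Y Z) W q + b Z (nab Y W) q) q"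
      by (rule D_cong[OF _ q]) (rule D_b[OF Y Z W])
    also have "\<dots> = D X (b (nab Y Z) W) q + D X (b Z (nab Y W)) q"
      by (rule D_add[OF nf_fa[OF b_nf] nf_fa[OF b_nf] q]) (intro nab_vf Y Z W)+
    finally show ?thesis
      by (simp add: D_b[OF X nab_vf[OF Y Z] W q] D_b[OF X Z nab_vf[OF Y W] q] add.assoc)
  qed
  let ?R = "curvature B nab X Y"
  have R: "vf (?R V)" if "vf V" for V
    unfolding curvature_def[abs_def]
    by (intro src.idm.field_along_diff[OF U] nab_vf bracket_vf X Y that)
  have left: "b (?R V) V' q = b (nab X (nab Y V)) V' q - b (nab Y (nab X V)) V' q
      - b (nab (lie_bracket B X Y) V) V' q" if "vf V'" for V V'
    unfolding b_pointwise[of "?R V"] curvature_def linear_diff[OF b_linear[OF that q]]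
      b_pointwise[symmetric] ..
  have right: "b Z (?R W) q = b Z (nab X (nab Y W)) q - b Z (nab Y (nab X W)) q
      - b Z (nab (lie_bracket B X Y) W) q"
    using left[OF Z, of W] by (simp add: b_sym[OF Z] R nab_vf bracket_vf X Y W q)
  show ?thesis
    unfolding normal_curv_def DD[OF X Y] DD[OF Y X] D_b[OF bracket_vf[OF X Y] Z W q] left[OF W] right
    by (simp add: algebra_simps)
qed

text \<open>Polarization of the symmetric form \<open>b\<close>; the vanishing argument treats only
  its diagonal values.\<close>

lemma ex_diagonal:
  assumes Y: "vf Y" and Z: "vf Z" and q: "q \<in> U" and ne: "b Y Z q \<noteq> 0"
  obtains X where "vf X" "b X X q \<noteq> 0"
proof -
  let ?S = "\<lambda>q. Y q + Z q"
  have S: "vf ?S" by (rule src.idm.field_along_add[OF U Y Z])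
  have add: "b ?S V q = b Y V q + b Z V q" if "vf V" for V
    unfolding b_pointwise[of ?S] linear_add[OF b_linear[OF that q]] b_pointwise[symmetric] ..
  have "b ?S ?S q = b Y Y q + b Y Z q + (b Y Z q + b Z Z q)"
    by (simp only: add[OF S] b_sym[OF Y S q] b_sym[OF Z S q] add[OF Y] add[OF Z] b_sym[OF Z Y q])
  then have "b ?S ?S q \<noteq> 0 \<or> b Y Y q \<noteq> 0 \<or> b Z Z q \<noteq> 0"
    using ne by (auto simp flip: scaleR_2)
  then show ?thesis using that S Y Z by blast
qed

text \<open>Both the Ricci equation and the Ricci identity are evaluated on the pair
  \<open>X\<close>, \<open>jF X\<close>. There the two shape operator terms add up instead of
  cancelling, because \<open>A_\<xi>\<close> anticommutes with \<open>J\<close>.\<close>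

lemma flat_normal_bundle_imp_b_diagonal_zero:
  assumes flat: "\<And>X Y \<xi> q. vf X \<Longrightarrow> vf Y \<Longrightarrow> nf \<xi> \<Longrightarrow> q \<in> U \<Longrightarrow> normal_curv B A f g nabla X Y \<xi> q = 0"
    and X: "vf X" and q: "q \<in> U"
  shows "b X X q = 0"
proof -
  define \<xi> where "\<xi> = b X X"
  define n where "n = g (f q) (df q (X q)) (df q (X q))"
  have jX: "vf (jF X)" by (rule jF_vf[OF X])
  have \<xi>: "nf \<xi>" unfolding \<xi>_def by (rule b_nf[OF X X])
  have a: "vf (Aw \<xi> X)" by (rule Aw_vf[OF X nf_fa[OF \<xi>]])
  define \<eta> where "\<eta> = b (Aw \<xi> X) X q"
  note lin = b_linear[OF X q]
  have J_inj: "J (f q) w = 0 \<Longrightarrow> w = 0" for w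
    using J_J[of "f q" w] by simp
  have b_j: "b (\<lambda>_. j q (V q)) X q = J (f q) (b V X q)" if "vf V" for V
    using b_jF_left[OF that X q] b_pointwise[of "jF V" X q] by simp
  have 1: "b X (Aw \<xi> (jF X)) q = - J (f q) \<eta>"
  proof -
    have "b X (Aw \<xi> (jF X)) q = b (\<lambda>_. Aw \<xi> (jF X) q) X q"
      unfolding b_sym[OF X Aw_vf[OF jX nf_fa[OF \<xi>]] q] by (rule b_pointwise)
    also have "\<dots> = - J (f q) \<eta>"
      by (simp only: Aw_jF[OF X \<xi> q] linear_neg[OF lin] b_j[OF a] \<eta>_def)
    finally show ?thesis .
  qed
  have 2: "b (jF X) (Aw \<xi> X) q = J (f q) \<eta>"
    by (simp only: b_jF_left[OF X a q] b_sym[OF X a q] \<eta>_def)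
  \<comment> \<open>The sign comes from \<open>g X (J (J X)) = - n\<close>; by \<open>1\<close> and
    \<open>2\<close> the two terms with \<open>b\<close> contribute \<open>- J \<eta>\<close>
    each.\<close>
  have "J (f q) ((c / 2 * n) *\<^sub>R \<xi> q + 2 *\<^sub>R \<eta>) = - normal_curv B A f g nabla X (jF X) \<xi> q"
    by (simp add: ricci[OF X jX \<xi> q] 1 2 n_def scaleR_2 algebra_simps)
  then have "J (f q) ((c / 2 * n) *\<^sub>R \<xi> q + 2 *\<^sub>R \<eta>) = 0"
    by (simp only: flat[OF X jX \<xi> q] minus_zero)
  then have I: "(c / 2 * n) *\<^sub>R \<xi> q + 2 *\<^sub>R \<eta> = 0" by (rule J_inj)
  have R: "curvature B nab X (jF X) X q = (- c * n) *\<^sub>R j q (X q) + 2 *\<^sub>R j q (Aw \<xi> X q)"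
  proof -
    \<comment> \<open>As \<open>J X\<close> is orthogonal to \<open>X\<close>, three terms of
      \<open>Rt\<close> survive, with coefficients \<open>- n\<close>, \<open>- n\<close> and
      \<open>- 2 n\<close>; their sum \<open>- 4 n\<close> meets the factor
      \<open>c / 4\<close>.\<close>
    have "Rti q (X q) (j q (X q)) (X q) = (- c * n) *\<^sub>R j q (X q)"
    proof (rule df_eq_iff[THEN iffD1, of q])
      let ?w = "J (f q) (df q (X q))"
      have [simp]: "g (f q) (df q (X q)) ?w = 0" by (simp add: g_commute[of _ "df q (X q)"])
      have "df q (Rti q (X q) (j q (X q)) (X q)) = (c / 4) *\<^sub>R (- n *\<^sub>R ?w - n *\<^sub>R ?w - (2 * n) *\<^sub>R ?w)"
        by (simp add: df_Rti Rt_def n_def)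
      also have "- n *\<^sub>R ?w - n *\<^sub>R ?w - (2 * n) *\<^sub>R ?w = (- 4 * n) *\<^sub>R ?w"
        by (simp only: scaleR_left_diff_distrib[symmetric], simp)
      finally show "df q (Rti q (X q) (j q (X q)) (X q)) = df q ((- c * n) *\<^sub>R j q (X q))" by simp
    qed
    \<comment> \<open>The first shape term of the Gauss equation; the second,
      \<open>- A_\<xi> (J X)\<close>, equals the same vector, hence the factor 2.\<close>
    moreover have "Aw (b (jF X) X) X q = j q (Aw \<xi> X q)"
      unfolding Aw_JF[OF nf_fa[OF \<xi>] q, symmetric]
      by (rule Aw_cong[OF _ q]) (simp only: b_jF_left[OF X X] \<xi>_def)
    ultimately show ?thesis
      using gauss_equation[OF X jX X q] Aw_jF[OF X \<xi> q] by (simp add: \<xi>_def scaleR_2)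
  qed
  have Rv: "vf (curvature B nab X (jF X) X)"
    unfolding curvature_def[abs_def]
    by (intro src.idm.field_along_diff[OF U] nab_vf bracket_vf X jX)
  have "b (curvature B nab X (jF X) X) X q = J (f q) ((- c * n) *\<^sub>R \<xi> q + 2 *\<^sub>R \<eta>)"
    unfolding b_pointwise[of "curvature _ _ _ _ _"] R linear_add[OF lin] linear_cmul[OF lin]
      b_j[OF X] b_j[OF a] by (simp add: \<xi>_def \<eta>_def)
  \<comment> \<open>With both arguments of \<open>b\<close> equal to \<open>X\<close>, the two terms
    of the Ricci identity coincide by symmetry.\<close>
  moreover have "2 *\<^sub>R b (curvature B nab X (jF X) X) X q = 0"
    using ricci_identity[OF X jX X X q] flat[OF X jX \<xi> q] b_sym[OF X Rv q]
    by (simp add: \<xi>_def scaleR_2)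
  ultimately have "J (f q) ((- c * n) *\<^sub>R \<xi> q + 2 *\<^sub>R \<eta>) = 0" by simp
  then have II: "(- c * n) *\<^sub>R \<xi> q + 2 *\<^sub>R \<eta> = 0" by (rule J_inj)
  \<comment> \<open>The common multiple of \<open>\<xi>\<close> is eliminated, giving
    \<open>6 \<eta> = 0\<close> without a division by \<open>c\<close> or \<open>n\<close>.\<close>
  have "2 *\<^sub>R \<eta> = (c * n) *\<^sub>R \<xi> q" using II by simp
  also have "\<dots> = 2 *\<^sub>R (c / 2 * n) *\<^sub>R \<xi> q" by simp
  also have "(c / 2 * n) *\<^sub>R \<xi> q = - (2 *\<^sub>R \<eta>)" using I by (simp only: eq_neg_iff_add_eq_0)
  finally have "2 *\<^sub>R \<eta> + 4 *\<^sub>R \<eta> = 0" by simp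
  then have "\<eta> = 0" by (simp flip: scaleR_left_distrib)
  have "g (f q) (df q (Aw \<xi> X q)) (df q (Aw \<xi> X q)) = g (f q) (\<xi> q) \<eta>"
    unfolding Aw_adjoint[OF a \<xi> q] \<eta>_def b_sym[OF X a q] ..
  then have "Aw \<xi> X q = 0" using \<open>\<eta> = 0\<close> by simp
  then have "g (f q) (\<xi> q) (\<xi> q) = 0"
    using Aw_adjoint[OF X \<xi> q, of X] by (simp add: \<xi>_def)
  then show ?thesis by (simp add: \<xi>_def)
qed

end

theorem theorem0p1:
  fixes A :: "('p::{t2_space,second_countable_topology}, 'e::euclidean_space) atlas"
    and B :: "('q::{t2_space,second_countable_topology}, 'f::euclidean_space) atlas"
    and J :: "'p \<Rightarrow> 'e \<Rightarrow> 'e"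
    and g :: "'p \<Rightarrow> 'e \<Rightarrow> 'e \<Rightarrow> real"
    and nabla :: "('p \<Rightarrow> 'e) \<Rightarrow> ('p \<Rightarrow> 'e) \<Rightarrow> 'p \<Rightarrow> 'e"
    and nab :: "('q \<Rightarrow> 'f) \<Rightarrow> ('q \<Rightarrow> 'f) \<Rightarrow> 'q \<Rightarrow> 'f"
    and f :: "'q \<Rightarrow> 'p"
    and m l :: nat
    and c :: real
  assumes "m \<ge> 1" and "l \<ge> 1"
    and "DIM('e) = 2 * m + 2 * l" and "DIM('f) = 2 * m"
    and "kaehler_manifold A J g nabla"
    and "const_holo_sect_curvature A J g nabla c"
    and "kaehler_submanifold B A f J"
    and "levi_civita B (induced_metric B A f g) nab"
    and "recurrent_second_ff B A f g nabla nab"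
  shows "normal_curv_nonzero B A f g nabla \<and> normal_curv_parallel B A f g nabla nab"
proof -
  interpret kaehler_sub B A f nabla J g c nab
    using assms(5-8)
    by unfold_locales
      (auto simp: kaehler_manifold_def kaehler_submanifold_def immersion_def levi_civita_def)
  obtain \<mu> where \<mu>: "\<forall>U X Y Z. open U \<and> vector_field B U X \<and> vector_field B U Y \<and> vector_field B U Z \<longrightarrow>
      (\<forall>q\<in>U. vdWB_second_ff B A f g nabla nab X Y Z q = \<mu> q (X q) *\<^sub>R second_ff B A f g nabla Y Z q)"
    using assms(9) unfolding recurrent_second_ff_def by (elim conjE exE)
  \<comment> \<open>Stated for every open \<open>U\<close>: parallelism of the normal curvature is
    claimed on all open sets, while the nonvanishing of \<open>b\<close> is known on one of
    them.\<close>
  have par: "kaehler_sub_parallel B A f nabla J g c nab U" if "open U" for U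
  proof -
    interpret kaehler_sub_on B A f nabla J g c nab U by unfold_locales (rule that)
    show ?thesis
      by unfold_locales (rule recurrent_imp_parallel[of \<mu>], use \<mu> that in auto)
  qed
  obtain U Y Z q where S: "open U" "vector_field B U Y" "vector_field B U Z" "q \<in> U"
    and ne: "second_ff B A f g nabla Y Z q \<noteq> 0"
    using assms(9) unfolding recurrent_second_ff_def by blast
  interpret kaehler_sub_parallel B A f nabla J g c nab U by (rule par[OF S(1)])
  obtain X where X: "vector_field B U X" "second_ff B A f g nabla X X q \<noteq> 0"
    using ex_diagonal[OF S(2-4) ne] .
  \<comment> \<open>By contraposition: without such a witness on this \<open>U\<close>, the lemma
    for flat normal bundles would force \<open>b X X\<close> to vanish at \<open>q\<close>.\<close>
  have "normal_curv_nonzero B A f g nabla"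
    using flat_normal_bundle_imp_b_diagonal_zero[OF _ X(1) S(4)] X(2) S(1) unfolding normal_curv_nonzero_def by blast
  moreover have "normal_curv_parallel B A f g nabla nab"
    unfolding normal_curv_parallel_def
    using kaehler_sub_parallel.normal_curv_parallel_on[OF par] by blast
  ultimately show ?thesis ..
qed

end
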